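(* Let $(X,\rho,\mu)$ be a space of homogeneous type. Assume that for some family of pairs $(f,g)$ of nonnegative functions on $X$, for some $p_0\in[1,\infty)$, and for all $w\in A_{p_0}$ we have $$\left(\int_X g^{p_0}w\,d\mu\right)^{1/p_0}\le C\,N([w]_{A_{p_0}})\left(\int_X f^{p_0}w\,d\mu\right)^{1/p_0},$$ where $N$ is an increasing function and the constant $C$ does not depend on $w$. Then for all $1<p<\infty$ and all $w\in A_p$ we have $$\left(\int_X g^{p}w\,d\mu\right)^{1/p}\le C\,K(w)\left(\int_X f^{p}w\,d\mu\right)^{1/p},$$ where $$K(w)=\begin{cases}N\!\left([w]_{A_p}\,(2\|M\|_{L^p(w)})^{p_0-p}\right), & \text{if } p<p_0,\\[2pt] N([w]_{A_p}), & \text{if } p=p_0,\\[2pt] N\!\left([w]_{A_p}^{\frac{p_0-1}{p-1}}\,(2\|M\|_{L^{p'}(w^{1-p'})})^{\frac{p-p_0}{p-1}}\right), & \text{if } p>p_0,\end{cases}$$ and $p'=p/(p-1)$. In particular, $K(w)\le C_1\,N\!\left(C_2\,[w]_{A_p}^{\max\{1,\frac{p_0-1}{p-1}\}}\right)$ for $w\in A_p$, where $C_2$ is an absolute constant, that is, a constant depending only on the space $(X,\rho,\mu)$.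
   Context: Space of homogeneous type: a triple $(X,\rho,\mu)$ where $\rho$ is a quasimetric on the set $X$ ($\rho(x,y)=0$ iff $x=y$; $\rho(x,y)=\rho(y,x)$; $\rho(x,z)\le\kappa(\rho(x,y)+\rho(y,z))$ for some constant $\kappa>0$) and $\mu$ is a positive doubling measure: $0<\mu(B(x_0,2r))\le D_\mu\,\mu(B(x_0,r))<\infty$. A dyadic decomposition of $X$ is a family $\mathcal D=\bigcup_{k\in\mathbb Z}\mathcal D_k$ of sets ("cubes") with points $x_c(Q)$, $Q\in\mathcal D$, and constants $\delta>1$, $0<C_0,\varepsilon<\infty$ such that: $X=\bigcup_{Q\in\mathcal D_k}Q$ for each $k$; two cubes that intersect are nested; every $Q\in\mathcal D_k$ has at least one child in $\mathcal D_{k-1}$ contained in $Q$ and exactly one parent in $\mathcal D_{k+1}$ containing $Q$; $\mu(Q_2)\ge\varepsilon\mu(Q_1)$ if $Q_2$ is a child of $Q_1$; $B(x_c(Q),\delta^k)\subset Q\subset B(x_c(Q),C_0\delta^k)$ for $Q\in\mathcal D_k$. Such a decomposition exists, and "cube" means dyadic cube. $M$ is the Hardy–Littlewood maximal operator $Mf(x)=\sup_{Q\ni x}\frac1{\mu(Q)}\int_Q|f|\,d\mu$, supremum over cubes; $\|M\|_{L^p(w)}$ denotes the operator norm of $M$ on $L^p(w)=L^p(X,w\,d\mu)$. A weight is a nonnegative locally integrable function with values in $(0,\infty)$ a.e. For $1<p<\infty$, $[w]_{A_p}=\sup_Q\left(\frac1{\mu(Q)}\int_Q w\,d\mu\right)\left(\frac1{\mu(Q)}\int_Q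 w^{1-p'}d\mu\right)^{p-1}$, and $[w]_{A_1}=\sup_Q\left(\frac1{\mu(Q)}\int_Q w\,d\mu\right)\operatorname{ess\,sup}_Q w^{-1}$, suprema over cubes; $w\in A_p$ means that $w$ is a weight with $[w]_{A_p}<\infty$. Constants denoted $C$, possibly different at each occurrence, are independent of the weight.
   Formalization: The constant C_2 (like C_1) may depend on the exponents p_0 and p, not only on the space; with C_2 depending only on the space the claim fails (N = exp and power weights on the line force C_2 ≥ (p')^{p_0-p}, which is unbounded as p → 1). *)

theory Defs
  imports "HOL-Probability.Essential_Supremum"
begin

text \<open>The underlying set \<open>X\<close> is \<open>space M\<close>, and \<open>M\<close> is the measure \<open>\<mu>\<close> together with
  its \<open>\<sigma>\<close>-algebra. Quasimetric balls need not be open for the topology they generate, so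
  their measurability is a separate requirement.\<close>

definition qball :: "'a measure \<Rightarrow> ('a \<Rightarrow> 'a \<Rightarrow> real) \<Rightarrow> 'a \<Rightarrow> real \<Rightarrow> 'a set" where
  "qball M \<rho> x r = {y \<in> space M. \<rho> x y < r}"

definition quasimetric_on :: "'a set \<Rightarrow> ('a \<Rightarrow> 'a \<Rightarrow> real) \<Rightarrow> bool" where
  "quasimetric_on X \<rho> \<longleftrightarrow>
     (\<forall>x\<in>X. \<forall>y\<in>X. 0 \<le> \<rho> x y \<and> (\<rho> x y = 0 \<longleftrightarrow> x = y) \<and> \<rho> x y = \<rho> y x) \<and>
     (\<exists>\<kappa>>0. \<forall>x\<in>X. \<forall>y\<in>X. \<forall>z\<in>X. \<rho> x z \<le> \<kappa> * (\<rho> x y + \<rho> y z))"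

definition space_of_homogeneous_type :: "'a measure \<Rightarrow> ('a \<Rightarrow> 'a \<Rightarrow> real) \<Rightarrow> bool" where
  "space_of_homogeneous_type M \<rho> \<longleftrightarrow>
     space M \<noteq> {} \<and> quasimetric_on (space M) \<rho> \<and>
     (\<forall>x\<in>space M. \<forall>r>0. qball M \<rho> x r \<in> sets M) \<and>
     (\<exists>D_mu::real. \<forall>x\<in>space M. \<forall>r>0.
        0 < emeasure M (qball M \<rho> x (2 * r)) \<and>
        emeasure M (qball M \<rho> x (2 * r)) \<le> ennreal D_mu * emeasure M (qball M \<rho> x r) \<and>
        ennreal D_mu * emeasure M (qball M \<rho> x r) < \<infinity>)"

text \<open>\<open>\<D> k\<close> is the family of cubes of generation \<open>k\<close>. Larger \<open>k\<close> means larger cubes.\<close>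

definition cubes :: "(int \<Rightarrow> 'a set set) \<Rightarrow> 'a set set" where
  "cubes \<D> = (\<Union>k. \<D> k)"

definition dyadic_decomposition ::
    "'a measure \<Rightarrow> ('a \<Rightarrow> 'a \<Rightarrow> real) \<Rightarrow> (int \<Rightarrow> 'a set set) \<Rightarrow> bool" where
  "dyadic_decomposition M \<rho> \<D> \<longleftrightarrow>
     cubes \<D> \<subseteq> sets M \<and>
     (\<forall>k. space M = \<Union>(\<D> k)) \<and>
     (\<forall>Q\<in>cubes \<D>. \<forall>R\<in>cubes \<D>. Q \<inter> R \<noteq> {} \<longrightarrow> Q \<subseteq> R \<or> R \<subseteq> Q) \<and>
     (\<forall>k. \<forall>Q\<in>\<D> k. \<exists>R\<in>\<D> (k - 1). R \<subseteq> Q) \<and>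
     (\<forall>k. \<forall>Q\<in>\<D> k. \<exists>!P. P \<in> \<D> (k + 1) \<and> Q \<subseteq> P) \<and>
     (\<exists>\<epsilon>::real. \<epsilon> > 0 \<and>
        (\<forall>k. \<forall>Q\<in>\<D> k. \<forall>R\<in>\<D> (k - 1).
           R \<subseteq> Q \<longrightarrow> ennreal \<epsilon> * emeasure M Q \<le> emeasure M R)) \<and>
     (\<exists>(xc :: 'a set \<Rightarrow> 'a) (\<delta>::real) (C0::real). \<delta> > 1 \<and> C0 > 0 \<and>
        (\<forall>k. \<forall>Q\<in>\<D> k. xc Q \<in> space M \<and>
           qball M \<rho> (xc Q) (\<delta> powi k) \<subseteq> Q \<and> Q \<subseteq> qball M \<rho> (xc Q) (C0 * \<delta> powi k)))"

text \<open>Real powers of \<open>[0,\<infinity>]\<close>-valued quantities, used only for exponents \<open>a > 0\<close>.\<close>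

definition ennpowr :: "ennreal \<Rightarrow> real \<Rightarrow> ennreal" where
  "ennpowr x a = (if x = \<infinity> then \<infinity> else ennreal (enn2real x powr a))"

definition avg :: "'a measure \<Rightarrow> 'a set \<Rightarrow> ('a \<Rightarrow> real) \<Rightarrow> ennreal" where
  "avg M Q f = (\<integral>\<^sup>+x\<in>Q. ennreal (f x) \<partial>M) / emeasure M Q"

definition conj_exp :: "real \<Rightarrow> real" where
  "conj_exp p = p / (p - 1)"

text \<open>A weight may be changed on a null set, so it is taken to be finite everywhere; it may still
  vanish on a null set. Local integrability is integrability over balls.\<close>

definition weight :: "'a measure \<Rightarrow> ('a \<Rightarrow> 'a \<Rightarrow> real) \<Rightarrow> ('a \<Rightarrow> real) \<Rightarrow> bool" where
  "weight M \<rho> w \<longleftrightarrow>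
     w \<in> borel_measurable M \<and> (\<forall>x\<in>space M. 0 \<le> w x) \<and> (AE x in M. 0 < w x) \<and>
     (\<forall>x\<in>space M. \<forall>r>0. (\<integral>\<^sup>+y\<in>qball M \<rho> x r. ennreal (w y) \<partial>M) < \<infinity>)"

definition Ap_const ::
    "'a measure \<Rightarrow> (int \<Rightarrow> 'a set set) \<Rightarrow> real \<Rightarrow> ('a \<Rightarrow> real) \<Rightarrow> ennreal" where
  "Ap_const M \<D> p w =
     (if p = 1
      then SUP Q\<in>cubes \<D>.
             avg M Q w * esssup (restrict_space M Q) (\<lambda>x. inverse (ennreal (w x)))
      else SUP Q\<in>cubes \<D>.
             avg M Q w * ennpowr (avg M Q (\<lambda>x. w x powr (1 - conj_exp p))) (p - 1))"

definition Ap_weights ::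
    "'a measure \<Rightarrow> ('a \<Rightarrow> 'a \<Rightarrow> real) \<Rightarrow> (int \<Rightarrow> 'a set set) \<Rightarrow> real \<Rightarrow> ('a \<Rightarrow> real) set" where
  "Ap_weights M \<rho> \<D> p = {w. weight M \<rho> w \<and> Ap_const M \<D> p w < \<infinity>}"

text \<open>The real value of \<open>[w]\<^bsub>A_p\<^esub>\<close>; only meaningful for \<open>w \<in> A_p\<close>.\<close>

abbreviation Ap_real ::
    "'a measure \<Rightarrow> (int \<Rightarrow> 'a set set) \<Rightarrow> real \<Rightarrow> ('a \<Rightarrow> real) \<Rightarrow> real" where
  "Ap_real M \<D> p w \<equiv> enn2real (Ap_const M \<D> p w)"

definition Lp_norm ::
    "'a measure \<Rightarrow> real \<Rightarrow> ('a \<Rightarrow> real) \<Rightarrow> ('a \<Rightarrow> ennreal) \<Rightarrow> ennreal" where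
  "Lp_norm M p w f = ennpowr (\<integral>\<^sup>+x. ennpowr (f x) p * ennreal (w x) \<partial>M) (1 / p)"

definition maximal_op ::
    "'a measure \<Rightarrow> (int \<Rightarrow> 'a set set) \<Rightarrow> ('a \<Rightarrow> real) \<Rightarrow> 'a \<Rightarrow> ennreal" where
  "maximal_op M \<D> f x = (SUP Q\<in>{Q \<in> cubes \<D>. x \<in> Q}. avg M Q (\<lambda>y. \<bar>f y\<bar>))"

definition maximal_norm ::
    "'a measure \<Rightarrow> (int \<Rightarrow> 'a set set) \<Rightarrow> real \<Rightarrow> ('a \<Rightarrow> real) \<Rightarrow> ennreal" where
  "maximal_norm M \<D> p w =
     (SUP f\<in>{f \<in> borel_measurable M. Lp_norm M p w (\<lambda>x. ennreal \<bar>f x\<bar>) \<le> 1}.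
        Lp_norm M p w (maximal_op M \<D> f))"

text \<open>For \<open>1 < p < \<infinity>\<close> and \<open>w \<in> A_p\<close> the norms below are finite, by Muckenhoupt's theorem for
  the pairs \<open>(p, w)\<close> and \<open>(p', w powr (1 - p'))\<close>, so \<open>enn2real\<close> loses nothing.\<close>

definition extrap_K ::
    "'a measure \<Rightarrow> (int \<Rightarrow> 'a set set) \<Rightarrow> (real \<Rightarrow> real) \<Rightarrow> real \<Rightarrow> real \<Rightarrow> ('a \<Rightarrow> real) \<Rightarrow> real" where
  "extrap_K M \<D> N p0 p w =
     (if p < p0 then
        N (Ap_real M \<D> p w * (2 * enn2real (maximal_norm M \<D> p w)) powr (p0 - p))
      else if p = p0 then N (Ap_real M \<D> p w)
      else
        N (Ap_real M \<D> p w powr ((p0 - 1) / (p - 1)) *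
           (2 * enn2real (maximal_norm M \<D> (conj_exp p) (\<lambda>x. w x powr (1 - conj_exp p))))
             powr ((p - p0) / (p - 1))))"

text \<open>The estimate, with constant \<open>C * B w\<close>, for all pairs of the family and all weights in \<open>A_p\<close>.\<close>

definition weighted_estimate ::
    "'a measure \<Rightarrow> ('a \<Rightarrow> 'a \<Rightarrow> real) \<Rightarrow> (int \<Rightarrow> 'a set set) \<Rightarrow> (('a \<Rightarrow> ennreal) \<times> ('a \<Rightarrow> ennreal)) set
      \<Rightarrow> real \<Rightarrow> real \<Rightarrow> (('a \<Rightarrow> real) \<Rightarrow> real) \<Rightarrow> bool" where
  "weighted_estimate M \<rho> \<D> F p C B \<longleftrightarrow>
     (\<forall>w\<in>Ap_weights M \<rho> \<D> p. \<forall>(f, g)\<in>F.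
        Lp_norm M p w g \<le> ennreal (C * B w) * Lp_norm M p w f)"

end

theory Submission
  imports Defs
begin

text \<open>The proof is Duoandikoetxea's: for a single weight \<open>w \<in> A_p\<close> one builds a weight \<open>W \<in> A_p0\<close> that depends on \<open>w\<close>
and on the functions, with \<open>[W]\<close> at most the argument of \<open>N\<close> in \<open>K(w)\<close>. The hypothesis is used
for \<open>W\<close>, and Hoelder's inequality leads back to \<open>w\<close>.

\<^item> Let \<open>\<sigma> = w^(1-q)\<close> with \<open>q\<close> the conjugate exponent. If \<open>M\<close> is bounded on \<open>L^p(w)\<close> with norm \<open>B\<close>, then \<open>F \<in> L^p(w)\<close> has the majorant
  \<open>u = \<Sum>_k M^kF / (2B)^k\<close>. It satisfies \<open>M u \<le> 2 B u\<close>, so it is an \<open>A_1\<close> weight with constant \<open>2B\<close>, and its norm is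
  comparable to that of \<open>F\<close> (\<open>A1_majorant\<close>).
\<^item> For \<open>p < p0\<close> take a majorant \<open>u\<close> of \<open>f\<close> and \<open>W = w u^(p-p0)\<close>. Then \<open>f^p0 W \<le> u^p w\<close>, and \<open>g^p w\<close> splits by Hoelder
  into powers of \<open>g^p0 W\<close> and \<open>u^p w\<close> (\<open>extrapolate_down\<close>).
\<^item> For \<open>p > p0\<close> take a majorant \<open>u\<close> of \<open>g^(p-1) w\<close> in \<open>L^q(\<sigma>)\<close> and \<open>W = w^\<theta> u^(1-\<theta>)\<close> with \<open>\<theta> = (p0 - 1) / (p - 1)\<close>. Then
  \<open>g^p w \<le> g^p0 W\<close> holds pointwise, which replaces duality. Hoelder bounds \<open>\<integral> f^p0 W\<close> by a power of \<open>\<integral> f^p w\<close> times a power of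
  \<open>\<integral> g^p w\<close>, and the latter is cancelled after \<open>g\<close> has been truncated to make it finite (\<open>extrapolate_up\<close>).

The bounds for \<open>[W]\<close> are one computation: where \<open>u\<close> is raised to a negative power, the \<open>A_1\<close> condition replaces it by its average
on the cube, and where it is raised to a positive power, Hoelder does (\<open>avg_factor\<close>).

Everything rests on the boundedness of the dyadic maximal operator. Lerner's argument estimates \<open>(M F)^(p-1)\<close> by \<open>[w]\<close> times
a composition of two weighted maximal operators, with respect to \<open>\<sigma>\<close> and to \<open>w\<close>. For nested cubes these satisfy Doob's inequality
with a constant that depends on the exponent alone, whatever the measure. Hence \<open>\<parallel>M\<parallel> \<le> c [w]^(1/(p-1))\<close> with \<open>c\<close> depending only on \<open>p\<close>
(\<open>buckley_bound\<close>), and this is what turns \<open>K(w)\<close> into \<open>N(C_2 [w]^(max(...)))\<close>. The function \<open>N\<close> is controlled on \<open>[1, \<infinity>)\<close> only, so \<open>[W] \<ge> 1\<close> and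
\<open>\<parallel>M\<parallel> \<ge> 1\<close> matter too. The first is Hoelder's inequality, the second comes from testing \<open>M\<close> on the indicator of a cube.

The geometry of \<open>X\<close> enters through the cubes: by doubling a ball meets only finitely many cubes of a generation. So there are
countably many cubes, and a function integrable on cubes is integrable on balls (\<open>Ap_weightsI\<close>).\<close>

section \<open>Real powers on the extended half-line\<close>

lemma ennpowr_0 [simp]: "ennpowr 0 a = 0"
  by (simp add: ennpowr_def)

lemma ennpowr_top [simp]: "ennpowr top a = top" 
  by (simp add: ennpowr_def)

lemma ennpowr_ennreal [simp]: "0 \<le> x \<Longrightarrow> ennpowr (ennreal x) a = ennreal (x powr a)"
  by (simp add: ennpowr_def)

lemma ennpowr_one [simp]: "ennpowr 1 a = 1"
  by (simp add: ennpowr_def)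

lemma ennpowr_1 [simp]: "ennpowr x 1 = x"
  by (cases x) (simp_all add: ennpowr_def)

lemma ennpowr_eq_0_iff [simp]: "ennpowr x a = 0 \<longleftrightarrow> x = 0"
  by (cases x) (auto simp: ennpowr_def)

lemma ennpowr_eq_top_iff [simp]: "ennpowr x a = top \<longleftrightarrow> x = top"
  by (cases x) (auto simp: ennpowr_def)

lemma ennpowr_less_top_iff [simp]: "ennpowr x a < top \<longleftrightarrow> x < top"
  by (simp add: less_top[symmetric])

lemma ennpowr_mono: "0 < a \<Longrightarrow> x \<le> y \<Longrightarrow> ennpowr x a \<le> ennpowr y a"
  by (cases x; cases y) (auto simp: ennpowr_def powr_mono2 top_unique)

lemma ennpowr_ennpowr [simp]: "ennpowr (ennpowr x a) b = ennpowr x (a * b)"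
  by (cases x) (auto simp: powr_powr)

lemma ennpowr_mult: "ennpowr (x * y) a = ennpowr x a * ennpowr y a"
proof (cases "x = top \<or> y = top")
  case True
  then show ?thesis by (auto simp: ennreal_mult_top ennreal_top_mult)
next
  case False
  then show ?thesis
    by (cases x; cases y) (auto simp: powr_mult ennreal_mult'[symmetric])
qed

lemma ennpowr_add: "ennpowr x a * ennpowr x b = ennpowr x (a + b)"
  by (cases x) (auto simp: powr_add ennreal_mult'[symmetric])

text \<open>The Galois connection between a power and the inverse power. It yields continuity of powers along suprema, and
it is how roots are taken in all the norm estimates.\<close>

lemma ennpowr_le_iff: "0 < a \<Longrightarrow> ennpowr x a \<le> y \<longleftrightarrow> x \<le> ennpowr y (1 / a)"
  using ennpowr_mono[of a x "ennpowr y (1/a)"] ennpowr_mono[of "1/a" "ennpowr x a" y] by auto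

lemma ennpowr_mono_iff: "0 < a \<Longrightarrow> ennpowr x a \<le> ennpowr y a \<longleftrightarrow> x \<le> y"
  by (simp add: ennpowr_le_iff)

lemma ennpowr_SUP: 
  assumes "0 < a" shows "ennpowr (SUP i\<in>I. f i) a = (SUP i\<in>I. ennpowr (f i) a)"
proof (rule antisym)
  show "ennpowr (SUP i\<in>I. f i) a \<le> (SUP i\<in>I. ennpowr (f i) a)"
    unfolding ennpowr_le_iff[OF assms]
  proof (rule SUP_least)
    fix i assume "i \<in> I"
    then have "ennpowr (f i) a \<le> (SUP i\<in>I. ennpowr (f i) a)" by (rule SUP_upper)
    then show "f i \<le> ennpowr (SUP i\<in>I. ennpowr (f i) a) (1 / a)"
      by (simp only: ennpowr_le_iff[OF assms])
  qed
  show "(SUP i\<in>I. ennpowr (f i) a) \<le> ennpowr (SUP i\<in>I. f i) a"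
    by (auto intro!: SUP_least ennpowr_mono SUP_upper assms)
qed

lemma measurable_ennpowr [measurable]:
  assumes [measurable]: "f \<in> borel_measurable M"
  shows "(\<lambda>x. ennpowr (f x) a) \<in> borel_measurable M"
  unfolding ennpowr_def by measurable

lemma ennpowr_max: "0 < a \<Longrightarrow> ennpowr (max x y) a = max (ennpowr x a) (ennpowr y a)"
  by (auto simp: max_def ennpowr_mono_iff)

text \<open>The values \<open>0\<close> and \<open>\<infinity>\<close> need no convention beyond \<open>0 \<cdot> \<infinity> = 0\<close>: a vanishing factor kills the left side, and an infinite
one makes the right side infinite.\<close>

lemma young_ennreal:
  assumes "0 < \<theta>" "\<theta> < 1"
  shows "ennpowr x \<theta> * ennpowr y (1 - \<theta>) \<le> ennreal \<theta> * x + ennreal (1 - \<theta>) * y"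
proof (cases "x = top \<or> y = top \<or> x = 0 \<or> y = 0")
  case True
  then show ?thesis using assms by (auto simp: ennreal_mult_top)
next
  case False
  then obtain a b where [simp]: "x = ennreal a" "y = ennreal b" and "a > 0" "b > 0"
    by (cases x; cases y) (auto simp: less_le)
  then show ?thesis
    using Youngs_inequality_0[of \<theta> "1 - \<theta>" a b] assms
    by (simp add: ennreal_mult'[symmetric] ennreal_plus[symmetric] del: ennreal_plus)
qed

text \<open>Hoelder's inequality in its logarithmically convex form. The exponents \<open>\<theta>\<close> and \<open>1 - \<theta>\<close> add up to one, so the same form applies to averages
as well as to integrals, and the powers of a weight can be split between the factors.
After normalising both integrals to one it is Young's inequality under the integral.\<close>

lemma nn_integral_Holder:
  assumes \<theta>: "0 < \<theta>" "\<theta> < 1"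
    and [measurable]: "F \<in> borel_measurable M" "G \<in> borel_measurable M"
  shows "(\<integral>\<^sup>+x. ennpowr (F x) \<theta> * ennpowr (G x) (1 - \<theta>) \<partial>M)
           \<le> ennpowr (\<integral>\<^sup>+x. F x \<partial>M) \<theta> * ennpowr (\<integral>\<^sup>+x. G x \<partial>M) (1 - \<theta>)"
proof -
  define I J where "I = (\<integral>\<^sup>+x. F x \<partial>M)" and "J = (\<integral>\<^sup>+x. G x \<partial>M)"
  consider "I = 0" | "J = 0" | "I \<noteq> 0" "J \<noteq> 0" "I = top \<or> J = top"
    | "I \<noteq> 0" "J \<noteq> 0" "I \<noteq> top" "J \<noteq> top" by blast
  then show ?thesis
  proof cases
    case 1
    then have "AE x in M. F x = 0" by (simp add: I_def nn_integral_0_iff_AE)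
    then have "AE x in M. ennpowr (F x) \<theta> * ennpowr (G x) (1 - \<theta>) = 0" by eventually_elim simp
    then have "(\<integral>\<^sup>+x. ennpowr (F x) \<theta> * ennpowr (G x) (1 - \<theta>) \<partial>M) = 0"
      by (subst nn_integral_0_iff_AE) auto
    then show ?thesis by simp
  next
    case 2
    then have "AE x in M. G x = 0" by (simp add: J_def nn_integral_0_iff_AE)
    then have "AE x in M. ennpowr (F x) \<theta> * ennpowr (G x) (1 - \<theta>) = 0" by eventually_elim simp
    then have "(\<integral>\<^sup>+x. ennpowr (F x) \<theta> * ennpowr (G x) (1 - \<theta>) \<partial>M) = 0"
      by (subst nn_integral_0_iff_AE) auto
    then show ?thesis by simp
  next
    case 3
    then show ?thesis unfolding I_def[symmetric] J_def[symmetric]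
      by (auto simp: ennreal_mult_top ennreal_top_mult)
  next
    case 4
    define c where "c = ennpowr I \<theta> * ennpowr J (1 - \<theta>)"
    have c: "c \<noteq> 0" "c \<noteq> top" using 4 by (auto simp: c_def ennreal_mult_eq_top_iff)
    have eq: "x = I * (x / I)" for x using 4
      by (metis ennreal_mult_divide_eq ennreal_times_divide mult.commute)
    have eq': "x = J * (x / J)" for x using 4
      by (metis ennreal_mult_divide_eq ennreal_times_divide mult.commute)
    have "(\<integral>\<^sup>+x. ennpowr (F x) \<theta> * ennpowr (G x) (1 - \<theta>) \<partial>M)
        = (\<integral>\<^sup>+x. c * (ennpowr (F x / I) \<theta> * ennpowr (G x / J) (1 - \<theta>)) \<partial>M)"
    proof (rule nn_integral_cong)
      fix x
      have "ennpowr (F x) \<theta> * ennpowr (G x) (1 - \<theta>) 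
          = ennpowr (I * (F x / I)) \<theta> * ennpowr (J * (G x / J)) (1 - \<theta>)"
        using eq[of "F x"] eq'[of "G x"] by simp
      then show "ennpowr (F x) \<theta> * ennpowr (G x) (1 - \<theta>)
          = c * (ennpowr (F x / I) \<theta> * ennpowr (G x / J) (1 - \<theta>))"
        by (simp only: ennpowr_mult c_def ac_simps)
    qed
    also have "\<dots> \<le> (\<integral>\<^sup>+x. c * (ennreal \<theta> * (F x / I) + ennreal (1 - \<theta>) * (G x / J)) \<partial>M)"
      by (intro nn_integral_mono mult_left_mono young_ennreal \<theta>) auto
    also have "\<dots> = c * (ennreal \<theta> * (I / I) + ennreal (1 - \<theta>) * (J / J))"
      by (simp add: nn_integral_cmult nn_integral_add nn_integral_divide I_def J_def)
    also have "\<dots> = c"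
      using 4 \<theta> by (simp add: ennreal_divide_self ennreal_plus[symmetric] less_top del: ennreal_plus)
    finally show ?thesis by (simp add: c_def I_def J_def)
  qed
qed

text \<open>The layer-cake formula at a single point; integrating it over the space and exchanging the integrals expresses \<open>\<integral> F^q\<close> through the
distribution function of \<open>F\<close>. The value \<open>a = \<infinity>\<close> is included because maximal functions are not known to be finite beforehand.\<close>

lemma nn_integral_powr_layer:
  assumes "0 < q"
  shows "(\<integral>\<^sup>+t. indicator {t. 0 < t \<and> ennreal t < a} t * ennreal (q * t powr (q - 1)) \<partial>lborel)
      = ennpowr a q"
proof -
  have fin: "(\<integral>\<^sup>+t. indicator {t. 0 < t \<and> t < c} t * ennreal (q * t powr (q - 1)) \<partial>lborel)
      = ennreal (c powr q)"
    if "0 \<le> c" for c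
  proof -
    have "((\<lambda>t. q * t powr (q - 1)) has_integral q * (c powr q / q)) {0..c}"
      using has_integral_powr_from_0[of "q-1" c] assms that
      by (intro has_integral_mult_right) auto
    then have "(\<integral>\<^sup>+t. ennreal (q * t powr (q - 1)) * indicator {0..c} t \<partial>lborel) = ennreal (c powr q)"
      using assms nn_integral_has_integral_lebesgue'[of "{0..c}" "\<lambda>t. q * t powr (q - 1)" "q * (c powr q / q)"]
      by simp
    moreover have "(\<integral>\<^sup>+t. indicator {t. 0 < t \<and> t < c} t * ennreal (q * t powr (q - 1)) \<partial>lborel)
       = (\<integral>\<^sup>+t. ennreal (q * t powr (q - 1)) * indicator {0..c} t \<partial>lborel)"
    proof (rule nn_integral_cong_AE)
      have "AE t in lborel. t \<noteq> (0::real)" "AE t in lborel. t \<noteq> c"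
        by (rule AE_lborel_singleton)+
      then show "AE t in lborel. indicator {t. 0 < t \<and> t < c} t * ennreal (q * t powr (q - 1))
          = ennreal (q * t powr (q - 1)) * indicator {0..c} t"
        by eventually_elim (auto simp: indicator_def)
    qed
    ultimately show ?thesis by simp
  qed
  show ?thesis
  proof (cases a)
    case (real c)
    then have "{t. 0 < t \<and> ennreal t < a} = {t. 0 < t \<and> t < c}" by (auto simp: ennreal_less_iff)
    then show ?thesis using fin[of c] real by simp
  next
    case top
    let ?I = "(\<integral>\<^sup>+t. indicator {t. 0 < t \<and> ennreal t < a} t * ennreal (q * t powr (q - 1)) \<partial>lborel)"
    have I: "ennreal c \<le> ?I" if "0 \<le> c" for c
    proof -
      have "ennreal c = ennreal ((c powr (1/q)) powr q)" using that assms by (simp add: powr_powr)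
      also have "\<dots> = (\<integral>\<^sup>+t. indicator {t. 0 < t
          \<and> t < c powr (1/q)} t * ennreal (q * t powr (q - 1)) \<partial>lborel)"
        by (rule fin[symmetric]) simp
      also have "\<dots> \<le> ?I" using top
        by (intro nn_integral_mono) (simp add: indicator_def)
      finally show ?thesis .
    qed
    have "of_nat n \<le> ?I" for n
      unfolding ennreal_of_nat_eq_real_of_nat by (intro I) simp
    then have "(SUP n::nat. of_nat n :: ennreal) \<le> ?I" by (rule SUP_least)
    then have "?I = top" by (simp add: ennreal_SUP_of_nat_eq_top top_unique)
    then show ?thesis using top by simp
  qed
qed

section \<open>Doob's maximal inequality for nested families\<close>

text \<open>The maximal operator over an arbitrary family of sets, with values in \<open>[0, \<infinity>]\<close>. It depends on the measure, so that its instance for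
the measure with density \<open>v\<close> is the weighted maximal operator.\<close>

definition mx :: "'a measure \<Rightarrow> 'a set set \<Rightarrow> ('a \<Rightarrow> ennreal) \<Rightarrow> 'a \<Rightarrow> ennreal" where
  "mx M \<Q> F x = (SUP Q\<in>{Q\<in>\<Q>. x \<in> Q}. (\<integral>\<^sup>+y\<in>Q. F y \<partial>M) / emeasure M Q)"

text \<open>Maximal inequalities are consequences of the nesting of the cubes. Since nesting does not involve the measure, a density with finite and positive integral over each cube gives another such family, which is
how weighted maximal operators are treated.\<close>

locale laminar_family =
  fixes M :: "'a measure" and \<Q> :: "'a set set"
  assumes countable_cubes: "countable \<Q>"
    and cubes_sets: "\<Q> \<subseteq> sets M"
    and nested: "Q \<in> \<Q> \<Longrightarrow> R \<in> \<Q> \<Longrightarrow> Q \<inter> R \<noteq> {} \<Longrightarrow> Q \<subseteq> R \<or> R \<subseteq> Q"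
    and cube_pos: "Q \<in> \<Q> \<Longrightarrow> emeasure M Q \<noteq> 0"
    and cube_fin: "Q \<in> \<Q> \<Longrightarrow> emeasure M Q \<noteq> top"
    and cover: "\<Union>\<Q> = space M"
begin

lemma cube_measurable [measurable]: "Q \<in> \<Q> \<Longrightarrow> Q \<in> sets M"
  using cubes_sets by auto

sublocale sigma_finite_measure M
  using countable_cubes cubes_sets cover cube_fin
  by unfold_locales (auto intro!: exI[of _ \<Q>])

abbreviation "maxf \<equiv> mx M \<Q>"

lemma avg_le_mx: "Q \<in> \<Q> \<Longrightarrow> x \<in> Q \<Longrightarrow> (\<integral>\<^sup>+y\<in>Q. F y \<partial>M) / emeasure M Q \<le> maxf F x"
  unfolding mx_def by (rule SUP_upper) simp

lemma mx_least:
  "(\<And>Q. Q \<in> \<Q> \<Longrightarrow> x \<in> Q \<Longrightarrow> (\<integral>\<^sup>+y\<in>Q. F y \<partial>M) / emeasure M Q \<le> c) \<Longrightarrow> maxf F x \<le> c"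
  unfolding mx_def by (rule SUP_least) simp

lemma mx_superlevel:
  "{x \<in> space M. t < maxf F x} = \<Union>{Q \<in> \<Q>. t < (\<integral>\<^sup>+y\<in>Q. F y \<partial>M) / emeasure M Q}"
  using cover by (auto simp: mx_def less_SUP_iff)

lemma measurable_mx [measurable]: "maxf F \<in> borel_measurable M"
proof (rule borel_measurableI_greater)
  fix t
  let ?G = "{Q \<in> \<Q>. t < (\<integral>\<^sup>+y\<in>Q. F y \<partial>M) / emeasure M Q}"
  have "countable ?G" using countable_cubes by (rule countable_subset[rotated]) auto
  moreover have "?G \<subseteq> sets M" using cubes_sets by auto
  ultimately show "{x \<in> space M. t < maxf F x} \<in> sets M"
    unfolding mx_superlevel by (rule sets.countable_Union)
qed

lemma mx_cong_AE:
  assumes "AE x in M. F x = G x"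
  shows "maxf F = maxf G"
proof
  fix x
  have "(\<integral>\<^sup>+y\<in>Q. F y \<partial>M) = (\<integral>\<^sup>+y\<in>Q. G y \<partial>M)" for Q
    using assms by (intro nn_integral_cong_AE) auto
  then show "maxf F x = maxf G x" by (simp add: mx_def)
qed

lemma mx_cmult:
  assumes [measurable]: "F \<in> borel_measurable M"
  shows "maxf (\<lambda>x. c * F x) x = c * maxf F x"
proof -
  have "(\<integral>\<^sup>+y\<in>Q. (c * F y) \<partial>M) / emeasure M Q = c * ((\<integral>\<^sup>+y\<in>Q. F y \<partial>M) / emeasure M Q)" if "Q \<in> \<Q>" for Q
    using that by (simp add: mult.assoc nn_integral_cmult ennreal_times_divide)
  then have "maxf (\<lambda>x. c * F x) x = (SUP Q\<in>{Q\<in>\<Q>. x \<in> Q}. c * ((\<integral>\<^sup>+y\<in>Q. F y \<partial>M) / emeasure M Q))"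
    unfolding mx_def by (intro SUP_cong) auto
  then show ?thesis by (simp add: mx_def SUP_mult_left_ennreal)
qed

text \<open>The maximal members of a finite nested family are disjoint and have the same union, so the estimates over the members add up.\<close>

lemma finite_subfamily_weak:
  assumes [measurable]: "F \<in> borel_measurable M"
    and fin: "finite \<G>" and sub: "\<G> \<subseteq> \<Q>"
    and big: "\<And>Q. Q \<in> \<G> \<Longrightarrow> t * emeasure M Q \<le> (\<integral>\<^sup>+y\<in>Q. F y \<partial>M)"
  shows "t * emeasure M (\<Union>\<G>) \<le> (\<integral>\<^sup>+x. F x \<partial>M)"
proof -
  define \<S> where "\<S> = {Q \<in> \<G>. \<forall>R\<in>\<G>. Q \<subseteq> R \<longrightarrow> Q = R}"
  have \<S>: "\<S> \<subseteq> \<G>" "finite \<S>" using fin by (auto simp: \<S>_def)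
  have "\<exists>R\<in>\<S>. Q \<subseteq> R" if "Q \<in> \<G>" for Q
    using finite_has_maximal2[OF fin that] by (auto simp: \<S>_def)
  then have U: "\<Union>\<G> = \<Union>\<S>" using \<S>(1) by blast
  have disj: "disjoint_family_on (\<lambda>Q. Q) \<S>"
    unfolding disjoint_family_on_def
  proof (intro ballI impI)
    fix Q R assume QR: "Q \<in> \<S>" "R \<in> \<S>" "Q \<noteq> R"
    then have "Q \<in> \<Q>" "R \<in> \<Q>" using \<S>(1) sub by auto
    then show "Q \<inter> R = {}" using nested[of Q R] QR by (auto simp: \<S>_def)
  qed
  have meas: "Q \<in> sets M" if "Q \<in> \<S>" for Q using that \<S> sub by auto
  have "t * emeasure M (\<Union>\<G>) = t * (\<Sum>Q\<in>\<S>. emeasure M Q)"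
    using sum_emeasure[of "\<lambda>Q. Q" \<S> M] meas disj \<S>(2) by (simp add: U subset_iff)
  also have "\<dots> \<le> (\<Sum>Q\<in>\<S>. emeasure (density M F) Q)"
    unfolding sum_distrib_left using big \<S>(1) meas
    by (intro sum_mono) (auto simp: emeasure_density)
  also have "\<dots> = emeasure (density M F) (\<Union>\<S>)"
    using sum_emeasure[of "\<lambda>Q. Q" \<S> "density M F"] meas disj \<S>(2) by auto
  also have "\<dots> \<le> emeasure (density M F) (space M)"
    by (metis emeasure_space space_density)
  also have "\<dots> = (\<integral>\<^sup>+x. F x \<partial>M)" by (simp add: emeasure_density cong: nn_integral_cong)
  finally show ?thesis .
qed

text \<open>The weak type estimate with constant one. The superlevel set is the union of the cubes with large average; it is exhausted by
finite subfamilies, for which no maximality issue arises even if the chains of cubes are infinite.\<close>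

lemma mx_weak_type:
  assumes [measurable]: "F \<in> borel_measurable M"
  shows "t * emeasure M {x \<in> space M. t < maxf F x} \<le> (\<integral>\<^sup>+x. F x \<partial>M)"
proof -
  define \<G> where "\<G> = {Q \<in> \<Q>. t < (\<integral>\<^sup>+y\<in>Q. F y \<partial>M) / emeasure M Q}"
  have \<G>: "countable \<G>" "\<G> \<subseteq> \<Q>" using countable_subset[OF _ countable_cubes, of \<G>] by (auto simp: \<G>_def)
  have big: "t * emeasure M Q \<le> (\<integral>\<^sup>+y\<in>Q. F y \<partial>M)" if "Q \<in> \<G>" for Q
  proof -
    from that have Q: "Q \<in> \<Q>" and less: "t \<le> (\<integral>\<^sup>+y\<in>Q. F y \<partial>M) / emeasure M Q" by (auto simp: \<G>_def)
    have "t * emeasure M Q \<le> (\<integral>\<^sup>+y\<in>Q. F y \<partial>M) / emeasure M Q * emeasure M Q"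
      by (rule mult_right_mono[OF less]) simp
    also have "\<dots> = (\<integral>\<^sup>+y\<in>Q. F y \<partial>M)"
      using cube_pos[OF Q] cube_fin[OF Q]
          by (simp add: ennreal_divide_times ennreal_divide_self less_top)
    finally show ?thesis .
  qed
  show ?thesis
  proof (cases "\<G> = {}")
    case True
    then show ?thesis unfolding mx_superlevel \<G>_def[symmetric] by simp
  next
    case False
    define A where "A n = \<Union>(from_nat_into \<G> ` {..n})" for n :: nat
    have im: "from_nat_into \<G> ` {..n} \<subseteq> \<G>" for n using from_nat_into[OF False] by auto
    have UA: "\<Union>\<G> = (\<Union>n. A n)"
    proof -
      have "\<Union>\<G> = \<Union>(range (from_nat_into \<G>))" using \<G>(1) False by (simp add: range_from_nat_into)
      then show ?thesis by (auto simp: A_def)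
    qed
    have A: "range A \<subseteq> sets M" "incseq A"
      using im \<G>(2) cubes_sets by (force simp: A_def incseq_def)+
    have "t * emeasure M (\<Union>\<G>) = (SUP n. t * emeasure M (A n))"
      unfolding UA SUP_emeasure_incseq[OF A, symmetric] by (simp add: SUP_mult_left_ennreal)
    also have "\<dots> \<le> (\<integral>\<^sup>+x. F x \<partial>M)"
    proof (rule SUP_least)
      fix n show "t * emeasure M (A n) \<le> (\<integral>\<^sup>+x. F x \<partial>M)"
        unfolding A_def using im[of n] \<G>(2) big by (intro finite_subfamily_weak) auto
    qed
    finally show ?thesis unfolding mx_superlevel \<G>_def[symmetric] .
  qed
qed

text \<open>The part of \<open>F\<close> below \<open>t / 2\<close> contributes at most \<open>t / 2\<close> to the maximal function. This form of the weak type estimate can be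
integrated in \<open>t\<close> without knowing in advance that the maximal function has finite norm.\<close>

lemma mx_weak_type_truncated:
  assumes [measurable]: "F \<in> borel_measurable M" and t: "0 < t"
  shows "emeasure M {x \<in> space M. ennreal t < maxf F x}
           \<le> ennreal (2 / t) * (\<integral>\<^sup>+x. F x * indicator {x. ennreal t < 2 * F x} x \<partial>M)"
proof -
  define G where "G x = F x * indicator {x. ennreal t < 2 * F x} x" for x
  have [measurable]: "G \<in> borel_measurable M" unfolding G_def by measurable
  have F_le: "F x \<le> G x + ennreal (t/2)" for x
  proof (cases "ennreal t < 2 * F x")
    case False
    then show ?thesis using t 
      by (cases "F x") (auto simp: G_def ennreal_mult'[symmetric] ennreal_less_iff ennreal_le_iff
        not_less ennreal_numeral[symmetric] simp del: ennreal_numeral)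
  qed (auto simp: G_def)
  have le: "maxf F x \<le> maxf G x + ennreal (t/2)" for x
  proof (rule mx_least)
    fix Q assume Q: "Q \<in> \<Q>" "x \<in> Q"
    have "(\<integral>\<^sup>+y\<in>Q. F y \<partial>M) \<le> (\<integral>\<^sup>+y. G y * indicator Q y + ennreal (t/2) * indicator Q y \<partial>M)"
      using F_le by (intro nn_integral_mono) (auto split: split_indicator)
    also have "\<dots> = (\<integral>\<^sup>+y\<in>Q. G y \<partial>M) + ennreal (t/2) * emeasure M Q"
      using Q by (subst nn_integral_add) (auto simp: nn_integral_cmult_indicator)
    finally have "(\<integral>\<^sup>+y\<in>Q. F y \<partial>M) / emeasure M Q
        \<le> ((\<integral>\<^sup>+y\<in>Q. G y \<partial>M) + ennreal (t/2) * emeasure M Q) / emeasure M Q"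
      by (rule divide_right_mono_ennreal)
    also have "\<dots> = (\<integral>\<^sup>+y\<in>Q. G y \<partial>M) / emeasure M Q + ennreal (t/2)"
      using cube_pos[OF Q(1)] cube_fin[OF Q(1)] 
      by (simp add: add_divide_distrib_ennreal mult_divide_eq_ennreal)
    also have "\<dots> \<le> maxf G x + ennreal (t/2)" by (intro add_right_mono avg_le_mx Q)
    finally show "(\<integral>\<^sup>+y\<in>Q. F y \<partial>M) / emeasure M Q \<le> maxf G x + ennreal (t/2)" .
  qed
  have sub: "{x \<in> space M. ennreal t < maxf F x} \<subseteq> {x \<in> space M. ennreal (t/2) < maxf G x}"
  proof safe
    fix x assume "ennreal t < maxf F x"
    then have "ennreal t < maxf G x + ennreal (t/2)" using le[of x] by (rule less_le_trans)
    then show "ennreal (t/2) < maxf G x" using t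
      by (cases "maxf G x") (auto simp: ennreal_plus[symmetric] ennreal_less_iff simp del: ennreal_plus)
  qed
  have "emeasure M {x \<in> space M. ennreal t < maxf F x}
      \<le> emeasure M {x \<in> space M. ennreal (t/2) < maxf G x}"
    by (rule emeasure_mono[OF sub]) measurable
  also have "\<dots> = ennreal (2/t) * (ennreal (t/2) * emeasure M {x \<in> space M. ennreal (t/2) < maxf G x})"
    using t by (simp add: mult.assoc[symmetric] ennreal_mult'[symmetric])
  also have "\<dots> \<le> ennreal (2/t) * (\<integral>\<^sup>+x. G x \<partial>M)"
    by (intro mult_left_mono mx_weak_type) auto
  finally show ?thesis by (simp add: G_def)
qed

text \<open>Doob's inequality. The truncated weak type estimate is multiplied by \<open>p t^(p-1)\<close> and integrated; the inner integral in \<open>t\<close> is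
then a layer-cake formula for the exponent \<open>p - 1\<close>. The constant depends on \<open>p\<close> alone, which is what makes the later bounds
uniform in the weight and in the dyadic decomposition.\<close>

lemma nn_integral_mx_powr:
  assumes [measurable]: "F \<in> borel_measurable M" and p: "1 < p"
  shows "(\<integral>\<^sup>+x. ennpowr (maxf F x) p \<partial>M) \<le> ennreal (p * 2 powr p / (p - 1)) * (\<integral>\<^sup>+x. ennpowr (F x) p \<partial>M)"
proof -
  interpret L: pair_sigma_finite M "lborel :: real measure" ..
  let ?k = "ennreal (2 * p / (p - 1))"
  have "(\<integral>\<^sup>+x. ennpowr (maxf F x) p \<partial>M)
     = (\<integral>\<^sup>+x. \<integral>\<^sup>+t. indicator {t. 0 < t
         \<and> ennreal t < maxf F x} t * ennreal (p * t powr (p - 1)) \<partial>lborel \<partial>M)"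
    using p by (simp add: nn_integral_powr_layer)
  also have "\<dots> = (\<integral>\<^sup>+t. \<integral>\<^sup>+x. indicator {t. 0 < t
      \<and> ennreal t < maxf F x} t * ennreal (p * t powr (p - 1)) \<partial>M \<partial>lborel)"
    by (rule L.Fubini'[symmetric]) measurable
  also have "\<dots> \<le> (\<integral>\<^sup>+t. \<integral>\<^sup>+x. (indicator {t. 0 < t
      \<and> ennreal t < 2 * F x} t * ennreal ((p - 1) * t powr (p - 1 - 1))) * (?k * F x) \<partial>M \<partial>lborel)"
  proof (rule nn_integral_mono)
    fix t :: real
    show "(\<integral>\<^sup>+x. indicator {t. 0 < t \<and> ennreal t < maxf F x} t * ennreal (p * t powr (p - 1)) \<partial>M) \<le>
      (\<integral>\<^sup>+x. (indicator {t. 0 < t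
          \<and> ennreal t < 2 * F x} t * ennreal ((p - 1) * t powr (p - 1 - 1))) * (?k * F x) \<partial>M)"
    proof (cases "0 < t")
      case t: True
      have "(\<integral>\<^sup>+x. indicator {t. 0 < t \<and> ennreal t < maxf F x} t * ennreal (p * t powr (p - 1)) \<partial>M)
        = (\<integral>\<^sup>+x. ennreal (p * t powr (p - 1)) * indicator {x \<in> space M. ennreal t < maxf F x} x \<partial>M)"
        using t by (intro nn_integral_cong) (simp add: indicator_def)
      also have "\<dots> = ennreal (p * t powr (p - 1)) * emeasure M {x \<in> space M. ennreal t < maxf F x}"
        by (rule nn_integral_cmult_indicator) measurable
      also have "\<dots> \<le> ennreal (p * t powr (p - 1)) * (ennreal (2 / t) * (\<integral>\<^sup>+x. F x * indicator {x. ennreal t < 2 * F x} x \<partial>M))"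
        by (intro mult_left_mono mx_weak_type_truncated t) auto
      also have "\<dots> = (\<integral>\<^sup>+x. ennreal (p * t powr (p - 1) * (2 / t)) * (F x * indicator {x. ennreal t < 2 * F x} x) \<partial>M)"
        using t p by (subst nn_integral_cmult) (measurable, simp add: mult.assoc[symmetric] ennreal_mult'[symmetric])
      also have "\<dots> = (\<integral>\<^sup>+x. (indicator {t. 0 < t
          \<and> ennreal t < 2 * F x} t * ennreal ((p - 1) * t powr (p - 1 - 1))) * (?k * F x) \<partial>M)"
      proof (rule nn_integral_cong)
        fix x
        have "p * t powr (p - 1) * (2 / t) = (p - 1) * t powr (p - 1 - 1) * (2 * p / (p - 1))"
          using t p powr_diff[of t "p - 1" 1] by simp
        then have "ennreal (p * t powr (p - 1) * (2 / t)) = ennreal ((p - 1) * t powr (p - 1 - 1)) * ?k"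
          using t p by (simp add: ennreal_mult'[symmetric])
        then show "ennreal (p * t powr (p - 1) * (2 / t)) * (F x * indicator {x. ennreal t < 2 * F x} x) = 
          (indicator {t. 0 < t \<and> ennreal t < 2 * F x} t * ennreal ((p - 1) * t powr (p - 1 - 1))) * (?k * F x)"
          using t by (simp add: indicator_def ac_simps)
      qed
      finally show ?thesis .
    qed simp
  qed
  also have "\<dots> = (\<integral>\<^sup>+x. \<integral>\<^sup>+t. (indicator {t. 0 < t
      \<and> ennreal t < 2 * F x} t * ennreal ((p - 1) * t powr (p - 1 - 1))) * (?k * F x) \<partial>lborel \<partial>M)"
    by (rule L.Fubini') measurable
  also have "\<dots> = (\<integral>\<^sup>+x. ennpowr (2 * F x) (p - 1) * (?k * F x) \<partial>M)"
  proof (rule nn_integral_cong)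
    fix x
    have "(\<integral>\<^sup>+t. (indicator {t. 0 < t
        \<and> ennreal t < 2 * F x} t * ennreal ((p - 1) * t powr (p - 1 - 1))) * (?k * F x) \<partial>lborel)
      = (\<integral>\<^sup>+t. indicator {t. 0 < t
          \<and> ennreal t < 2 * F x} t * ennreal ((p - 1) * t powr (p - 1 - 1)) \<partial>lborel) * (?k * F x)"
      by (rule nn_integral_multc) measurable
    also have "\<dots> = ennpowr (2 * F x) (p - 1) * (?k * F x)"
      using p by (subst nn_integral_powr_layer) auto
    finally show "(\<integral>\<^sup>+t. (indicator {t. 0 < t
        \<and> ennreal t < 2 * F x} t * ennreal ((p - 1) * t powr (p - 1 - 1))) * (?k * F x) \<partial>lborel)
      = ennpowr (2 * F x) (p - 1) * (?k * F x)" .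
  qed
  also have "\<dots> = (\<integral>\<^sup>+x. (ennpowr 2 (p - 1) * ?k) * ennpowr (F x) p \<partial>M)"
  proof (rule nn_integral_cong)
    fix x
    have "ennpowr (F x) p = ennpowr (F x) (p - 1) * F x"
      using ennpowr_add[of "F x" "p - 1" 1] by simp
    then show "ennpowr (2 * F x) (p - 1) * (?k * F x) = (ennpowr 2 (p - 1) * ?k) * ennpowr (F x) p"
      by (simp add: ennpowr_mult ac_simps)
  qed
  also have "\<dots> = (ennpowr 2 (p - 1) * ?k) * (\<integral>\<^sup>+x. ennpowr (F x) p \<partial>M)"
    by (rule nn_integral_cmult) measurable
  also have "ennpowr 2 (p - 1) * ?k = ennreal (p * 2 powr p / (p - 1))"
  proof -
    have "ennpowr 2 (p - 1) = ennreal (2 powr (p - 1))" using ennpowr_ennreal[of 2 "p - 1"] by simp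
    then show ?thesis using p by (simp add: ennreal_mult'[symmetric] powr_diff)
  qed
  finally show ?thesis .
qed

end

section \<open>The weighted maximal theorem with Buckley's exponent\<close>

text \<open>A finite \<open>A_p\<close> product forces both of its averages to be finite, since neither of them vanishes.\<close>

lemma Ap_product_finite:
  fixes a b m :: ennreal
  assumes fin: "a / m * ennpowr (b / m) r < top" and "a \<noteq> 0" "b \<noteq> 0" "m \<noteq> 0" "m \<noteq> top"
  shows "a < top" "b < top"
proof -
  have nz: "a / m \<noteq> 0" "b / m \<noteq> 0" using assms by auto
  have "a / m \<noteq> top \<and> ennpowr (b / m) r \<noteq> top"
    using fin nz by (auto simp: ennreal_mult_top ennreal_top_mult)
  then show "a < top" "b < top" using assms(4,5)
      by (auto simp: ennreal_divide_eq_top_iff top.not_eq_extremum)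
qed

lemma ennreal_cancel_weight:
  assumes "0 < c"
  shows "ennreal c * (x * ennreal (1 / c) * y) = x * y"
proof -
  have "ennreal c * (x * ennreal (1 / c) * y) = (ennreal c * ennreal (1 / c)) * (x * y)"
    by (simp only: ac_simps)
  also have "ennreal c * ennreal (1 / c) = 1"
    using assms by (simp add: ennreal_mult'[symmetric])
  finally show ?thesis by simp
qed

context laminar_family
begin

lemma cube_integral_pos:
  assumes [measurable]: "v \<in> borel_measurable M"
    and pos: "AE x in M. 0 < v x" and Q: "Q \<in> \<Q>"
  shows "(\<integral>\<^sup>+x\<in>Q. v x \<partial>M) \<noteq> 0"
proof
  assume "(\<integral>\<^sup>+x\<in>Q. v x \<partial>M) = 0"
  then have "AE x in M. v x * indicator Q x = 0" using Q by (subst (asm) nn_integral_0_iff_AE) auto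
  with pos have "AE x in M. x \<notin> Q" by eventually_elim (auto simp: indicator_def split: if_splits)
  then have "Q \<in> null_sets M" using Q by (simp add: AE_iff_null_sets)
  then show False using cube_pos[OF Q] by auto
qed

lemma laminar_density:
  assumes [measurable]: "v \<in> borel_measurable M"
    and pos: "AE x in M. 0 < v x" and fin: "\<And>Q. Q \<in> \<Q> \<Longrightarrow> (\<integral>\<^sup>+x\<in>Q. v x \<partial>M) < top"
  shows "laminar_family (density M v) \<Q>"
proof
  fix Q assume Q: "Q \<in> \<Q>"
  then show "emeasure (density M v) Q \<noteq> top" using fin[OF Q] by (simp add: emeasure_density)
  show "emeasure (density M v) Q \<noteq> 0"
    using cube_integral_pos[OF _ pos Q] Q by (simp add: emeasure_density)
qed (use countable_cubes cubes_sets cover nested in auto)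

text \<open>Lerner's proof. On a cube \<open>Q\<close> the average of \<open>F\<close> is written as
\<open>(\<integral>_Q F / \<sigma>(Q)) (\<sigma>(Q) / \<mu>(Q))\<close>; here \<open>\<integral>_Q F / \<sigma>(Q)\<close> is a \<open>\<sigma>\<close>-average of \<open>\<phi> = F / \<sigma>\<close>, hence a lower bound on \<open>Q\<close> for the
\<open>\<sigma>\<close>-maximal function of \<open>\<phi>\<close>. Its power \<open>p - 1\<close> is therefore bounded by an average over \<open>Q\<close>, which is a \<open>w\<close>-average of
\<open>\<psi> = (M_\<sigma> \<phi>)^(p-1) / w\<close> up to the factor \<open>w(Q) / \<mu>(Q)\<close>. The leftover factors form the \<open>A_p\<close> product, so
\<open>(M F)^(p-1) \<le> A M_w \<psi>\<close>, and Doob's inequality for \<open>w\<close> with exponent \<open>q\<close> and for \<open>\<sigma>\<close> with exponent \<open>p\<close> finishes the proof.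
The weight \<open>\<sigma>\<close> is called \<open>s\<close>; it is a separate variable so that the roles of \<open>w\<close> and \<open>\<sigma>\<close> can be exchanged.\<close>

theorem buckley_bound:
  fixes w s :: "'a \<Rightarrow> real" and A :: ennreal
  assumes p: "1 < p"
    and [measurable]: "w \<in> borel_measurable M" "s \<in> borel_measurable M"
    and w_pos: "AE x in M. 0 < w x" and s_eq: "AE x in M. s x = w x powr (- 1 / (p - 1))"
    and A: "A < top"
    and Ap: "\<And>Q. Q \<in> \<Q> \<Longrightarrow> (\<integral>\<^sup>+x\<in>Q. ennreal (w x) \<partial>M) / emeasure M Q
           * ennpowr ((\<integral>\<^sup>+x\<in>Q. ennreal (s x) \<partial>M) / emeasure M Q) (p - 1) \<le> A"
    and [measurable]: "F \<in> borel_measurable M"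
  defines "q \<equiv> p / (p - 1)"
  shows "(\<integral>\<^sup>+x. ennpowr (maxf F x) p * ennreal (w x) \<partial>M)
     \<le> ennpowr A q * (ennreal (q * 2 powr q / (q - 1)) * (ennreal (p * 2 powr p / (p - 1)) * (\<integral>\<^sup>+x. ennpowr (F x) p * ennreal (w x) \<partial>M)))"
proof -
  have q: "1 < q" using p by (simp add: q_def)
  have s_pos: "AE x in M. 0 < s x" using s_eq w_pos by eventually_elim simp
  define S where "S = density M (\<lambda>x. ennreal (s x))"
  define W where "W = density M (\<lambda>x. ennreal (w x))"
  have S_pos: "(\<integral>\<^sup>+x\<in>Q. ennreal (s x) \<partial>M) \<noteq> 0" and W_pos: "(\<integral>\<^sup>+x\<in>Q. ennreal (w x) \<partial>M) \<noteq> 0"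
      if "Q \<in> \<Q>" for Q
    using s_pos w_pos that by (intro cube_integral_pos; simp)+
  have SW_fin: "(\<integral>\<^sup>+x\<in>Q. ennreal (s x) \<partial>M) < top" "(\<integral>\<^sup>+x\<in>Q. ennreal (w x) \<partial>M) < top" if Q: "Q \<in> \<Q>" for Q
  proof -
    have "(\<integral>\<^sup>+x\<in>Q. ennreal (w x) \<partial>M) / emeasure M Q
           * ennpowr ((\<integral>\<^sup>+x\<in>Q. ennreal (s x) \<partial>M) / emeasure M Q) (p - 1) < top"
      using Ap[OF Q] A by (rule le_less_trans)
    from Ap_product_finite[OF this W_pos[OF Q] S_pos[OF Q] cube_pos[OF Q] cube_fin[OF Q]]
    show "(\<integral>\<^sup>+x\<in>Q. ennreal (s x) \<partial>M) < top" "(\<integral>\<^sup>+x\<in>Q. ennreal (w x) \<partial>M) < top" by auto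
  qed
  interpret S: laminar_family S \<Q>
    unfolding S_def using s_pos SW_fin by (intro laminar_density) auto
  interpret W: laminar_family W \<Q>
    unfolding W_def using w_pos SW_fin by (intro laminar_density) auto
  have [measurable_cong]: "sets S = sets M" "sets W = sets M" by (simp_all add: S_def W_def)
  have int_S: "(\<integral>\<^sup>+x. G x \<partial>S) = (\<integral>\<^sup>+x. ennreal (s x) * G x \<partial>M)"
    and int_W: "(\<integral>\<^sup>+x. G x \<partial>W) = (\<integral>\<^sup>+x. ennreal (w x) * G x \<partial>M)"
    if "G \<in> borel_measurable M" for G
    unfolding S_def W_def using that by (simp_all add: nn_integral_density)
  define \<phi> where "\<phi> x = F x * ennreal (1 / s x)" for x
  have [measurable]: "\<phi> \<in> borel_measurable M" unfolding \<phi>_def by measurable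
  have [measurable]: "S.maxf \<phi> \<in> borel_measurable M" 
    using S.measurable_mx[of \<phi>] measurable_cong_sets[OF \<open>sets S = sets M\<close> refl] by auto
  define \<psi> where "\<psi> x = ennpowr (S.maxf \<phi> x) (p - 1) * ennreal (1 / w x)" for x
  have [measurable]: "\<psi> \<in> borel_measurable M" unfolding \<psi>_def by measurable
  have [measurable]: "W.maxf \<psi> \<in> borel_measurable M" 
    using W.measurable_mx[of \<psi>] measurable_cong_sets[OF \<open>sets W = sets M\<close> refl] by auto
  have pointwise: "ennpowr (maxf F x) p \<le> ennpowr A q * ennpowr (W.maxf \<psi> x) q" for x
  proof -
    have "maxf F x \<le> ennpowr (A * W.maxf \<psi> x) (1 / (p - 1))"
    proof (rule mx_least)
      fix Q assume Q: "Q \<in> \<Q>" and x: "x \<in> Q"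
      let ?I = "\<integral>\<^sup>+x\<in>Q. F x \<partial>M" and ?m = "emeasure M Q"
        and ?S = "\<integral>\<^sup>+x\<in>Q. ennreal (s x) \<partial>M" and ?W = "\<integral>\<^sup>+x\<in>Q. ennreal (w x) \<partial>M"
      have I: "(\<integral>\<^sup>+x\<in>Q. \<phi> x \<partial>S) = ?I"
      proof -
        have "(\<integral>\<^sup>+x\<in>Q. \<phi> x \<partial>S) = (\<integral>\<^sup>+x. ennreal (s x) * (\<phi> x * indicator Q x) \<partial>M)"
          using Q by (intro int_S) measurable
        also have "\<dots> = ?I" using s_pos
          by (intro nn_integral_cong_AE, eventually_elim)
            (simp only: \<phi>_def ennreal_cancel_weight)
        finally show ?thesis .
      qed
      have mS: "emeasure S Q = ?S" and mW: "emeasure W Q = ?W"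
        using Q by (simp_all add: S_def W_def emeasure_density)
      have "ennpowr (?I / ?S) (p - 1) * ?m = (\<integral>\<^sup>+y. ennpowr (?I / ?S) (p - 1) * indicator Q y \<partial>M)"
        using Q by (simp add: nn_integral_cmult_indicator)
      also have "\<dots> \<le> (\<integral>\<^sup>+y\<in>Q. ennpowr (S.maxf \<phi> y) (p - 1) \<partial>M)"
        using S.avg_le_mx[OF Q, of _ \<phi>] p unfolding I mS
        by (intro nn_integral_mono) (auto split: split_indicator intro!: ennpowr_mono)
      also have "\<dots> = (\<integral>\<^sup>+y. ennreal (w y) * (\<psi> y * indicator Q y) \<partial>M)"
        using w_pos
        by (intro nn_integral_cong_AE, eventually_elim)
          (simp only: \<psi>_def ennreal_cancel_weight)
      also have "\<dots> = (\<integral>\<^sup>+y\<in>Q. \<psi> y \<partial>W)"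
        using Q by (intro int_W[symmetric]) measurable
      finally have "ennpowr (?I / ?S) (p - 1) * ?m / ?W \<le> (\<integral>\<^sup>+y\<in>Q. \<psi> y \<partial>W) / emeasure W Q"
        unfolding mW by (rule divide_right_mono_ennreal)
      also have "\<dots> \<le> W.maxf \<psi> x" by (rule W.avg_le_mx[OF Q x])
      finally have 1: "ennpowr (?I / ?S) (p - 1) * ?m / ?W \<le> W.maxf \<psi> x" .
      have "?I / ?m = ?I / ?S * (?S / ?m)"
        using S_pos[OF Q] SW_fin(1)[OF Q]
            by (simp add: ennreal_times_divide ennreal_divide_times ennreal_divide_self less_top mult_divide_eq_ennreal)
      then have "ennpowr (?I / ?m) (p - 1) = ennpowr (?I / ?S) (p - 1) * ennpowr (?S / ?m) (p - 1)"
        by (simp add: ennpowr_mult)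
      also have "\<dots> = ennpowr (?I / ?S) (p - 1) * (?m / ?W * (?W / ?m)) * ennpowr (?S / ?m) (p - 1)"
      proof -
        have "?m / ?W * (?W / ?m) = 1"
          using W_pos[OF Q] SW_fin(2)[OF Q] cube_pos[OF Q] cube_fin[OF Q]
          by (simp add: ennreal_times_divide ennreal_divide_times ennreal_divide_self less_top mult_divide_eq_ennreal)
        then show ?thesis by simp
      qed
      also have "\<dots> = (ennpowr (?I / ?S) (p - 1) * ?m / ?W) * (?W / ?m * ennpowr (?S / ?m) (p - 1))"
        by (simp add: ennreal_times_divide[symmetric] mult.assoc)
      also have "\<dots> \<le> W.maxf \<psi> x * A"
        by (intro mult_mono 1 Ap Q) auto
      finally show "?I / ?m \<le> ennpowr (A * W.maxf \<psi> x) (1 / (p - 1))"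
        using p by (subst (asm) ennpowr_le_iff) (auto simp: mult.commute)
    qed
    then have "ennpowr (maxf F x) p \<le> ennpowr (ennpowr (A * W.maxf \<psi> x) (1 / (p - 1))) p"
      using p by (intro ennpowr_mono) auto
    then show ?thesis using p by (simp add: q_def ennpowr_mult)
  qed
  have "(\<integral>\<^sup>+x. ennpowr (maxf F x) p * ennreal (w x) \<partial>M)
      \<le> (\<integral>\<^sup>+x. ennpowr A q * (ennreal (w x) * ennpowr (W.maxf \<psi> x) q) \<partial>M)"
    using pointwise by (intro nn_integral_mono) (metis mult.assoc mult.commute mult_right_mono zero_le)
  also have "\<dots> = ennpowr A q * (\<integral>\<^sup>+x. ennpowr (W.maxf \<psi> x) q \<partial>W)"
    by (simp add: nn_integral_cmult int_W)
  also have "\<dots> \<le> ennpowr A q * (ennreal (q * 2 powr q / (q - 1)) * (\<integral>\<^sup>+x. ennpowr (\<psi> x) q \<partial>W))"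
    using q by (intro mult_left_mono W.nn_integral_mx_powr) auto
  also have "(\<integral>\<^sup>+x. ennpowr (\<psi> x) q \<partial>W) = (\<integral>\<^sup>+x. ennreal (w x) * ennpowr (\<psi> x) q \<partial>M)"
    by (rule int_W) measurable
  also have "\<dots> = (\<integral>\<^sup>+x. ennreal (s x) * ennpowr (S.maxf \<phi> x) p \<partial>M)"
    using s_eq w_pos
  proof (intro nn_integral_cong_AE, eventually_elim)
    fix x assume s: "s x = w x powr (- 1 / (p - 1))" and w: "0 < w x"
    have "ennpowr (\<psi> x) q = ennpowr (S.maxf \<phi> x) p * ennreal ((1 / w x) powr q)"
      using p w by (simp add: \<psi>_def ennpowr_mult q_def)
    moreover have "w x * (1 / w x) powr q = s x"
    proof -
      have "w x * (1 / w x) powr q = w x powr 1 * w x powr (- q)" using w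
          by (simp add: powr_divide powr_minus_divide)
      also have "\<dots> = w x powr (1 - q)" using powr_add[of "w x" 1 "- q"] by simp
      also have "1 - q = - 1 / (p - 1)" using p by (simp add: q_def field_simps)
      finally show ?thesis by (simp add: s)
    qed
    ultimately show "ennreal (w x) * ennpowr (\<psi> x) q = ennreal (s x) * ennpowr (S.maxf \<phi> x) p"
      using w by (simp add: mult.left_commute[of "ennreal (w x)"] ennreal_mult'[symmetric] mult.commute)
  qed
  also have "\<dots> = (\<integral>\<^sup>+x. ennpowr (S.maxf \<phi> x) p \<partial>S)"
    by (rule int_S[symmetric]) measurable
  also have "\<dots> \<le> ennreal (p * 2 powr p / (p - 1)) * (\<integral>\<^sup>+x. ennpowr (\<phi> x) p \<partial>S)"
    using p by (intro S.nn_integral_mx_powr) auto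
  also have "(\<integral>\<^sup>+x. ennpowr (\<phi> x) p \<partial>S) = (\<integral>\<^sup>+x. ennreal (s x) * ennpowr (\<phi> x) p \<partial>M)"
    by (rule int_S) measurable
  also have "\<dots> = (\<integral>\<^sup>+x. ennpowr (F x) p * ennreal (w x) \<partial>M)"
    using s_eq w_pos s_pos
  proof (intro nn_integral_cong_AE, eventually_elim)
    fix x assume s: "s x = w x powr (- 1 / (p - 1))" and w: "0 < w x" and s0: "0 < s x"
    have "ennpowr (\<phi> x) p = ennpowr (F x) p * ennreal ((1 / s x) powr p)"
      using s0 by (simp add: \<phi>_def ennpowr_mult)
    moreover have "s x * (1 / s x) powr p = w x"
    proof -
      have "s x * (1 / s x) powr p = s x powr 1 * s x powr (- p)" using s0
          by (simp add: powr_divide powr_minus_divide)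
      also have "\<dots> = s x powr (1 - p)" using powr_add[of "s x" 1 "- p"] by simp
      also have "\<dots> = w x powr (- 1 / (p - 1) * (1 - p))" by (simp add: s powr_powr)
      also have "- 1 / (p - 1) * (1 - p) = 1" using p by (simp add: field_simps)
      finally show ?thesis using w by simp
    qed
    ultimately show "ennreal (s x) * ennpowr (\<phi> x) p = ennpowr (F x) p * ennreal (w x)"
      using s0 by (simp add: mult.left_commute[of "ennreal (s x)"] ennreal_mult'[symmetric])
  qed
  finally show ?thesis by (simp add: mult_left_mono)
qed

end

section \<open>Rubio de Francia's majorants\<close>

text \<open>Convexity of the power for countable convex combinations, as Hoelder's inequality for the counting measure. It takes the place of
Minkowski's inequality in the norm bound for Rubio de Francia's series.\<close>

lemma ennreal_suminf_jensen:
  fixes a :: "nat \<Rightarrow> ennreal"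
  assumes p: "1 < p" and r: "\<And>k. 0 \<le> r k" "r sums 1"
  shows "ennpowr (\<Sum>k. ennreal (r k) * a k) p \<le> (\<Sum>k. ennreal (r k) * ennpowr (a k) p)"
proof -
  have split: "ennreal (r k) * a k
      = ennpowr (ennreal (r k) * ennpowr (a k) p) (1 / p) * ennpowr (ennreal (r k)) (1 - 1 / p)" for k
  proof -
    have "ennpowr (ennreal (r k) * ennpowr (a k) p) (1 / p) * ennpowr (ennreal (r k)) (1 - 1 / p)
        = a k * (ennpowr (ennreal (r k)) (1 / p) * ennpowr (ennreal (r k)) (1 - 1 / p))"
      using p by (simp only: ennpowr_mult ennpowr_ennpowr) (simp add: ac_simps)
    then show ?thesis unfolding ennpowr_add by (simp add: mult.commute)
  qed
  have one: "(\<Sum>k. ennreal (r k)) = 1"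
    using suminf_ennreal_eq[OF r] by simp
  have "(\<Sum>k. ennreal (r k) * a k)
      = (\<integral>\<^sup>+k. ennpowr (ennreal (r k) * ennpowr (a k) p) (1 / p) * ennpowr (ennreal (r k)) (1 - 1 / p) \<partial>count_space UNIV)"
    by (simp only: split[symmetric] nn_integral_count_space_nat)
  also have "\<dots> \<le> ennpowr (\<integral>\<^sup>+k. ennreal (r k) * ennpowr (a k) p \<partial>count_space UNIV) (1 / p)
      * ennpowr (\<integral>\<^sup>+k. ennreal (r k) \<partial>count_space UNIV) (1 - 1 / p)"
    using p by (intro nn_integral_Holder) auto
  also have "\<dots> = ennpowr (\<Sum>k. ennreal (r k) * ennpowr (a k) p) (1 / p)"
    by (simp add: nn_integral_count_space_nat one)
  finally show ?thesis using p by (simp add: ennpowr_le_iff)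
qed

context laminar_family
begin

text \<open>The majorant is \<open>\<Sum>_k T_k / (2B)^k\<close> with \<open>T_k\<close> the \<open>k\<close>-fold maximal function of \<open>F\<close>. Applying the maximal operator shifts the series by
one place, which costs the factor \<open>2B\<close>. For the norm, the series is the convex combination with weights \<open>2^(-k-1)\<close> of the functions
\<open>2 T_k / B^k\<close>, and each of these has norm at most twice that of \<open>F\<close>.\<close>

lemma rubio_de_francia:
  fixes v :: "'a \<Rightarrow> ennreal" and B :: real
  assumes p: "1 < p" and B: "0 < B"
    and [measurable]: "v \<in> borel_measurable M"
    and bound: "\<And>F. F \<in> borel_measurable M \<Longrightarrow>
      (\<integral>\<^sup>+x. ennpowr (maxf F x) p * v x \<partial>M) \<le> ennreal (B powr p) * (\<integral>\<^sup>+x. ennpowr (F x) p * v x \<partial>M)"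
    and F[measurable]: "F \<in> borel_measurable M"
  obtains u where "u \<in> borel_measurable M" "\<And>x. F x \<le> u x" "\<And>x. maxf u x \<le> ennreal (2 * B) * u x"
    "(\<integral>\<^sup>+x. ennpowr (u x) p * v x \<partial>M) \<le> ennreal (2 powr p) * (\<integral>\<^sup>+x. ennpowr (F x) p * v x \<partial>M)"
proof
  define T where "T k = (maxf ^^ k) F" for k
  define c where "c = 1 / (2 * B)"
  define u where "u x = (\<Sum>k. ennreal (c ^ k) * T k x)" for x
  let ?J = "\<integral>\<^sup>+x. ennpowr (F x) p * v x \<partial>M"
  have c: "0 < c" using B by (simp add: c_def)
  have T_Suc: "T (Suc k) = maxf (T k)" and T_0: "T 0 = F" for k by (simp_all add: T_def)
  have T_meas[measurable]: "T k \<in> borel_measurable M" for k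
    by (cases k) (simp_all add: T_Suc T_0)
  have T_int: "(\<integral>\<^sup>+x. ennpowr (T k x) p * v x \<partial>M) \<le> ennreal ((B powr p) ^ k) * ?J" for k
  proof (induction k)
    case (Suc k)
    have "(\<integral>\<^sup>+x. ennpowr (T (Suc k) x) p * v x \<partial>M)
        \<le> ennreal (B powr p) * (\<integral>\<^sup>+x. ennpowr (T k x) p * v x \<partial>M)"
      unfolding T_Suc by (rule bound) measurable
    also have "\<dots> \<le> ennreal (B powr p) * (ennreal ((B powr p) ^ k) * ?J)"
      by (intro mult_left_mono Suc) simp
    also have "\<dots> = ennreal ((B powr p) ^ Suc k) * ?J"
      by (simp add: mult.assoc[symmetric] ennreal_mult'[symmetric])
    finally show ?case .
  qed (simp add: T_0)
  show u_meas[measurable]: "u \<in> borel_measurable M" unfolding u_def by measurable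
  show "F x \<le> u x" for x
  proof -
    have "F x = (\<Sum>k\<in>{0}. ennreal (c ^ k) * T k x)" by (simp add: T_0)
    also have "\<dots> \<le> u x" unfolding u_def by (rule sum_le_suminf) auto
    finally show ?thesis .
  qed
  show "maxf u x \<le> ennreal (2 * B) * u x" for x
  proof (rule mx_least)
    fix Q assume Q: "Q \<in> \<Q>" "x \<in> Q"
    have "(\<integral>\<^sup>+y\<in>Q. u y \<partial>M) = (\<integral>\<^sup>+y. (\<Sum>k. ennreal (c ^ k) * (T k y * indicator Q y)) \<partial>M)"
      by (simp only: u_def ennreal_suminf_multc[symmetric] mult.assoc)
    also have "\<dots> = (\<Sum>k. ennreal (c ^ k) * (\<integral>\<^sup>+y\<in>Q. T k y \<partial>M))"
      using Q by (simp add: nn_integral_suminf nn_integral_cmult)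
    finally have "(\<integral>\<^sup>+y\<in>Q. u y \<partial>M) / emeasure M Q
        = (\<Sum>k. ennreal (c ^ k) * ((\<integral>\<^sup>+y\<in>Q. T k y \<partial>M) / emeasure M Q))"
      by (simp only: divide_ennreal_def ennreal_suminf_multc[symmetric] mult.assoc)
    also have "\<dots> \<le> (\<Sum>k. ennreal (2 * B) * (ennreal (c ^ Suc k) * T (Suc k) x))"
    proof (rule suminf_le)
      fix k
      have "ennreal (c ^ k) * ((\<integral>\<^sup>+y\<in>Q. T k y \<partial>M) / emeasure M Q) \<le> ennreal (c ^ k) * T (Suc k) x"
        unfolding T_Suc by (intro mult_left_mono avg_le_mx Q) simp
      also have "\<dots> = ennreal (2 * B) * (ennreal (c ^ Suc k) * T (Suc k) x)"
        using B c by (simp add: mult.assoc[symmetric] ennreal_mult'[symmetric]) (simp add: c_def)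
      finally show "ennreal (c ^ k) * ((\<integral>\<^sup>+y\<in>Q. T k y \<partial>M) / emeasure M Q)
        \<le> ennreal (2 * B) * (ennreal (c ^ Suc k) * T (Suc k) x)" .
    qed auto
    also have "\<dots> = ennreal (2 * B) * (\<Sum>k. ennreal (c ^ Suc k) * T (Suc k) x)"
      by (rule ennreal_suminf_cmult)
    also have "\<dots> \<le> ennreal (2 * B) * u x"
    proof (rule mult_left_mono)
      have "u x = (\<Sum>k. ennreal (c ^ (k + 1)) * T (k + 1) x) + (\<Sum>k<1. ennreal (c ^ k) * T k x)"
        unfolding u_def by (rule suminf_offset) simp
      then show "(\<Sum>k. ennreal (c ^ Suc k) * T (Suc k) x) \<le> u x" by simp
    qed simp
    finally show "(\<integral>\<^sup>+y\<in>Q. u y \<partial>M) / emeasure M Q \<le> ennreal (2 * B) * u x" .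
  qed
  define r :: "nat \<Rightarrow> real" where "r k = (1 / 2) ^ Suc k" for k
  have r: "0 \<le> r k" "r sums 1" for k
    unfolding r_def using power_half_series by auto
  define a where "a k x = ennreal (2 * (1 / B) ^ k) * T k x" for k x
  have [measurable]: "a k \<in> borel_measurable M" for k unfolding a_def by measurable
  have u_eq: "u x = (\<Sum>k. ennreal (r k) * a k x)" for x
  proof -
    have "r k * (2 * (1 / B) ^ k) = c ^ k" for k
      by (simp add: r_def c_def power_divide power_mult_distrib)
    then have "ennreal (r k) * a k x = ennreal (c ^ k) * T k x" for k
      using r B by (simp add: a_def mult.assoc[symmetric] ennreal_mult'[symmetric])
    then show ?thesis by (simp add: u_def)
  qed
  have a_int: "(\<integral>\<^sup>+x. ennpowr (a k x) p * v x \<partial>M) \<le> ennreal (2 powr p) * ?J" for k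
  proof -
    have "(\<integral>\<^sup>+x. ennpowr (a k x) p * v x \<partial>M)
        = (\<integral>\<^sup>+x. ennreal ((2 * (1 / B) ^ k) powr p) * (ennpowr (T k x) p * v x) \<partial>M)"
      using B by (simp add: a_def ennpowr_mult mult.assoc)
    also have "\<dots> = ennreal ((2 * (1 / B) ^ k) powr p) * (\<integral>\<^sup>+x. ennpowr (T k x) p * v x \<partial>M)"
      by (rule nn_integral_cmult) measurable
    also have "\<dots> \<le> ennreal ((2 * (1 / B) ^ k) powr p) * (ennreal ((B powr p) ^ k) * ?J)"
      by (intro mult_left_mono T_int) simp
    also have "\<dots> = ennreal ((2 * (1 / B) ^ k) powr p * (B powr p) ^ k) * ?J"
      by (simp add: mult.assoc[symmetric] ennreal_mult'[symmetric])
    also have "(2 * (1 / B) ^ k) powr p * (B powr p) ^ k = 2 powr p"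
    proof -
      have "(B powr p) ^ k = (B ^ k) powr p" 
        using B by (induction k) (auto simp: powr_mult)
      then show ?thesis using B by (simp add: powr_mult[symmetric] power_divide)
    qed
    finally show ?thesis .
  qed
  have "(\<integral>\<^sup>+x. ennpowr (u x) p * v x \<partial>M) \<le> (\<integral>\<^sup>+x. (\<Sum>k. ennreal (r k) * ennpowr (a k x) p) * v x \<partial>M)"
    unfolding u_eq using p r by (intro nn_integral_mono mult_right_mono ennreal_suminf_jensen) auto
  also have "\<dots> = (\<Sum>k. ennreal (r k) * (\<integral>\<^sup>+x. ennpowr (a k x) p * v x \<partial>M))"
    by (simp only: ennreal_suminf_multc[symmetric] mult.assoc)
      (simp add: nn_integral_suminf nn_integral_cmult)
  also have "\<dots> \<le> (\<Sum>k. ennreal (r k) * (ennreal (2 powr p) * ?J))"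
    by (intro suminf_le mult_left_mono a_int) auto
  also have "\<dots> = ennreal (2 powr p) * ?J"
    unfolding ennreal_suminf_multc suminf_ennreal_eq[OF r] by simp
  finally show "(\<integral>\<^sup>+x. ennpowr (u x) p * v x \<partial>M) \<le> ennreal (2 powr p) * ?J" .
qed

text \<open>The majorant in the form in which it can serve as a weight: real, everywhere positive, and with finite averages.
Positivity is not automatic, because the space may split into parts that no common cube contains and then the maximal function of
\<open>F\<close> vanishes on the parts that \<open>F\<close> misses. Therefore the series is formed for \<open>max F h\<close>, where \<open>h > 0\<close> has norm at most that of \<open>F\<close>; this costs the
factor \<open>2\<close> in the last bound.\<close>

lemma A1_majorant:
  fixes v :: "'a \<Rightarrow> real" and B :: real
  assumes p: "1 < p" and B: "0 < B"
    and [measurable]: "v \<in> borel_measurable M" and v_pos: "AE x in M. 0 < v x"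
    and bound: "\<And>F. F \<in> borel_measurable M \<Longrightarrow>
      (\<integral>\<^sup>+x. ennpowr (maxf F x) p * ennreal (v x) \<partial>M)
          \<le> ennreal (B powr p) * (\<integral>\<^sup>+x. ennpowr (F x) p * ennreal (v x) \<partial>M)"
    and F[measurable]: "F \<in> borel_measurable M"
    and J: "(\<integral>\<^sup>+x. ennpowr (F x) p * ennreal (v x) \<partial>M) \<noteq> 0" "(\<integral>\<^sup>+x. ennpowr (F x) p * ennreal (v x) \<partial>M) \<noteq> top"
  obtains u :: "'a \<Rightarrow> real" where "u \<in> borel_measurable M" "\<And>x. 0 < u x" "AE x in M. F x \<le> ennreal (u x)"
    "\<And>Q. Q \<in> \<Q> \<Longrightarrow> \<exists>U>0. (\<integral>\<^sup>+x\<in>Q. ennreal (u x) \<partial>M) / emeasure M Q = ennreal U \<and> (AE x in M. x \<in> Q \<longrightarrow> U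
        \<le> 2 * B * u x)"
    "(\<integral>\<^sup>+x. ennpowr (ennreal (u x)) p * ennreal (v x) \<partial>M)
        \<le> ennreal (2 * 2 powr p) * (\<integral>\<^sup>+x. ennpowr (F x) p * ennreal (v x) \<partial>M)"
proof -
  let ?J = "\<integral>\<^sup>+x. ennpowr (F x) p * ennreal (v x) \<partial>M"
  obtain j where j: "?J = ennreal j" "0 < j" using J by (cases ?J) (auto simp: less_le)
  obtain h0 :: "'a \<Rightarrow> real" where h0[measurable]: "h0 \<in> borel_measurable M"
      and h0_pos: "\<And>x. 0 < h0 x" and h0_int: "integrable M h0"
    by (rule obtain_positive_integrable_function) (rule that)
  define H where "H = (\<integral>x. h0 x \<partial>M)"
  have H: "(\<integral>\<^sup>+x. ennreal (h0 x) \<partial>M) = ennreal H" "0 \<le> H"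
    unfolding H_def using h0_int order_less_imp_le[OF h0_pos]
    by (intro nn_integral_eq_integral integral_nonneg_AE AE_I2; simp)+
  define c where "c = j / (H + 1)"
  have c: "0 < c" using j H by (simp add: c_def)
  \<comment> \<open>The factor \<open>c\<close> makes \<open>\<integral> h\<^sup>p v = c H\<close> at most \<open>j\<close>; dividing
      by \<open>H + 1\<close> avoids a case distinction on \<open>H = 0\<close>.\<close>
  define h where "h x = ennpowr (ennreal (c * h0 x / v x)) (1 / p)" for x
  have [measurable]: "h \<in> borel_measurable M" unfolding h_def by measurable
  have "(\<integral>\<^sup>+x. ennpowr (h x) p * ennreal (v x) \<partial>M) = (\<integral>\<^sup>+x. ennreal c * ennreal (h0 x) \<partial>M)"
    using v_pos
  proof (intro nn_integral_cong_AE, eventually_elim)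
    fix x assume "0 < v x"
    then show "ennpowr (h x) p * ennreal (v x) = ennreal c * ennreal (h0 x)"
      using p c by (simp add: h_def ennreal_mult''[symmetric] ennreal_mult'[symmetric])
  qed
  also have "\<dots> = ennreal (c * H)" using c H by (simp add: nn_integral_cmult ennreal_mult)
  also have "\<dots> \<le> ?J" unfolding j using j H by (intro ennreal_leI) (simp add: c_def field_simps)
  finally have h_int: "(\<integral>\<^sup>+x. ennpowr (h x) p * ennreal (v x) \<partial>M) \<le> ?J" .
  have F': "(\<integral>\<^sup>+x. ennpowr (max (F x) (h x)) p * ennreal (v x) \<partial>M) \<le> 2 * ?J"
  proof -
    have "(\<integral>\<^sup>+x. ennpowr (max (F x) (h x)) p * ennreal (v x) \<partial>M)
        \<le> (\<integral>\<^sup>+x. ennpowr (F x) p * ennreal (v x) + ennpowr (h x) p * ennreal (v x) \<partial>M)"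
      using p by (intro nn_integral_mono) (auto simp: ennpowr_max max_def)
    also have "\<dots> = ?J + (\<integral>\<^sup>+x. ennpowr (h x) p * ennreal (v x) \<partial>M)"
      by (rule nn_integral_add) measurable
    also have "\<dots> \<le> ?J + ?J" by (intro add_left_mono h_int)
    finally show ?thesis by (simp add: mult_2)
  qed
  obtain u0 where [measurable]: "u0 \<in> borel_measurable M" and u0_ge: "\<And>x. max (F x) (h x) \<le> u0 x"
    and u0_mx: "\<And>x. maxf u0 x \<le> ennreal (2 * B) * u0 x"
    and u0_int: "(\<integral>\<^sup>+x. ennpowr (u0 x) p * ennreal (v x) \<partial>M)
        \<le> ennreal (2 powr p) * (\<integral>\<^sup>+x. ennpowr (max (F x) (h x)) p * ennreal (v x) \<partial>M)"
    by (rule rubio_de_francia[OF p B _ bound, of "\<lambda>x. max (F x) (h x)"]) auto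
  have u0_int': "(\<integral>\<^sup>+x. ennpowr (u0 x) p * ennreal (v x) \<partial>M) \<le> ennreal (2 * 2 powr p) * ?J"
  proof -
    have "(\<integral>\<^sup>+x. ennpowr (u0 x) p * ennreal (v x) \<partial>M) \<le> ennreal (2 powr p) * (2 * ?J)"
      using u0_int mult_left_mono[OF F', of "ennreal (2 powr p)"] by auto
    then show ?thesis by (simp add: ennreal_mult ac_simps)
  qed
  have "(\<integral>\<^sup>+x. ennpowr (u0 x) p * ennreal (v x) \<partial>M) \<noteq> top"
    using u0_int' j by (auto simp: ennreal_mult'[symmetric] top_unique)
  then have "AE x in M. ennpowr (u0 x) p * ennreal (v x) \<noteq> top"
    by (intro nn_integral_noteq_infinite[unfolded infinity_ennreal_def]) auto
  with v_pos have u0_fin: "AE x in M. u0 x \<noteq> top"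
    by eventually_elim (auto simp: ennreal_top_mult)
  have u0_pos: "AE x in M. 0 < u0 x"
    using v_pos
  proof eventually_elim
    fix x assume "0 < v x"
    then have "0 < c * h0 x / v x" using h0_pos[of x] c by simp
    then have "0 < h x" unfolding zero_less_iff_neq_zero h_def ennpowr_eq_0_iff by auto
    then show "0 < u0 x" using u0_ge[of x] by (auto intro: less_le_trans)
  qed
  \<comment> \<open>The value \<open>1\<close> is taken on a null set only; it makes \<open>u\<close> positive everywhere.\<close>
  define u where "u x = (if 0 < u0 x \<and> u0 x \<noteq> top then enn2real (u0 x) else 1)" for x
  have u_meas[measurable]: "u \<in> borel_measurable M" unfolding u_def by measurable
  have u_pos: "0 < u x" for x by (auto simp: u_def enn2real_positive_iff less_top)
  have u_eq: "AE x in M. u0 x = ennreal (u x)"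
    using u0_pos u0_fin by eventually_elim (simp add: u_def less_top)
  show thesis
  proof
    show "u \<in> borel_measurable M" "\<And>x. 0 < u x" by (fact u_meas u_pos)+
    show "AE x in M. F x \<le> ennreal (u x)"
      using u_eq
    proof eventually_elim
      fix x assume "u0 x = ennreal (u x)"
      then show "F x \<le> ennreal (u x)" using u0_ge[of x] by simp
    qed
    have "(\<integral>\<^sup>+x. ennpowr (ennreal (u x)) p * ennreal (v x) \<partial>M)
        = (\<integral>\<^sup>+x. ennpowr (u0 x) p * ennreal (v x) \<partial>M)"
      using u_eq by (intro nn_integral_cong_AE) (auto elim!: eventually_mono simp del: ennpowr_ennreal)
    then show "(\<integral>\<^sup>+x. ennpowr (ennreal (u x)) p * ennreal (v x) \<partial>M) \<le> ennreal (2 * 2 powr p) * ?J"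
      using u0_int' by simp
    fix Q assume Q: "Q \<in> \<Q>"
    let ?A = "(\<integral>\<^sup>+x\<in>Q. ennreal (u x) \<partial>M) / emeasure M Q"
    have le: "?A \<le> ennreal (2 * B) * u0 x" if "x \<in> Q" for x
    proof -
      have "(\<integral>\<^sup>+x\<in>Q. ennreal (u x) \<partial>M) = (\<integral>\<^sup>+x\<in>Q. u0 x \<partial>M)"
        using u_eq by (intro nn_integral_cong_AE, eventually_elim) simp
      then show ?thesis using avg_le_mx[OF Q that, of u0] u0_mx[of x] by (auto intro: order_trans)
    qed
    have "?A \<noteq> 0"
      using cube_integral_pos[of "\<lambda>x. ennreal (u x)", OF _ _ Q] u_pos cube_fin[OF Q] by simp
    moreover have "?A \<noteq> top"
    proof
      assume top: "?A = top"
      have "AE x in M. x \<notin> Q"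
        using u_eq
      proof eventually_elim
        fix x assume "u0 x = ennreal (u x)"
        then show "x \<notin> Q" using le[of x] top by (auto simp: top_unique ennreal_mult_eq_top_iff)
      qed
      then have "Q \<in> null_sets M" using Q by (simp add: AE_iff_null_sets)
      then show False using cube_pos[OF Q] by auto
    qed
    ultimately obtain U where U: "?A = ennreal U" "0 < U" by (cases ?A) (auto simp: less_le)
    have "AE x in M. x \<in> Q \<longrightarrow> U \<le> 2 * B * u x"
      using u_eq
    proof eventually_elim
      fix x assume "u0 x = ennreal (u x)"
      then show "x \<in> Q \<longrightarrow> U \<le> 2 * B * u x"
        using le[of x] U B u_pos[of x]
            by (auto simp: ennreal_mult'[symmetric] ennreal_mult''[symmetric] ennreal_le_iff)
    qed
    with U show "\<exists>U>0. ?A = ennreal U \<and> (AE x in M. x \<in> Q \<longrightarrow> U \<le> 2 * B * u x)" by auto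
  qed
qed

end

section \<open>Products of powers of A_p and A_1 weights\<close>

lemma one_minus_conj_exp: "1 < p \<Longrightarrow> 1 - conj_exp p = - 1 / (p - 1)"
  by (simp add: conj_exp_def field_simps)

context laminar_family
begin

lemma avg_cong_AE:
  "AE x in M. x \<in> Q \<longrightarrow> f x = g x \<Longrightarrow> avg M Q f = avg M Q g"
  unfolding avg_def
  by (intro arg_cong2[where f="(/)"] nn_integral_cong_AE) (auto elim!: eventually_mono simp: indicator_def)

lemma avg_mono_AE:
  "AE x in M. x \<in> Q \<longrightarrow> f x \<le> g x \<Longrightarrow> avg M Q f \<le> avg M Q g"
  unfolding avg_def
  by (intro divide_right_mono_ennreal nn_integral_mono_AE)
    (auto elim!: eventually_mono simp: indicator_def ennreal_leI)

lemma avg_cmult: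
  assumes "Q \<in> \<Q>" "0 \<le> c" and [measurable]: "f \<in> borel_measurable M"
  shows "avg M Q (\<lambda>x. c * f x) = ennreal c * avg M Q f"
  using assms(1,2) by (simp add: avg_def ennreal_mult' mult.assoc nn_integral_cmult ennreal_times_divide)

lemma avg_one: "Q \<in> \<Q> \<Longrightarrow> avg M Q (\<lambda>x. 1) = 1"
  using cube_pos[of Q] cube_fin[of Q] by (simp add: avg_def ennreal_divide_self less_top)

lemma avg_Holder:
  assumes Q: "Q \<in> \<Q>" and \<theta>: "0 < \<theta>" "\<theta> < 1"
    and [measurable]: "a \<in> borel_measurable M" "b \<in> borel_measurable M"
    and nonneg: "AE x in M. 0 \<le> a x" "AE x in M. 0 \<le> b x"
  shows "avg M Q (\<lambda>x. a x powr \<theta> * b x powr (1 - \<theta>))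
      \<le> ennpowr (avg M Q a) \<theta> * ennpowr (avg M Q b) (1 - \<theta>)"
proof -
  let ?m = "inverse (emeasure M Q)"
  have [measurable]: "Q \<in> sets M" using Q by simp
  have "(\<integral>\<^sup>+x\<in>Q. ennreal (a x powr \<theta> * b x powr (1 - \<theta>)) \<partial>M)
      = (\<integral>\<^sup>+x. ennpowr (ennreal (a x) * indicator Q x) \<theta> * ennpowr (ennreal (b x) * indicator Q x) (1 - \<theta>) \<partial>M)"
    using nonneg by (intro nn_integral_cong_AE, eventually_elim) (simp add: indicator_def ennreal_mult')
  also have "\<dots> \<le> ennpowr (\<integral>\<^sup>+x\<in>Q. ennreal (a x) \<partial>M) \<theta> * ennpowr (\<integral>\<^sup>+x\<in>Q. ennreal (b x) \<partial>M) (1 - \<theta>)"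
    by (rule nn_integral_Holder[OF \<theta>]) measurable
  finally have "avg M Q (\<lambda>x. a x powr \<theta> * b x powr (1 - \<theta>))
      \<le> (ennpowr (\<integral>\<^sup>+x\<in>Q. ennreal (a x) \<partial>M) \<theta> * ennpowr (\<integral>\<^sup>+x\<in>Q. ennreal (b x) \<partial>M) (1 - \<theta>)) * ?m"
    unfolding avg_def divide_ennreal_def by (rule mult_right_mono) simp
  also have "?m = ennpowr ?m \<theta> * ennpowr ?m (1 - \<theta>)"
    by (simp add: ennpowr_add)
  finally show ?thesis
    by (simp only: avg_def divide_ennreal_def ennpowr_mult ac_simps)
qed

text \<open>The common core of both bounds for \<open>A_p0\<close> constants. The positive power of \<open>u\<close> is handled by Hoelder and leaves the factor \<open>U^(1-\<theta>)\<close>, the negative one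
by \<open>u \<ge> U / c\<close> on \<open>Q\<close> and leaves \<open>(c / U)^(1-\<theta>)\<close>. The average \<open>U\<close> of \<open>u\<close> cancels.\<close>

lemma avg_factor:
  fixes a b u :: "'a \<Rightarrow> real"
  assumes Q: "Q \<in> \<Q>" and \<theta>: "0 < \<theta>" "\<theta> < 1" and r: "0 < r" and c: "0 < c"
    and [measurable]: "a \<in> borel_measurable M" "b \<in> borel_measurable M" "u \<in> borel_measurable M"
    and nonneg: "AE x in M. 0 \<le> a x" "AE x in M. 0 \<le> b x" and u: "\<And>x. 0 < u x"
    and U: "0 < U" "avg M Q u = ennreal U" "AE x in M. x \<in> Q \<longrightarrow> U \<le> c * u x"
  shows "avg M Q (\<lambda>x. a x powr \<theta> * u x powr (1 - \<theta>))
        * ennpowr (avg M Q (\<lambda>x. b x * u x powr (- ((1 - \<theta>) * r)))) (1 / r)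
      \<le> ennreal (c powr (1 - \<theta>)) * (ennpowr (avg M Q a) \<theta> * ennpowr (avg M Q b) (1 / r))"
proof -
  let ?s = "(1 - \<theta>) * r"
  have s: "0 < ?s" using \<theta> r by simp
  have "avg M Q (\<lambda>x. b x * u x powr (- ?s)) \<le> avg M Q (\<lambda>x. (c / U) powr ?s * b x)"
  proof (rule avg_mono_AE, use U(3) nonneg(2) in eventually_elim, rule impI)
    fix x assume "x \<in> Q \<longrightarrow> U \<le> c * u x" and b: "0 \<le> b x" and "x \<in> Q"
    then have "U / c \<le> u x" using c by (simp add: field_simps)
    then have "u x powr (- ?s) \<le> (U / c) powr (- ?s)"
      using U(1) c s by (intro powr_mono2') auto
    also have "\<dots> = (c / U) powr ?s"
      using U(1) c by (simp add: powr_minus powr_divide)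
    finally show "b x * u x powr (- ?s) \<le> (c / U) powr ?s * b x"
      using b by (simp add: mult.commute mult_left_mono)
  qed
  also have "\<dots> = ennreal ((c / U) powr ?s) * avg M Q b"
    using Q by (intro avg_cmult) auto
  finally have "ennpowr (avg M Q (\<lambda>x. b x * u x powr (- ?s))) (1 / r)
      \<le> ennpowr (ennreal ((c / U) powr ?s) * avg M Q b) (1 / r)"
    using r by (intro ennpowr_mono) auto
  also have "\<dots> = ennreal ((c / U) powr (1 - \<theta>)) * ennpowr (avg M Q b) (1 / r)"
    using r by (simp add: ennpowr_mult powr_powr)
  finally have 2: "ennpowr (avg M Q (\<lambda>x. b x * u x powr (- ?s))) (1 / r)
    \<le> ennreal ((c / U) powr (1 - \<theta>)) * ennpowr (avg M Q b) (1 / r)" .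
  have "avg M Q (\<lambda>x. a x powr \<theta> * u x powr (1 - \<theta>))
      \<le> ennpowr (avg M Q a) \<theta> * ennpowr (avg M Q u) (1 - \<theta>)"
    using nonneg u by (intro avg_Holder Q \<theta>) (auto intro!: AE_I2 less_imp_le)
  also have "\<dots> = ennpowr (avg M Q a) \<theta> * ennreal (U powr (1 - \<theta>))"
    using U(1,2) by simp
  finally have "avg M Q (\<lambda>x. a x powr \<theta> * u x powr (1 - \<theta>))
        * ennpowr (avg M Q (\<lambda>x. b x * u x powr (- ?s))) (1 / r)
     \<le> (ennpowr (avg M Q a) \<theta> * ennreal (U powr (1 - \<theta>))) * (ennreal ((c / U) powr (1 - \<theta>)) * ennpowr (avg M Q b) (1 / r))"
    by (intro mult_mono 2) auto
  also have "\<dots> = (ennreal (U powr (1 - \<theta>)) * ennreal ((c / U) powr (1 - \<theta>))) * (ennpowr (avg M Q a) \<theta> * ennpowr (avg M Q b) (1 / r))"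
    by (simp only: ac_simps)
  also have "ennreal (U powr (1 - \<theta>)) * ennreal ((c / U) powr (1 - \<theta>)) = ennreal (c powr (1 - \<theta>))"
    using U(1) c by (simp add: ennreal_mult'[symmetric] powr_divide)
  finally show ?thesis .
qed

text \<open>Hoelder's inequality for the product \<open>w^(1/p) \<sigma>^(1-1/p) = 1\<close>, with \<open>\<sigma> = w^(1-q)\<close>.\<close>

lemma one_le_Ap_product:
  assumes Q: "Q \<in> \<Q>" and p: "1 < p" and [measurable]: "w \<in> borel_measurable M"
      and pos: "AE x in M. 0 < w x"
  shows "1 \<le> avg M Q w * ennpowr (avg M Q (\<lambda>x. w x powr (1 - conj_exp p))) (p - 1)"
proof -
  let ?s = "\<lambda>x. w x powr (1 - conj_exp p)"
  have "1 = avg M Q (\<lambda>x. w x powr (1 / p) * ?s x powr (1 - 1 / p))"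
  proof -
    have "avg M Q (\<lambda>x. w x powr (1 / p) * ?s x powr (1 - 1 / p)) = avg M Q (\<lambda>x. 1)"
    proof (rule avg_cong_AE, use pos in eventually_elim, rule impI)
      fix x assume w: "0 < w x"
      have "w x powr (1 / p) * ?s x powr (1 - 1 / p) = w x powr (1 / p + (1 - conj_exp p) * (1 - 1 / p))"
        by (simp add: powr_powr powr_add)
      also have "1 / p + (1 - conj_exp p) * (1 - 1 / p) = 0"
        using p by (simp add: one_minus_conj_exp field_simps)
      finally show "w x powr (1 / p) * ?s x powr (1 - 1 / p) = 1" using w by simp
    qed
    then show ?thesis using Q by (simp add: avg_one)
  qed
  also have "\<dots> \<le> ennpowr (avg M Q w) (1 / p) * ennpowr (avg M Q ?s) (1 - 1 / p)"
    using pos p by (intro avg_Holder Q) (auto elim!: eventually_mono)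
  finally have "ennpowr 1 p \<le> ennpowr (ennpowr (avg M Q w) (1 / p) * ennpowr (avg M Q ?s) (1 - 1 / p)) p"
    using p by (intro ennpowr_mono) auto
  also have "\<dots> = avg M Q w * ennpowr (avg M Q ?s) (p - 1)"
  proof -
    have "(1 - 1 / p) * p = p - 1" using p by (simp add: field_simps)
    then show ?thesis using p by (simp add: ennpowr_mult)
  qed
  finally show ?thesis by simp
qed

lemma one_le_A1_product:
  assumes Q: "Q \<in> \<Q>" and [measurable]: "w \<in> borel_measurable M" and pos: "AE x in M. 0 < w x"
  shows "1 \<le> avg M Q w * esssup (restrict_space M Q) (\<lambda>x. inverse (ennreal (w x)))"
proof -
  let ?E = "esssup (restrict_space M Q) (\<lambda>x. inverse (ennreal (w x)))"
  have [measurable]: "Q \<in> sets M" using Q by simp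
  have "AE x in restrict_space M Q. inverse (ennreal (w x)) \<le> ?E" by (rule esssup_AE)
  then have "AE x in M. x \<in> Q \<longrightarrow> inverse (ennreal (w x)) \<le> ?E"
    by (subst (asm) AE_restrict_space_iff) (auto simp: Int_absorb1)
  with pos have le: "AE x in M. indicator Q x \<le> ?E * (ennreal (w x) * indicator Q x)"
  proof eventually_elim
    fix x assume "0 < w x" "x \<in> Q \<longrightarrow> inverse (ennreal (w x)) \<le> ?E"
    then have "x \<in> Q \<Longrightarrow> inverse (ennreal (w x)) * ennreal (w x) \<le> ?E * ennreal (w x)"
      by (intro mult_right_mono) auto
    then show "indicator Q x \<le> ?E * (ennreal (w x) * indicator Q x)"
      using \<open>0 < w x\<close> by (cases "x \<in> Q") (auto simp: inverse_ennreal ennreal_mult'[symmetric])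
  qed
  have "emeasure M Q = (\<integral>\<^sup>+x. indicator Q x \<partial>M)" by simp
  also have "\<dots> \<le> (\<integral>\<^sup>+x. ?E * (ennreal (w x) * indicator Q x) \<partial>M)"
    by (rule nn_integral_mono_AE[OF le])
  also have "\<dots> = ?E * (\<integral>\<^sup>+x\<in>Q. ennreal (w x) \<partial>M)" by (rule nn_integral_cmult) measurable
  finally have "emeasure M Q / emeasure M Q \<le> ?E * (\<integral>\<^sup>+x\<in>Q. ennreal (w x) \<partial>M) / emeasure M Q"
    by (rule divide_right_mono_ennreal)
  then show ?thesis using cube_pos[OF Q] cube_fin[OF Q]
    by (simp add: avg_def ennreal_divide_self less_top ennreal_divide_times mult.commute ennreal_times_divide)
qed

end

locale dyadic_family = laminar_family M "cubes \<D>" for M :: "'a measure" and \<D> +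
  assumes space_nonempty: "space M \<noteq> {}"
begin

lemma obtain_cube: obtains Q where "Q \<in> cubes \<D>"
  using cover space_nonempty by auto

lemma Ap_const_least:
  assumes "1 < p" and "\<And>Q. Q \<in> cubes \<D>
      \<Longrightarrow> avg M Q w * ennpowr (avg M Q (\<lambda>x. w x powr (1 - conj_exp p))) (p - 1) \<le> A"
  shows "Ap_const M \<D> p w \<le> A"
  using assms by (auto simp: Ap_const_def intro: SUP_least)

lemma Ap_const_upper:
  assumes "1 < p" "Q \<in> cubes \<D>"
  shows "avg M Q w * ennpowr (avg M Q (\<lambda>x. w x powr (1 - conj_exp p))) (p - 1) \<le> Ap_const M \<D> p w"
  using assms by (auto simp: Ap_const_def intro: SUP_upper)

lemma one_le_Ap_const:
  assumes p: "1 \<le> p" and [measurable]: "w \<in> borel_measurable M" and pos: "AE x in M. 0 < w x"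
  shows "1 \<le> Ap_const M \<D> p w"
proof -
  obtain Q where Q: "Q \<in> cubes \<D>" by (rule obtain_cube)
  show ?thesis
  proof (cases "p = 1")
    case True
    show ?thesis unfolding Ap_const_def if_P[OF True]
      by (rule SUP_upper2[OF Q]) (rule one_le_A1_product[OF Q _ pos], measurable)
  next
    case False
    then show ?thesis using p one_le_Ap_product[OF Q _ _ pos, of p] Ap_const_upper[OF _ Q, of p w]
      by (auto intro: order_trans)
  qed
qed

lemma Ap_const_finite_imp_integrable:
  assumes p: "1 \<le> p" and [measurable]: "w \<in> borel_measurable M" and pos: "AE x in M. 0 < w x"
    and fin: "Ap_const M \<D> p w < top" and Q: "Q \<in> cubes \<D>"
  shows "(\<integral>\<^sup>+x\<in>Q. ennreal (w x) \<partial>M) < top"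
proof (cases "p = 1")
  case False
  then have p: "1 < p" using p by simp
  have "(\<integral>\<^sup>+x\<in>Q. ennreal (w x) \<partial>M) \<noteq> 0" "(\<integral>\<^sup>+x\<in>Q. ennreal (w x powr (1 - conj_exp p)) \<partial>M) \<noteq> 0"
    using pos by (intro cube_integral_pos Q; auto elim!: eventually_mono)+
  from Ap_product_finite(1)[OF _ this cube_pos[OF Q] cube_fin[OF Q]] show ?thesis
    using Ap_const_upper[OF p Q, of w] fin by (auto simp: avg_def dest: le_less_trans)
next
  case True
  let ?E = "esssup (restrict_space M Q) (\<lambda>x. inverse (ennreal (w x)))"
  have le: "avg M Q w * ?E < top"
  proof (rule le_less_trans[OF _ fin])
    show "avg M Q w * ?E \<le> Ap_const M \<D> p w"
      unfolding Ap_const_def if_P[OF True] using Q by (rule SUP_upper)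
  qed
  have "?E \<noteq> 0"
    using one_le_A1_product[OF Q _ pos] by auto
  then have "avg M Q w \<noteq> top" using le by (auto simp: ennreal_top_mult)
  then show ?thesis using cube_fin[OF Q] cube_pos[OF Q]
    by (auto simp: avg_def ennreal_divide_eq_top_iff top.not_eq_extremum)
qed

text \<open>Here \<open>avg_factor\<close> is used with the roles exchanged: the dual weight of \<open>W = w u^(p-p0)\<close> is \<open>s^\<theta> u^(1-\<theta>)\<close> with \<open>\<theta> = (p - 1) / (p0 - 1)\<close>, where \<open>s\<close> is the dual
weight of \<open>w\<close>, and \<open>W\<close> itself carries the negative power of \<open>u\<close>.\<close>

lemma Ap_const_times_A1_power:
  assumes p: "1 < p" "p < p0" and c: "0 < c"
    and [measurable]: "w \<in> borel_measurable M" "u \<in> borel_measurable M"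
    and w_pos: "AE x in M. 0 < w x" and u: "\<And>x. 0 < u x"
    and A1: "\<And>Q. Q \<in> cubes \<D> \<Longrightarrow> \<exists>U>0. avg M Q u = ennreal U \<and> (AE x in M. x \<in> Q \<longrightarrow> U \<le> c * u x)"
  shows "Ap_const M \<D> p0 (\<lambda>x. w x * u x powr (p - p0)) \<le> ennreal (c powr (p0 - p)) * Ap_const M \<D> p w"
proof (rule Ap_const_least)
  fix Q assume Q: "Q \<in> cubes \<D>"
  obtain U where U: "0 < U" "avg M Q u = ennreal U" "AE x in M. x \<in> Q \<longrightarrow> U \<le> c * u x" using A1[OF Q]
      by auto
  define \<theta> where "\<theta> = (p - 1) / (p0 - 1)"
  define r where "r = p0 - 1"
  define s where "s x = w x powr (1 - conj_exp p)" for x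
  let ?W = "\<lambda>x. w x * u x powr (p - p0)"
  have \<theta>: "0 < \<theta>" "\<theta> < 1" and r: "0 < r" using p by (auto simp: \<theta>_def r_def)
  have [measurable]: "s \<in> borel_measurable M" unfolding s_def by measurable
  have e: "(1 - \<theta>) * r = p0 - p" "r * (1 - \<theta>) = p0 - p" "\<theta> * r = p - 1" using p
      by (auto simp: \<theta>_def r_def field_simps)
  have W: "?W = (\<lambda>x. w x * u x powr (- ((1 - \<theta>) * r)))" by (simp add: e)
  have sW: "avg M Q (\<lambda>x. ?W x powr (1 - conj_exp p0)) = avg M Q (\<lambda>x. s x powr \<theta> * u x powr (1 - \<theta>))"
  proof (rule avg_cong_AE, use w_pos in eventually_elim, rule impI)
    fix x assume w: "0 < w x"
    have "(p - p0) * (1 - conj_exp p0) = 1 - \<theta>" "1 - conj_exp p0 = (1 - conj_exp p) * \<theta>"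
      using p by (simp_all add: one_minus_conj_exp \<theta>_def field_simps)
    then show "?W x powr (1 - conj_exp p0) = s x powr \<theta> * u x powr (1 - \<theta>)"
      using w u[of x] by (simp add: powr_mult powr_powr s_def)
  qed
  have "avg M Q (\<lambda>x. s x powr \<theta> * u x powr (1 - \<theta>)) * ennpowr (avg M Q (\<lambda>x. w x * u x powr (- ((1 - \<theta>) * r)))) (1 / r)
      \<le> ennreal (c powr (1 - \<theta>)) * (ennpowr (avg M Q s) \<theta> * ennpowr (avg M Q w) (1 / r))"
    using w_pos by (intro avg_factor[OF Q \<theta> r c _ _ _ _ _ u U]) (auto simp: s_def elim!: eventually_mono)
  then have "ennpowr (avg M Q (\<lambda>x. ?W x powr (1 - conj_exp p0)) * ennpowr (avg M Q ?W) (1 / r)) r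
      \<le> ennpowr (ennreal (c powr (1 - \<theta>)) * (ennpowr (avg M Q s) \<theta> * ennpowr (avg M Q w) (1 / r))) r"
    unfolding sW W[symmetric] using r by (intro ennpowr_mono) auto
  then have "avg M Q ?W * ennpowr (avg M Q (\<lambda>x. ?W x powr (1 - conj_exp p0))) r
      \<le> ennreal (c powr (p0 - p)) * (avg M Q w * ennpowr (avg M Q s) (p - 1))"
    using r by (simp add: ennpowr_mult powr_powr e mult.commute)
  also have "\<dots> \<le> ennreal (c powr (p0 - p)) * Ap_const M \<D> p w"
    unfolding s_def using p Q by (intro mult_left_mono Ap_const_upper) auto
  finally show "avg M Q ?W * ennpowr (avg M Q (\<lambda>x. ?W x powr (1 - conj_exp p0))) (p0 - 1)
      \<le> ennreal (c powr (p0 - p)) * Ap_const M \<D> p w" by (simp add: r_def)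
qed (use p in simp)

text \<open>For \<open>p0 > 1\<close> the weight \<open>W\<close> carries the positive power of \<open>u\<close> and its dual weight is \<open>s u^(-(1-\<theta>)r)\<close> with \<open>r = 1 / (p0 - 1)\<close>, so \<open>avg_factor\<close> applies
directly. For \<open>p0 = 1\<close> the exponent \<open>\<theta>\<close> is zero and \<open>W = u\<close> is itself the \<open>A_1\<close> weight.\<close>

lemma Ap_const_interpolate_A1:
  assumes p: "1 \<le> p0" "p0 < p" and c: "0 < c"
    and [measurable]: "w \<in> borel_measurable M" "u \<in> borel_measurable M"
    and w_pos: "AE x in M. 0 < w x" and u: "\<And>x. 0 < u x"
    and A1: "\<And>Q. Q \<in> cubes \<D> \<Longrightarrow> \<exists>U>0. avg M Q u = ennreal U \<and> (AE x in M. x \<in> Q \<longrightarrow> U \<le> c * u x)"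
    and fin: "Ap_const M \<D> p w < top"
  defines "\<theta> \<equiv> (p0 - 1) / (p - 1)"
  shows "Ap_const M \<D> p0 (\<lambda>x. w x powr \<theta> * u x powr (1 - \<theta>))
      \<le> ennreal (c powr (1 - \<theta>)) * ennpowr (Ap_const M \<D> p w) \<theta>"
proof (cases "p0 = 1")
  case True
  have A: "ennpowr (Ap_const M \<D> p w) \<theta> = 1"
    using one_le_Ap_const[of p w] fin p w_pos True
    by (cases "Ap_const M \<D> p w") (auto simp: \<theta>_def ennreal_le_iff2 simp flip: ennreal_1)
  have "avg M Q (\<lambda>x. w x powr \<theta> * u x powr (1 - \<theta>)) * esssup (restrict_space M Q) (\<lambda>x. inverse (ennreal (w x powr \<theta> * u x powr (1 - \<theta>)))) \<le> ennreal c"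
    if Q: "Q \<in> cubes \<D>" for Q
  proof -
    obtain U where U: "0 < U" "avg M Q u = ennreal U" "AE x in M. x \<in> Q \<longrightarrow> U \<le> c * u x"
        using A1[OF Q] by auto
    have W: "avg M Q (\<lambda>x. w x powr \<theta> * u x powr (1 - \<theta>)) = ennreal U"
      unfolding U(2)[symmetric]
    proof (rule avg_cong_AE, use w_pos in eventually_elim, rule impI)
      fix x assume "0 < w x" then show "w x powr \<theta> * u x powr (1 - \<theta>) = u x"
        using u[of x] True by (simp add: \<theta>_def)
    qed
    have "esssup (restrict_space M Q) (\<lambda>x. inverse (ennreal (w x powr \<theta> * u x powr (1 - \<theta>))))
        \<le> ennreal (c / U)"
    proof (rule esssup_I)
      have "AE x in M. x \<in> Q \<longrightarrow> inverse (ennreal (w x powr \<theta> * u x powr (1 - \<theta>))) \<le> ennreal (c / U)"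
        using U(3) w_pos
      proof eventually_elim
        fix x assume *: "x \<in> Q \<longrightarrow> U \<le> c * u x" "0 < w x"
        have "w x powr \<theta> * u x powr (1 - \<theta>) = u x" using *(2) u[of x] True by (simp add: \<theta>_def)
        then show "x \<in> Q \<longrightarrow> inverse (ennreal (w x powr \<theta> * u x powr (1 - \<theta>))) \<le> ennreal (c / U)"
          using * u[of x] U(1) by (auto simp: inverse_ennreal intro!: ennreal_leI simp: field_simps)
      qed
      then show "AE x in restrict_space M Q. inverse (ennreal (w x powr \<theta> * u x powr (1 - \<theta>)))
          \<le> ennreal (c / U)"
        using Q by (subst AE_restrict_space_iff) auto
    qed (intro measurable_restrict_space1, measurable)
    then have "avg M Q (\<lambda>x. w x powr \<theta> * u x powr (1 - \<theta>)) * esssup (restrict_space M Q) (\<lambda>x. inverse (ennreal (w x powr \<theta> * u x powr (1 - \<theta>))))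
       \<le> ennreal U * ennreal (c / U)"
      unfolding W by (intro mult_left_mono) auto
    also have "\<dots> = ennreal c" using U(1) c by (simp add: ennreal_mult'[symmetric])
    finally show ?thesis .
  qed
  then have "Ap_const M \<D> p0 (\<lambda>x. w x powr \<theta> * u x powr (1 - \<theta>)) \<le> ennreal c"
    unfolding Ap_const_def if_P[OF True] by (rule SUP_least)
  then show ?thesis using True c by (simp add: A) (simp add: \<theta>_def)
next
  case False
  with p have p0: "1 < p0" by simp
  show ?thesis
  proof (rule Ap_const_least[OF p0])
    fix Q assume Q: "Q \<in> cubes \<D>"
    obtain U where U: "0 < U" "avg M Q u = ennreal U" "AE x in M. x \<in> Q \<longrightarrow> U \<le> c * u x"
        using A1[OF Q] by auto
    define r where "r = 1 / (p0 - 1)"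
    define s where "s x = w x powr (1 - conj_exp p)" for x
    let ?W = "\<lambda>x. w x powr \<theta> * u x powr (1 - \<theta>)"
    have \<theta>: "0 < \<theta>" "\<theta> < 1" and r: "0 < r" using p p0 by (auto simp: \<theta>_def r_def)
    have [measurable]: "s \<in> borel_measurable M" unfolding s_def by measurable
    have e: "(p - 1) * \<theta> = p0 - 1" "1 / r = p0 - 1" using p by (auto simp: \<theta>_def r_def)
    have sW: "avg M Q (\<lambda>x. ?W x powr (1 - conj_exp p0)) = avg M Q (\<lambda>x. s x * u x powr (- ((1 - \<theta>) * r)))"
    proof (rule avg_cong_AE, use w_pos in eventually_elim, rule impI)
      fix x assume w: "0 < w x"
      have "1 - conj_exp p = \<theta> * (1 - conj_exp p0)" "1 - conj_exp p0 = - r"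
        using p p0 by (simp_all add: one_minus_conj_exp \<theta>_def r_def field_simps)
      then show "?W x powr (1 - conj_exp p0) = s x * u x powr (- ((1 - \<theta>) * r))"
        using w u[of x] by (simp add: powr_mult powr_powr s_def)
    qed
    have "avg M Q ?W * ennpowr (avg M Q (\<lambda>x. s x * u x powr (- ((1 - \<theta>) * r)))) (1 / r)
        \<le> ennreal (c powr (1 - \<theta>)) * (ennpowr (avg M Q w) \<theta> * ennpowr (avg M Q s) (1 / r))"
      using w_pos by (intro avg_factor[OF Q \<theta> r c _ _ _ _ _ u U]) (auto simp: s_def elim!: eventually_mono)
    also have "\<dots> = ennreal (c powr (1 - \<theta>)) * ennpowr (avg M Q w * ennpowr (avg M Q s) (p - 1)) \<theta>"
      by (simp add: ennpowr_mult e)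
    also have "\<dots> \<le> ennreal (c powr (1 - \<theta>)) * ennpowr (Ap_const M \<D> p w) \<theta>"
      unfolding s_def using p p0 Q \<theta> by (intro mult_left_mono ennpowr_mono Ap_const_upper) auto
    finally show "avg M Q ?W * ennpowr (avg M Q (\<lambda>x. ?W x powr (1 - conj_exp p0))) (p0 - 1)
        \<le> ennreal (c powr (1 - \<theta>)) * ennpowr (Ap_const M \<D> p w) \<theta>" by (simp add: sW e)
  qed
qed

end

section \<open>The operator norm of the maximal operator\<close>

text \<open>The product of the two constants in Doob's inequality for the exponents \<open>p\<close> and \<open>q\<close>. It is symmetric under conjugation, so the
same constant serves the dual weight.\<close>

definition buckley_const :: "real \<Rightarrow> real" where
  "buckley_const p = (let q = conj_exp p in (q * 2 powr q / (q - 1)) * (p * 2 powr p / (p - 1)))"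

lemma conj_exp_gt_1: "1 < p \<Longrightarrow> 1 < conj_exp p"
  by (simp add: conj_exp_def)

lemma conj_exp_conj_exp: "1 < p \<Longrightarrow> conj_exp (conj_exp p) = p"
  by (simp add: conj_exp_def field_simps)

lemma conj_exp_minus_1: "1 < p \<Longrightarrow> conj_exp p - 1 = 1 / (p - 1)"
  by (simp add: conj_exp_def field_simps)

lemma buckley_const_pos: "1 < p \<Longrightarrow> 0 < buckley_const p"
  using conj_exp_gt_1[of p] by (simp add: buckley_const_def Let_def)

lemma buckley_const_conj: "1 < p \<Longrightarrow> buckley_const (conj_exp p) = buckley_const p"
  by (simp add: buckley_const_def Let_def conj_exp_conj_exp mult.commute)

context dyadic_family
begin

lemma maximal_op_eq: "maximal_op M \<D> f = maxf (\<lambda>y. ennreal \<bar>f y\<bar>)"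
  by (simp add: maximal_op_def mx_def avg_def fun_eq_iff)

lemma maximal_norm_le:
  fixes w s :: "'a \<Rightarrow> real" and A :: ennreal
  assumes p: "1 < p"
    and [measurable]: "w \<in> borel_measurable M" "s \<in> borel_measurable M"
    and w_pos: "AE x in M. 0 < w x" and s_eq: "AE x in M. s x = w x powr (- 1 / (p - 1))"
    and A: "A < top"
    and Ap: "\<And>Q. Q \<in> cubes \<D> \<Longrightarrow> avg M Q w * ennpowr (avg M Q s) (p - 1) \<le> A"
  shows "maximal_norm M \<D> p w \<le> ennreal (buckley_const p powr (1 / p)) * ennpowr A (1 / (p - 1))"
  unfolding maximal_norm_def
proof (rule SUP_least, clarify)
  fix f :: "'a \<Rightarrow> real" assume [measurable]: "f \<in> borel_measurable M"
      and f: "Lp_norm M p w (\<lambda>x. ennreal \<bar>f x\<bar>) \<le> 1"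
  let ?q = "p / (p - 1)"
  have f1: "(\<integral>\<^sup>+x. ennpowr (ennreal \<bar>f x\<bar>) p * ennreal (w x) \<partial>M) \<le> 1"
    using f p by (simp add: Lp_norm_def ennpowr_le_iff)
  have "(\<integral>\<^sup>+x. ennpowr (maxf (\<lambda>x. ennreal \<bar>f x\<bar>) x) p * ennreal (w x) \<partial>M)
      \<le> ennpowr A ?q * (ennreal (?q * 2 powr ?q / (?q - 1)) * (ennreal (p * 2 powr p / (p - 1)) * (\<integral>\<^sup>+x. ennpowr (ennreal \<bar>f x\<bar>) p * ennreal (w x) \<partial>M)))"
    using Ap by (intro buckley_bound[OF p _ _ w_pos s_eq A]) (auto simp: avg_def)
  also have "\<dots> \<le> ennpowr A ?q * (ennreal (?q * 2 powr ?q / (?q - 1)) * (ennreal (p * 2 powr p / (p - 1)) * 1))"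
    by (intro mult_left_mono f1) auto
  also have "\<dots> = ennpowr A ?q * ennreal (buckley_const p)"
    using p conj_exp_gt_1[OF p] unfolding buckley_const_def Let_def conj_exp_def[symmetric]
    by (simp add: ennreal_mult'[symmetric])
  finally have "Lp_norm M p w (maximal_op M \<D> f)
      \<le> ennpowr (ennpowr A ?q * ennreal (buckley_const p)) (1 / p)"
    unfolding Lp_norm_def maximal_op_eq using p by (intro ennpowr_mono) auto
  also have "\<dots> = ennreal (buckley_const p powr (1 / p)) * ennpowr A (1 / (p - 1))"
    using p buckley_const_pos[OF p] by (simp add: ennpowr_mult mult.commute)
  finally show "Lp_norm M p w (maximal_op M \<D> f)
      \<le> ennreal (buckley_const p powr (1 / p)) * ennpowr A (1 / (p - 1))" .
qed

text \<open>A normalised indicator of a cube \<open>Q\<close> is a test function, and its maximal function is at least as large on \<open>Q\<close>.\<close>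

lemma one_le_maximal_norm:
  assumes p: "1 < p" and [measurable]: "w \<in> borel_measurable M"
    and w_pos: "AE x in M. 0 < w x" and fin: "\<And>Q. Q \<in> cubes \<D> \<Longrightarrow> (\<integral>\<^sup>+x\<in>Q. ennreal (w x) \<partial>M) < top"
  shows "1 \<le> maximal_norm M \<D> p w"
proof -
  obtain Q where Q: "Q \<in> cubes \<D>" by (rule obtain_cube)
  then have [measurable]: "Q \<in> sets M" by simp
  have "(\<integral>\<^sup>+x\<in>Q. ennreal (w x) \<partial>M) \<noteq> 0"
    using w_pos by (intro cube_integral_pos Q) auto
  then obtain W where W: "(\<integral>\<^sup>+x\<in>Q. ennreal (w x) \<partial>M) = ennreal W" "0 < W"
    using fin[OF Q] by (cases "\<integral>\<^sup>+x\<in>Q. ennreal (w x) \<partial>M") (auto simp: less_le)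
  define a where "a = (1 / W) powr (1 / p)"
  define f where "f x = a * indicator Q x" for x
  have a: "0 < a" "a powr p = 1 / W" using W p by (simp_all add: a_def powr_powr)
  have [measurable]: "f \<in> borel_measurable M" unfolding f_def by measurable
  have 1: "(\<integral>\<^sup>+x. ennpowr (ennreal a * indicator Q x) p * ennreal (w x) \<partial>M) = 1"
  proof -
    have "(\<integral>\<^sup>+x. ennpowr (ennreal a * indicator Q x) p * ennreal (w x) \<partial>M)
      = (\<integral>\<^sup>+x. ennreal (1 / W) * (ennreal (w x) * indicator Q x) \<partial>M)"
      using a by (intro nn_integral_cong) (simp add: indicator_def)
    also have "\<dots> = ennreal (1 / W) * ennreal W" by (subst nn_integral_cmult) (auto simp: W)
    finally show ?thesis using W by (simp add: ennreal_mult'[symmetric])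
  qed
  have abs_f: "ennreal \<bar>f x\<bar> = ennreal a * indicator Q x" for x
    using a by (simp add: f_def indicator_def)
  have "Lp_norm M p w (\<lambda>x. ennreal \<bar>f x\<bar>) \<le> 1"
    unfolding abs_f Lp_norm_def by (simp add: 1)
  then have upper: "Lp_norm M p w (maximal_op M \<D> f) \<le> maximal_norm M \<D> p w"
    unfolding maximal_norm_def by (intro SUP_upper) simp
  have "ennreal a * indicator Q x \<le> maxf (\<lambda>y. ennreal \<bar>f y\<bar>) x" for x
  proof (cases "x \<in> Q")
    case True
    have "(\<integral>\<^sup>+y\<in>Q. ennreal \<bar>f y\<bar> \<partial>M) = (\<integral>\<^sup>+y. ennreal a * indicator Q y \<partial>M)"
      by (intro nn_integral_cong) (simp add: abs_f indicator_def)
    also have "\<dots> = ennreal a * emeasure M Q" by (rule nn_integral_cmult_indicator) simp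
    finally have "ennreal a = (\<integral>\<^sup>+y\<in>Q. ennreal \<bar>f y\<bar> \<partial>M) / emeasure M Q"
      using cube_pos[OF Q] cube_fin[OF Q] by (simp add: mult_divide_eq_ennreal)
    also have "\<dots> \<le> maxf (\<lambda>y. ennreal \<bar>f y\<bar>) x" by (rule avg_le_mx[OF Q True])
    finally show ?thesis using True by simp
  qed simp
  then have "1 \<le> (\<integral>\<^sup>+x. ennpowr (maximal_op M \<D> f x) p * ennreal (w x) \<partial>M)"
    unfolding 1[symmetric] maximal_op_eq using p
        by (intro nn_integral_mono mult_right_mono ennpowr_mono) auto
  then have "ennpowr 1 (1 / p) \<le> Lp_norm M p w (maximal_op M \<D> f)"
    unfolding Lp_norm_def using p by (intro ennpowr_mono) auto
  with upper show ?thesis by simp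
qed

text \<open>The norm is a supremum over real functions with norm at most one; homogeneity extends the estimate to functions with values in
\<open>[0, \<infinity>]\<close>.\<close>

lemma maximal_norm_bound:
  assumes p: "1 < p" and [measurable]: "w \<in> borel_measurable M"
    and w_pos: "AE x in M. 0 < w x"
    and norm: "maximal_norm M \<D> p w = ennreal B" "0 < B"
    and [measurable]: "F \<in> borel_measurable M"
  shows "(\<integral>\<^sup>+x. ennpowr (maxf F x) p * ennreal (w x) \<partial>M)
      \<le> ennreal (B powr p) * (\<integral>\<^sup>+x. ennpowr (F x) p * ennreal (w x) \<partial>M)"
    (is "?L \<le> _ * ?J")
proof -
  consider "?J = 0" | "?J = top" | j where "?J = ennreal j" "0 < j"
    by (cases ?J) (auto simp: less_le)
  then show ?thesis
  proof cases
    case 1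
    then have "AE x in M. ennpowr (F x) p * ennreal (w x) = 0" by (subst (asm) nn_integral_0_iff_AE) auto
    with w_pos have "AE x in M. F x = 0" by eventually_elim auto
    then have "maxf F = maxf (\<lambda>x. 0)" by (rule mx_cong_AE)
    moreover have "maxf (\<lambda>x. 0) x = 0" for x 
      unfolding le_zero_eq[symmetric] by (rule mx_least) simp
    ultimately show ?thesis by simp
  next
    case 2
    then show ?thesis using norm by (simp add: ennreal_mult_top)
  next
    case 3
    then have "AE x in M. ennpowr (F x) p * ennreal (w x) \<noteq> top"
      by (intro nn_integral_noteq_infinite[unfolded infinity_ennreal_def]) auto
    with w_pos have F_fin: "AE x in M. F x \<noteq> top" by eventually_elim (auto simp: ennreal_top_mult)
    \<comment> \<open>The scaling that makes the norm of the test function \<open>f\<close> equal to one.\<close>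
    define a where "a = (1 / j) powr (1 / p)"
    have a: "0 < a" "a powr p = 1 / j" using 3 p by (simp_all add: a_def powr_powr)
    define f where "f x = a * enn2real (F x)" for x
    have [measurable]: "f \<in> borel_measurable M" unfolding f_def by measurable
    have f_eq: "AE x in M. ennreal \<bar>f x\<bar> = ennreal a * F x"
      using F_fin by eventually_elim (use a in \<open>simp add: f_def ennreal_mult less_top\<close>)
    have "(\<integral>\<^sup>+x. ennpowr (ennreal \<bar>f x\<bar>) p * ennreal (w x) \<partial>M)
        = (\<integral>\<^sup>+x. ennreal (1 / j) * (ennpowr (F x) p * ennreal (w x)) \<partial>M)"
      using f_eq a by (intro nn_integral_cong_AE)
        (auto elim!: eventually_mono simp: ennpowr_mult mult.assoc simp del: ennpowr_ennreal, simp add: mult.assoc)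
    also have "\<dots> = ennreal (1 / j) * ?J" by (rule nn_integral_cmult) measurable
    also have "\<dots> = 1" using 3 by (simp add: ennreal_mult'[symmetric])
    finally have "Lp_norm M p w (\<lambda>x. ennreal \<bar>f x\<bar>) \<le> 1" by (simp add: Lp_norm_def)
    then have "Lp_norm M p w (maximal_op M \<D> f) \<le> ennreal B"
      unfolding norm(1)[symmetric] maximal_norm_def by (intro SUP_upper) simp
    then have "(\<integral>\<^sup>+x. ennpowr (maximal_op M \<D> f x) p * ennreal (w x) \<partial>M) \<le> ennreal (B powr p)"
      using p norm by (simp add: Lp_norm_def ennpowr_le_iff)
    also have "maximal_op M \<D> f x = ennreal a * maxf F x" for x
      unfolding maximal_op_eq mx_cong_AE[OF f_eq] by (rule mx_cmult) measurable
    then have "(\<integral>\<^sup>+x. ennpowr (maximal_op M \<D> f x) p * ennreal (w x) \<partial>M)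
        = (\<integral>\<^sup>+x. ennreal (1 / j) * (ennpowr (maxf F x) p * ennreal (w x)) \<partial>M)"
      using a by (simp add: ennpowr_mult mult.assoc)
    also have "\<dots> = ennreal (1 / j) * ?L" by (rule nn_integral_cmult) measurable
    finally have "ennreal j * (ennreal (1 / j) * ?L) \<le> ennreal j * ennreal (B powr p)"
      by (rule mult_left_mono) simp
    then show ?thesis using 3 by (simp add: mult.assoc[symmetric] ennreal_mult'[symmetric] mult.commute)
  qed
qed

lemma maximal_norm_Ap:
  assumes p: "1 < p" and [measurable]: "w \<in> borel_measurable M" and w_pos: "AE x in M. 0 < w x"
    and A: "Ap_const M \<D> p w = ennreal A" "0 \<le> A"
  shows "\<exists>B\<ge>1. maximal_norm M \<D> p w = ennreal B \<and> B
      \<le> buckley_const p powr (1 / p) * A powr (1 / (p - 1))"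
proof -
  have le: "maximal_norm M \<D> p w
      \<le> ennreal (buckley_const p powr (1 / p)) * ennpowr (ennreal A) (1 / (p - 1))"
    using Ap_const_upper[OF p, of _ w] w_pos A
    by (intro maximal_norm_le[OF p, of w "\<lambda>x. w x powr (1 - conj_exp p)"]) (auto simp: one_minus_conj_exp[OF p])
  have "1 \<le> maximal_norm M \<D> p w"
    using Ap_const_finite_imp_integrable[of p w] p w_pos A by (intro one_le_maximal_norm) auto
  with le A(2) show ?thesis
    by (cases "maximal_norm M \<D> p w") (auto simp: ennreal_mult'[symmetric] top_unique ennreal_le_iff2 simp flip: ennreal_1)
qed

text \<open>The dual weight \<open>\<sigma>\<close> lies in \<open>A_q\<close> with constant \<open>[w]^(q-1)\<close>, so Buckley's exponent \<open>1 / (q - 1)\<close> makes the norm on \<open>L^q(\<sigma>)\<close> linear in \<open>[w]\<close>.\<close>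

lemma maximal_norm_dual:
  assumes p: "1 < p" and [measurable]: "w \<in> borel_measurable M" and w_pos: "AE x in M. 0 < w x"
    and A: "Ap_const M \<D> p w = ennreal A" "0 \<le> A"
  defines "q \<equiv> conj_exp p"
  shows "\<exists>B\<ge>1. maximal_norm M \<D> q (\<lambda>x. w x powr (1 - q)) = ennreal B \<and> B
      \<le> buckley_const p powr (1 / q) * A"
proof -
  let ?s = "\<lambda>x. w x powr (1 - q)"
  have q: "1 < q" and q1: "q - 1 = 1 / (p - 1)" using p
      by (simp_all add: q_def conj_exp_gt_1 conj_exp_minus_1)
  have s_pos: "AE x in M. 0 < ?s x" using w_pos by eventually_elim simp
  have w_eq: "AE x in M. w x = ?s x powr (- 1 / (q - 1))"
  proof -
    have "(1 - q) * (- 1 / (q - 1)) = 1" using q by (simp add: field_simps)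
    then show ?thesis using w_pos
        by (auto elim!: eventually_mono simp del: minus_divide_left simp: powr_powr)
  qed
  have Ap: "avg M Q ?s * ennpowr (avg M Q w) (q - 1) \<le> ennpowr (ennreal A) (q - 1)"
      if Q: "Q \<in> cubes \<D>" for Q
  proof -
    have "ennpowr (avg M Q w * ennpowr (avg M Q ?s) (p - 1)) (q - 1) \<le> ennpowr (ennreal A) (q - 1)"
      using Ap_const_upper[OF p Q, of w] A q by (intro ennpowr_mono) (auto simp: q_def)
    then show ?thesis using p by (simp add: ennpowr_mult q1 mult.commute)
  qed
  have fin: "(\<integral>\<^sup>+x\<in>Q. ennreal (?s x) \<partial>M) < top" if Q: "Q \<in> cubes \<D>" for Q
  proof (rule Ap_product_finite(1))
    show "(\<integral>\<^sup>+x\<in>Q. ennreal (?s x) \<partial>M) / emeasure M Q * ennpowr ((\<integral>\<^sup>+x\<in>Q. ennreal (w x) \<partial>M) / emeasure M Q) (q - 1) < top"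
      using Ap[OF Q] A by (auto simp: avg_def intro: le_less_trans)
    show "(\<integral>\<^sup>+x\<in>Q. ennreal (?s x) \<partial>M) \<noteq> 0" "(\<integral>\<^sup>+x\<in>Q. ennreal (w x) \<partial>M) \<noteq> 0"
      using w_pos s_pos by (intro cube_integral_pos Q; simp)+
  qed (use cube_pos[OF Q] cube_fin[OF Q] in auto)
  have "maximal_norm M \<D> q ?s
      \<le> ennreal (buckley_const q powr (1 / q)) * ennpowr (ennpowr (ennreal A) (q - 1)) (1 / (q - 1))"
    using A s_pos w_eq Ap by (intro maximal_norm_le[OF q, of ?s w]) (auto simp del: ennpowr_ennreal)
  also have "\<dots> = ennreal (buckley_const p powr (1 / q) * A)"
    using q A p by (simp add: powr_powr ennreal_mult' buckley_const_conj[OF p, folded q_def])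
  finally have le: "maximal_norm M \<D> q ?s \<le> ennreal (buckley_const p powr (1 / q) * A)" .
  have "1 \<le> maximal_norm M \<D> q ?s"
    using q s_pos fin by (intro one_le_maximal_norm) auto
  with le A(2) show ?thesis
    by (cases "maximal_norm M \<D> q ?s") (auto simp: top_unique ennreal_le_iff2 simp flip: ennreal_1)
qed

end

section \<open>Extrapolation for one weight\<close>

context dyadic_family
begin

text \<open>With \<open>u\<close> an \<open>A_1\<close> majorant of \<open>f\<close>, put \<open>W = w u^(p-p0)\<close> and \<open>I = \<integral> u^p w\<close>. Then \<open>f \<le> u\<close> and \<open>p < p0\<close> give
\<open>\<integral> f^p0 W \<le> I\<close>, and \<open>g^p w = (g^p0 W)^\<theta> (u^p w)^(1-\<theta>)\<close> with \<open>\<theta> = p / p0\<close>. Hoelder and the hypothesis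
for \<open>W\<close> give \<open>\<integral> g^p w \<le> (K^p0 I)^\<theta> I^(1-\<theta>) = K^p I\<close>.\<close>

lemma extrapolate_down:
  fixes w :: "'a \<Rightarrow> real" and f g :: "'a \<Rightarrow> ennreal"
  assumes p: "1 < p" "p < p0" and [measurable]: "w \<in> borel_measurable M"
    and w_nonneg: "\<And>x. x \<in> space M \<Longrightarrow> 0 \<le> w x" and w_pos: "AE x in M. 0 < w x"
    and A: "Ap_const M \<D> p w = ennreal A" "0 \<le> A"
    and B: "maximal_norm M \<D> p w = ennreal B" "0 < B"
    and hyp: "\<And>W. W \<in> borel_measurable M \<Longrightarrow> (\<And>x. x \<in> space M \<Longrightarrow> 0 \<le> W x) \<Longrightarrow> (AE x in M. 0 < W x) \<Longrightarrow>
        Ap_const M \<D> p0 W \<le> ennreal (A * (2 * B) powr (p0 - p)) \<Longrightarrow>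
        (\<integral>\<^sup>+x. ennpowr (g x) p0 * ennreal (W x) \<partial>M)
            \<le> ennreal (K powr p0) * (\<integral>\<^sup>+x. ennpowr (f x) p0 * ennreal (W x) \<partial>M)"
    and [measurable]: "f \<in> borel_measurable M" "g \<in> borel_measurable M"
    and J: "(\<integral>\<^sup>+x. ennpowr (f x) p * ennreal (w x) \<partial>M) \<noteq> 0" "(\<integral>\<^sup>+x. ennpowr (f x) p * ennreal (w x) \<partial>M) \<noteq> top"
    and K: "0 \<le> K"
  shows "(\<integral>\<^sup>+x. ennpowr (g x) p * ennreal (w x) \<partial>M)
      \<le> ennreal (K powr p * (2 * 2 powr p)) * (\<integral>\<^sup>+x. ennpowr (f x) p * ennreal (w x) \<partial>M)"
proof -
  let ?J = "\<integral>\<^sup>+x. ennpowr (f x) p * ennreal (w x) \<partial>M"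
  obtain u :: "'a \<Rightarrow> real" where [measurable]: "u \<in> borel_measurable M" and u: "\<And>x. 0 < u x"
      and fu: "AE x in M. f x \<le> ennreal (u x)"
    and A1: "\<And>Q. Q \<in> cubes \<D> \<Longrightarrow> \<exists>U>0. (\<integral>\<^sup>+x\<in>Q. ennreal (u x) \<partial>M) / emeasure M Q = ennreal U
        \<and> (AE x in M. x \<in> Q \<longrightarrow> U \<le> 2 * B * u x)"
    and u_int: "(\<integral>\<^sup>+x. ennpowr (ennreal (u x)) p * ennreal (w x) \<partial>M) \<le> ennreal (2 * 2 powr p) * ?J"
    by (rule A1_majorant[OF p(1) B(2) _ w_pos _ _ J]) (use maximal_norm_bound[OF p(1) _ w_pos B] in auto)
  define \<theta> where "\<theta> = p / p0"
  have \<theta>: "0 < \<theta>" "\<theta> < 1" using p by (auto simp: \<theta>_def)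
  define W where "W x = w x * u x powr (p - p0)" for x
  have [measurable]: "W \<in> borel_measurable M" unfolding W_def by measurable
  have W_pos: "AE x in M. 0 < W x" using w_pos
      by eventually_elim (use u in \<open>simp add: W_def less_imp_neq[symmetric]\<close>)
  define I where "I = (\<integral>\<^sup>+x. ennpowr (ennreal (u x)) p * ennreal (w x) \<partial>M)"
  have "Ap_const M \<D> p0 W \<le> ennreal ((2 * B) powr (p0 - p)) * Ap_const M \<D> p w"
    unfolding W_def using A1 B w_pos u by (intro Ap_const_times_A1_power p) (auto simp: avg_def)
  also have "\<dots> = ennreal (A * (2 * B) powr (p0 - p))" using A by (simp add: ennreal_mult' mult.commute)
  finally have W_Ap: "Ap_const M \<D> p0 W \<le> ennreal (A * (2 * B) powr (p0 - p))" .
  have W_nonneg: "0 \<le> W x" if "x \<in> space M" for x using w_nonneg[OF that] by (simp add: W_def)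
  have "(\<integral>\<^sup>+x. ennpowr (g x) p0 * ennreal (W x) \<partial>M)
      \<le> ennreal (K powr p0) * (\<integral>\<^sup>+x. ennpowr (f x) p0 * ennreal (W x) \<partial>M)"
    by (rule hyp[OF _ W_nonneg W_pos W_Ap]) measurable
  also have "(\<integral>\<^sup>+x. ennpowr (f x) p0 * ennreal (W x) \<partial>M) \<le> I"
    unfolding I_def
  proof (intro nn_integral_mono_AE, use fu w_pos in eventually_elim)
    fix x assume f: "f x \<le> ennreal (u x)" and w: "0 < w x"
    have "ennpowr (f x) p0 * ennreal (W x) \<le> ennpowr (ennreal (u x)) p0 * ennreal (W x)"
      using f p by (intro mult_right_mono ennpowr_mono) auto
    also have "\<dots> = ennreal (u x powr p0 * u x powr (p - p0) * w x)"
      using u[of x] w by (simp add: W_def ennreal_mult'[symmetric] ac_simps)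
    also have "u x powr p0 * u x powr (p - p0) = u x powr p"
      by (simp add: powr_add[symmetric])
    finally show "ennpowr (f x) p0 * ennreal (W x) \<le> ennpowr (ennreal (u x)) p * ennreal (w x)"
      using u[of x] by (simp add: ennreal_mult')
  qed
  finally have G: "(\<integral>\<^sup>+x. ennpowr (g x) p0 * ennreal (W x) \<partial>M) \<le> ennreal (K powr p0) * I"
      by (simp add: mult_left_mono)
  have "(\<integral>\<^sup>+x. ennpowr (g x) p * ennreal (w x) \<partial>M)
     = (\<integral>\<^sup>+x. ennpowr (ennpowr (g x) p0 * ennreal (W x)) \<theta> * ennpowr (ennpowr (ennreal (u x)) p * ennreal (w x)) (1 - \<theta>) \<partial>M)"
  proof (intro nn_integral_cong_AE, use w_pos in eventually_elim)
    fix x assume w: "0 < w x"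
    have "W x powr \<theta> * (u x powr p * w x) powr (1 - \<theta>)
      = (w x powr \<theta> * w x powr (1 - \<theta>)) * (u x powr ((p - p0) * \<theta>) * u x powr (p * (1 - \<theta>)))"
      using w u[of x] by (simp add: W_def powr_mult powr_powr)
    also have "\<dots> = w x powr 1 * u x powr ((p - p0) * \<theta> + p * (1 - \<theta>))"
      by (simp only: powr_add[symmetric]) simp
    also have "(p - p0) * \<theta> + p * (1 - \<theta>) = 0" using p by (simp add: \<theta>_def field_simps)
    finally have e: "W x powr \<theta> * (u x powr p * w x) powr (1 - \<theta>) = w x" using w u[of x] by simp
    have "ennpowr (ennpowr (g x) p0 * ennreal (W x)) \<theta> * ennpowr (ennpowr (ennreal (u x)) p * ennreal (w x)) (1 - \<theta>)
      = ennpowr (g x) p * ennreal (W x powr \<theta> * (u x powr p * w x) powr (1 - \<theta>))"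
      using p w u[of x] by (simp add: W_def ennpowr_mult \<theta>_def mult.assoc) (simp add: ennreal_mult' powr_mult)
    then show "ennpowr (g x) p * ennreal (w x)
      = ennpowr (ennpowr (g x) p0 * ennreal (W x)) \<theta> * ennpowr (ennpowr (ennreal (u x)) p * ennreal (w x)) (1 - \<theta>)"
      by (simp only: e)
  qed
  also have "\<dots> \<le> ennpowr (\<integral>\<^sup>+x. ennpowr (g x) p0 * ennreal (W x) \<partial>M) \<theta> * ennpowr I (1 - \<theta>)"
    unfolding I_def by (rule nn_integral_Holder[OF \<theta>]) measurable
  also have "\<dots> \<le> ennpowr (ennreal (K powr p0) * I) \<theta> * ennpowr I (1 - \<theta>)"
    by (intro mult_right_mono ennpowr_mono \<theta> G) simp
  also have "\<dots> = ennreal (K powr p) * (ennpowr I \<theta> * ennpowr I (1 - \<theta>))"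
    using p by (simp add: ennpowr_mult powr_powr \<theta>_def mult.assoc)
  also have "\<dots> = ennreal (K powr p) * I" by (simp add: ennpowr_add)
  also have "\<dots> \<le> ennreal (K powr p) * (ennreal (2 * 2 powr p) * ?J)"
    unfolding I_def by (intro mult_left_mono u_int) simp
  finally show ?thesis by (simp add: mult.assoc[symmetric] ennreal_mult'[symmetric])
qed

text \<open>With \<open>u\<close> an \<open>A_1\<close> majorant of \<open>G^(p-1) w\<close> in \<open>L^q(\<sigma>)\<close>, where that function has the norm of \<open>G\<close> in \<open>L^p(w)\<close> to the power \<open>p - 1\<close>, put
\<open>W = w^\<theta> u^(1-\<theta>)\<close>. Inserting \<open>G^(p-1) w \<le> u\<close> gives \<open>G^p w \<le> G^p0 W\<close>. Let \<open>I = \<integral> G^p w\<close> and \<open>t = p0 / p\<close>. Since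
\<open>f^p0 W = (f^p w)^t (u^q \<sigma>)^(1-t)\<close>, the hypothesis for \<open>W\<close> and Hoelder bound \<open>I\<close> by \<open>K^p0 (\<integral> f^p w)^t\<close> times a constant times \<open>I^(1-t)\<close>. The last factor
cancels because \<open>I\<close> is finite.\<close>

lemma extrapolate_up_finite:
  fixes w :: "'a \<Rightarrow> real" and f g :: "'a \<Rightarrow> ennreal"
  assumes p: "1 \<le> p0" "p0 < p" and [measurable]: "w \<in> borel_measurable M"
    and w_pos: "AE x in M. 0 < w x"
    and A: "Ap_const M \<D> p w = ennreal A" "0 \<le> A"
    and B: "maximal_norm M \<D> (conj_exp p) (\<lambda>x. w x powr (1 - conj_exp p)) = ennreal B" "0 < B"
    and hyp: "\<And>W. W \<in> borel_measurable M \<Longrightarrow> (\<And>x. x \<in> space M \<Longrightarrow> 0 \<le> W x) \<Longrightarrow> (AE x in M. 0 < W x) \<Longrightarrow>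
        Ap_const M \<D> p0 W \<le> ennreal (A powr ((p0 - 1) / (p - 1)) * (2 * B) powr ((p - p0) / (p - 1))) \<Longrightarrow>
        (\<integral>\<^sup>+x. ennpowr (g x) p0 * ennreal (W x) \<partial>M)
            \<le> ennreal (K powr p0) * (\<integral>\<^sup>+x. ennpowr (f x) p0 * ennreal (W x) \<partial>M)"
    and [measurable]: "f \<in> borel_measurable M" "g \<in> borel_measurable M" "G \<in> borel_measurable M"
    and Gg: "\<And>x. G x \<le> g x"
    and I: "(\<integral>\<^sup>+x. ennpowr (G x) p * ennreal (w x) \<partial>M) \<noteq> top"
    and K: "0 \<le> K"
  shows "(\<integral>\<^sup>+x. ennpowr (G x) p * ennreal (w x) \<partial>M)
     \<le> ennreal (K powr p * (2 * 2 powr conj_exp p) powr ((p - p0) / p0)) * (\<integral>\<^sup>+x. ennpowr (f x) p * ennreal (w x) \<partial>M)"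
proof (cases "(\<integral>\<^sup>+x. ennpowr (G x) p * ennreal (w x) \<partial>M) = 0")
  case I0: False
  let ?I = "\<integral>\<^sup>+x. ennpowr (G x) p * ennreal (w x) \<partial>M"
  let ?J = "\<integral>\<^sup>+x. ennpowr (f x) p * ennreal (w x) \<partial>M"
  define q where "q = conj_exp p"
  define s where "s x = w x powr (1 - q)" for x
  define \<theta> where "\<theta> = (p0 - 1) / (p - 1)"
  define F where "F x = ennpowr (G x) (p - 1) * ennreal (w x)" for x
  have p1: "1 < p" using p by simp
  have q: "1 < q" unfolding q_def by (rule conj_exp_gt_1[OF p1])
  have pq: "(p - 1) * q = p" using p by (simp add: q_def conj_exp_def)
  have [measurable]: "s \<in> borel_measurable M" "F \<in> borel_measurable M" unfolding s_def F_def
      by measurable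
  have s_pos: "AE x in M. 0 < s x" using w_pos by eventually_elim (simp add: s_def)
  have F_int: "(\<integral>\<^sup>+x. ennpowr (F x) q * ennreal (s x) \<partial>M) = ?I"
  proof (intro nn_integral_cong_AE, use w_pos in eventually_elim)
    fix x assume w: "0 < w x"
    have "w x powr q * s x = w x" using w powr_add[of "w x" q "1 - q"] by (simp add: s_def)
    then show "ennpowr (F x) q * ennreal (s x) = ennpowr (G x) p * ennreal (w x)"
      using w by (simp add: F_def ennpowr_mult pq mult.assoc ennreal_mult'[symmetric])
  qed
  obtain u :: "'a \<Rightarrow> real" where [measurable]: "u \<in> borel_measurable M" and u: "\<And>x. 0 < u x"
      and Fu: "AE x in M. F x \<le> ennreal (u x)"
    and A1: "\<And>Q. Q \<in> cubes \<D> \<Longrightarrow> \<exists>U>0. (\<integral>\<^sup>+x\<in>Q. ennreal (u x) \<partial>M) / emeasure M Q = ennreal U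
        \<and> (AE x in M. x \<in> Q \<longrightarrow> U \<le> 2 * B * u x)"
    and u_int: "(\<integral>\<^sup>+x. ennpowr (ennreal (u x)) q * ennreal (s x) \<partial>M)
        \<le> ennreal (2 * 2 powr q) * (\<integral>\<^sup>+x. ennpowr (F x) q * ennreal (s x) \<partial>M)"
  proof (rule A1_majorant[OF q B(2) _ s_pos])
    show "\<And>F. F \<in> borel_measurable M \<Longrightarrow> (\<integral>\<^sup>+x. ennpowr (maxf F x) q * ennreal (s x) \<partial>M)
        \<le> ennreal (B powr q) * (\<integral>\<^sup>+x. ennpowr (F x) q * ennreal (s x) \<partial>M)"
      using B s_pos by (intro maximal_norm_bound q) (auto simp: s_def[abs_def] q_def)
    show "(\<integral>\<^sup>+x. ennpowr (F x) q * ennreal (s x) \<partial>M) \<noteq> 0" "(\<integral>\<^sup>+x. ennpowr (F x) q * ennreal (s x) \<partial>M) \<noteq> top"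
      unfolding F_int by (fact I0 I)+
  qed (auto intro: that)
  define W where "W x = w x powr \<theta> * u x powr (1 - \<theta>)" for x
  have [measurable]: "W \<in> borel_measurable M" unfolding W_def by measurable
  have W_pos: "AE x in M. 0 < W x" using w_pos
      by eventually_elim (use u in \<open>simp add: W_def less_imp_neq[symmetric]\<close>)
  have \<theta>: "1 - \<theta> = (p - p0) / (p - 1)" "0 < 1 - \<theta>" using p by (simp_all add: \<theta>_def field_simps)
  have lower: "?I \<le> (\<integral>\<^sup>+x. ennpowr (g x) p0 * ennreal (W x) \<partial>M)"
  proof (intro nn_integral_mono_AE, use Fu w_pos in eventually_elim)
    fix x assume F: "F x \<le> ennreal (u x)" and w: "0 < w x"
    have e: "p = p0 + (p - 1) * (1 - \<theta>)" using p by (simp add: \<theta>(1))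
    have "ennpowr (G x) p * ennreal (w x)
        = ennpowr (G x) p0 * ennreal (w x powr \<theta>) * ennpowr (F x) (1 - \<theta>)"
    proof -
      have "w x = w x powr \<theta> * w x powr (1 - \<theta>)" using w by (simp add: powr_add[symmetric])
      then have "ennreal (w x) = ennreal (w x powr \<theta>) * ennreal (w x powr (1 - \<theta>))"
        by (metis ennreal_mult' powr_ge_zero)
      moreover have "ennpowr (G x) p = ennpowr (G x) p0 * ennpowr (G x) ((p - 1) * (1 - \<theta>))"
        by (subst e) (simp add: ennpowr_add)
      moreover have "ennpowr (F x) (1 - \<theta>)
          = ennpowr (G x) ((p - 1) * (1 - \<theta>)) * ennreal (w x powr (1 - \<theta>))"
        using w by (simp add: F_def ennpowr_mult)
      ultimately show ?thesis by (simp only: ac_simps)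
    qed
    also have "\<dots> \<le> ennpowr (g x) p0 * ennreal (w x powr \<theta>) * ennpowr (ennreal (u x)) (1 - \<theta>)"
      using p \<theta> F Gg by (intro mult_mono ennpowr_mono) auto
    also have "\<dots> = ennpowr (g x) p0 * ennreal (W x)"
      using u[of x] by (simp add: W_def ennreal_mult' mult.assoc)
    finally show "ennpowr (G x) p * ennreal (w x) \<le> ennpowr (g x) p0 * ennreal (W x)" .
  qed
  have "Ap_const M \<D> p0 W \<le> ennreal ((2 * B) powr (1 - \<theta>)) * ennpowr (Ap_const M \<D> p w) \<theta>"
    unfolding W_def \<theta>_def using A1 B A w_pos u by (intro Ap_const_interpolate_A1 p) (auto simp: avg_def)
  also have "\<dots> = ennreal (A powr ((p0 - 1) / (p - 1)) * (2 * B) powr ((p - p0) / (p - 1)))"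
    using A \<theta>(1) by (simp add: ennreal_mult' mult.commute \<theta>_def)
  finally have W_Ap: "Ap_const M \<D> p0 W
      \<le> ennreal (A powr ((p0 - 1) / (p - 1)) * (2 * B) powr ((p - p0) / (p - 1)))" .
  have W_nonneg: "0 \<le> W x" for x by (simp add: W_def)
  have "(\<integral>\<^sup>+x. ennpowr (g x) p0 * ennreal (W x) \<partial>M)
      \<le> ennreal (K powr p0) * (\<integral>\<^sup>+x. ennpowr (f x) p0 * ennreal (W x) \<partial>M)"
    by (rule hyp[OF _ W_nonneg W_pos W_Ap]) measurable
  with lower have I_le: "?I \<le> ennreal (K powr p0) * (\<integral>\<^sup>+x. ennpowr (f x) p0 * ennreal (W x) \<partial>M)"
      by (rule order_trans)
  define t where "t = p0 / p"
  have t: "0 < t" "t < 1" "1 - t = (p - p0) / p" using p by (auto simp: t_def field_simps)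
  have "(\<integral>\<^sup>+x. ennpowr (f x) p0 * ennreal (W x) \<partial>M)
     = (\<integral>\<^sup>+x. ennpowr (ennpowr (f x) p * ennreal (w x)) t * ennpowr (ennpowr (ennreal (u x)) q * ennreal (s x)) (1 - t) \<partial>M)"
  proof (intro nn_integral_cong_AE, use w_pos in eventually_elim)
    fix x assume w: "0 < w x"
    have "w x powr t * (u x powr q * s x) powr (1 - t)
        = (w x powr t * w x powr ((1 - q) * (1 - t))) * u x powr (q * (1 - t))"
      using w u[of x] by (simp add: s_def powr_mult powr_powr)
    also have "\<dots> = w x powr (t + (1 - q) * (1 - t)) * u x powr (q * (1 - t))"
      by (simp only: powr_add)
    also have "t + (1 - q) * (1 - t) = \<theta>"
      using p unfolding q_def one_minus_conj_exp[OF p1] t(3)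
          by (simp add: t_def \<theta>_def divide_simps) (simp add: algebra_simps)
    also have "q * (1 - t) = 1 - \<theta>"
      using p unfolding q_def t(3) \<theta>(1) by (simp add: conj_exp_def)
    finally have e: "w x powr t * (u x powr q * s x) powr (1 - t) = W x" by (simp add: W_def)
    have "ennpowr (ennpowr (f x) p * ennreal (w x)) t * ennpowr (ennpowr (ennreal (u x)) q * ennreal (s x)) (1 - t)
       = ennpowr (f x) p0 * ennreal (w x powr t * (u x powr q * s x) powr (1 - t))"
      using p w u[of x] by (simp add: s_def ennpowr_mult t_def mult.assoc) (simp add: ennreal_mult' powr_mult)
    then show "ennpowr (f x) p0 * ennreal (W x)
      = ennpowr (ennpowr (f x) p * ennreal (w x)) t * ennpowr (ennpowr (ennreal (u x)) q * ennreal (s x)) (1 - t)"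
      by (simp only: e)
  qed
  also have "\<dots> \<le> ennpowr ?J t * ennpowr (\<integral>\<^sup>+x. ennpowr (ennreal (u x)) q * ennreal (s x) \<partial>M) (1 - t)"
    by (rule nn_integral_Holder[OF t(1,2)]) measurable
  also have "\<dots> \<le> ennpowr ?J t * ennpowr (ennreal (2 * 2 powr q) * ?I) (1 - t)"
    using u_int t unfolding F_int by (intro mult_left_mono ennpowr_mono) auto
  finally have "ennreal (K powr p0) * (\<integral>\<^sup>+x. ennpowr (f x) p0 * ennreal (W x) \<partial>M)
      \<le> ennreal (K powr p0) * (ennpowr ?J t * ennpowr (ennreal (2 * 2 powr q) * ?I) (1 - t))"
    by (rule mult_left_mono) simp
  with I_le have "?I \<le> ennreal (K powr p0) * (ennpowr ?J t * ennpowr (ennreal (2 * 2 powr q) * ?I) (1 - t))"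
    by (rule order_trans)
  also have "\<dots> = (ennreal (K powr p0) * ennreal ((2 * 2 powr q) powr (1 - t)) * ennpowr ?J t) * ennpowr ?I (1 - t)"
    by (simp add: ennpowr_mult[of "ennreal _"] ac_simps)
  also have "?I = ennpowr ?I t * ennpowr ?I (1 - t)" by (simp add: ennpowr_add)
  finally have "ennpowr ?I t * ennpowr ?I (1 - t)
      \<le> (ennreal (K powr p0) * ennreal ((2 * 2 powr q) powr (1 - t)) * ennpowr ?J t) * ennpowr ?I (1 - t)"
    by (simp add: ennpowr_add)
  then have "ennpowr ?I t * ennpowr ?I (1 - t) / ennpowr ?I (1 - t)
      \<le> (ennreal (K powr p0) * ennreal ((2 * 2 powr q) powr (1 - t)) * ennpowr ?J t) * ennpowr ?I (1 - t) / ennpowr ?I (1 - t)"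
    by (rule divide_right_mono_ennreal)
  then have "ennpowr ?I t \<le> ennreal (K powr p0) * ennreal ((2 * 2 powr q) powr (1 - t)) * ennpowr ?J t"
    using I0 I by (simp add: mult_divide_eq_ennreal)
  then have "?I \<le> ennpowr (ennreal (K powr p0) * ennreal ((2 * 2 powr q) powr (1 - t)) * ennpowr ?J t) (1 / t)"
    using t by (simp add: ennpowr_le_iff)
  also have "\<dots> = ennreal (K powr p) * ennreal ((2 * 2 powr q) powr ((p - p0) / p0)) * ?J"
  proof -
    have "p0 * (1 / t) = p" "(1 - t) * (1 / t) = (p - p0) / p0" "t * (1 / t) = 1"
      unfolding t(3) using p by (simp_all add: t_def)
    then show ?thesis by (simp only: ennpowr_mult ennpowr_ennpowr ennpowr_ennreal powr_ge_zero powr_powr ennpowr_1)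
  qed
  finally show ?thesis by (simp add: q_def ennreal_mult')
qed simp

text \<open>The finiteness of \<open>\<integral> G^p w\<close> is removed by exhausting \<open>g\<close> with the truncations \<open>min g (n h)\<close>, where \<open>h > 0\<close> has finite norm.\<close>

lemma extrapolate_up:
  fixes w :: "'a \<Rightarrow> real" and f g :: "'a \<Rightarrow> ennreal"
  assumes p: "1 \<le> p0" "p0 < p" and [measurable]: "w \<in> borel_measurable M"
    and w_pos: "AE x in M. 0 < w x"
    and A: "Ap_const M \<D> p w = ennreal A" "0 \<le> A"
    and B: "maximal_norm M \<D> (conj_exp p) (\<lambda>x. w x powr (1 - conj_exp p)) = ennreal B" "0 < B"
    and hyp: "\<And>W. W \<in> borel_measurable M \<Longrightarrow> (\<And>x. x \<in> space M \<Longrightarrow> 0 \<le> W x) \<Longrightarrow> (AE x in M. 0 < W x) \<Longrightarrow>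
        Ap_const M \<D> p0 W \<le> ennreal (A powr ((p0 - 1) / (p - 1)) * (2 * B) powr ((p - p0) / (p - 1))) \<Longrightarrow>
        (\<integral>\<^sup>+x. ennpowr (g x) p0 * ennreal (W x) \<partial>M)
            \<le> ennreal (K powr p0) * (\<integral>\<^sup>+x. ennpowr (f x) p0 * ennreal (W x) \<partial>M)"
    and [measurable]: "f \<in> borel_measurable M" "g \<in> borel_measurable M"
    and K: "0 \<le> K"
  shows "(\<integral>\<^sup>+x. ennpowr (g x) p * ennreal (w x) \<partial>M)
     \<le> ennreal (K powr p * (2 * 2 powr conj_exp p) powr ((p - p0) / p0)) * (\<integral>\<^sup>+x. ennpowr (f x) p * ennreal (w x) \<partial>M)"
proof -
  have p1: "1 < p" using p by simp
  obtain h0 :: "'a \<Rightarrow> real" where h0[measurable]: "h0 \<in> borel_measurable M"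
      and h0_pos: "\<And>x. 0 < h0 x" and h0_int: "integrable M h0"
    by (rule obtain_positive_integrable_function) (rule that)
  have h0_fin: "(\<integral>\<^sup>+x. ennreal (h0 x) \<partial>M) < top"
    using h0_int order_less_imp_le[OF h0_pos] by (subst nn_integral_eq_integral) auto
  define h where "h x = ennpowr (ennreal (h0 x / w x)) (1 / p)" for x
  have [measurable]: "h \<in> borel_measurable M" unfolding h_def by measurable
  define G where "G n x = min (g x) (of_nat n * h x)" for n :: nat and x
  have [measurable]: "G n \<in> borel_measurable M" for n unfolding G_def by measurable
  have G_fin: "(\<integral>\<^sup>+x. ennpowr (G n x) p * ennreal (w x) \<partial>M) \<noteq> top" for n
  proof -
    have "(\<integral>\<^sup>+x. ennpowr (G n x) p * ennreal (w x) \<partial>M)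
        \<le> (\<integral>\<^sup>+x. ennpowr (of_nat n) p * ennreal (h0 x) \<partial>M)"
    proof (intro nn_integral_mono_AE, use w_pos in eventually_elim)
      fix x assume w: "0 < w x"
      have "ennpowr (G n x) p * ennreal (w x) \<le> ennpowr (of_nat n * h x) p * ennreal (w x)"
        using p by (intro mult_right_mono ennpowr_mono) (auto simp: G_def)
      also have "\<dots> = ennpowr (of_nat n) p * ennreal (h0 x)"
        using w p h0_pos[of x] by (simp add: h_def ennpowr_mult mult.assoc ennreal_mult'[symmetric] del: ennpowr_ennreal)
      finally show "ennpowr (G n x) p * ennreal (w x) \<le> ennpowr (of_nat n) p * ennreal (h0 x)" .
    qed
    also have "\<dots> < top"
      using h0_fin by (simp add: nn_integral_cmult ennreal_mult_less_top of_nat_less_top)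
    finally show ?thesis by simp
  qed
  have mono_G: "incseq (\<lambda>n x. ennpowr (G n x) p * ennreal (w x))"
  proof (intro incseq_SucI le_funI mult_right_mono ennpowr_mono)
    show "G n x \<le> G (Suc n) x" for n x
      unfolding G_def by (intro min.mono mult_right_mono of_nat_mono) auto
  qed (use p in auto)
  have SUP_G: "AE x in M. ennpowr (g x) p * ennreal (w x) = (SUP n. ennpowr (G n x) p * ennreal (w x))"
    using w_pos
  proof eventually_elim
    fix x assume w: "0 < w x"
    have h: "h x \<noteq> 0" using w h0_pos[of x] by (simp add: h_def del: ennpowr_ennreal)
    have "(SUP n. G n x) = g x"
    proof -
      have top: "(SUP n::nat. of_nat n * h x) = top"
        using h by (simp add: SUP_mult_right_ennreal[symmetric] ennreal_SUP_of_nat_eq_top ennreal_top_mult)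
      have "(SUP n. G n x) = inf (g x) (SUP n::nat. of_nat n * h x)"
        unfolding G_def inf_SUP by (simp add: inf_min)
      then show ?thesis unfolding top by simp
    qed
    then show "ennpowr (g x) p * ennreal (w x) = (SUP n. ennpowr (G n x) p * ennreal (w x))"
      using p by (simp add: SUP_mult_right_ennreal[symmetric] ennpowr_SUP[symmetric])
  qed
  have "(\<integral>\<^sup>+x. ennpowr (g x) p * ennreal (w x) \<partial>M)
      = (\<integral>\<^sup>+x. (SUP n. ennpowr (G n x) p * ennreal (w x)) \<partial>M)"
    by (rule nn_integral_cong_AE[OF SUP_G])
  also have "\<dots> = (SUP n. \<integral>\<^sup>+x. ennpowr (G n x) p * ennreal (w x) \<partial>M)"
    by (rule nn_integral_monotone_convergence_SUP[OF mono_G]) measurable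
  also have "\<dots> \<le> ennreal (K powr p * (2 * 2 powr conj_exp p) powr ((p - p0) / p0)) * (\<integral>\<^sup>+x. ennpowr (f x) p * ennreal (w x) \<partial>M)"
  proof (rule SUP_least)
    fix n
    show "(\<integral>\<^sup>+x. ennpowr (G n x) p * ennreal (w x) \<partial>M)
        \<le> ennreal (K powr p * (2 * 2 powr conj_exp p) powr ((p - p0) / p0)) * (\<integral>\<^sup>+x. ennpowr (f x) p * ennreal (w x) \<partial>M)"
      by (rule extrapolate_up_finite[where g
          = g, OF p _ w_pos A B hyp _ _ _ _ G_fin K]) (auto simp: G_def)
  qed
  finally show ?thesis .
qed

text \<open>The cases in which the main estimate says nothing. If \<open>\<parallel>f\<parallel>\<close> is zero, or if \<open>K = 0\<close> (where \<open>\<parallel>f\<parallel> = \<infinity>\<close> would leave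
\<open>0 \<cdot> \<infinity> = 0\<close> on the right), then \<open>g = 0\<close> almost everywhere by the unweighted estimate, which is the one for the weight \<open>1\<close>.\<close>

lemma extrapolation_closing:
  fixes w :: "'a \<Rightarrow> real" and f g :: "'a \<Rightarrow> ennreal"
  assumes p: "0 < p" "0 < p0" and [measurable]: "w \<in> borel_measurable M" and w_pos: "AE x in M. 0 < w x"
    and [measurable]: "f \<in> borel_measurable M" "g \<in> borel_measurable M"
    and unweighted: "(\<integral>\<^sup>+x. ennpowr (g x) p0 \<partial>M) \<le> ennreal (K powr p0) * (\<integral>\<^sup>+x. ennpowr (f x) p0 \<partial>M)"
    and main: "(\<integral>\<^sup>+x. ennpowr (f x) p * ennreal (w x) \<partial>M) \<noteq> 0
        \<Longrightarrow> (\<integral>\<^sup>+x. ennpowr (f x) p * ennreal (w x) \<partial>M) \<noteq> top \<Longrightarrow>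
      (\<integral>\<^sup>+x. ennpowr (g x) p * ennreal (w x) \<partial>M)
          \<le> ennreal (K powr p * D) * (\<integral>\<^sup>+x. ennpowr (f x) p * ennreal (w x) \<partial>M)"
    and K: "0 \<le> K" and D: "0 < D"
  shows "Lp_norm M p w g \<le> ennreal (K * D powr (1 / p)) * Lp_norm M p w f"
proof -
  let ?J = "\<integral>\<^sup>+x. ennpowr (f x) p * ennreal (w x) \<partial>M"
  have zero: "Lp_norm M p w g = 0" if "(\<integral>\<^sup>+x. ennpowr (g x) p0 \<partial>M) = 0"
  proof -
    have "AE x in M. g x = 0" using that by (subst (asm) nn_integral_0_iff_AE) auto
    then have "AE x in M. ennpowr (g x) p * ennreal (w x) = 0" by eventually_elim simp
    then have "(\<integral>\<^sup>+x. ennpowr (g x) p * ennreal (w x) \<partial>M) = 0" by (subst nn_integral_0_iff_AE) auto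
    then show ?thesis by (simp add: Lp_norm_def)
  qed
  consider "?J = 0" | "K = 0" | "?J = top" "K > 0" | "?J \<noteq> 0" "?J \<noteq> top" using K by fastforce
  then show ?thesis
  proof cases
    case 1
    then have "AE x in M. ennpowr (f x) p * ennreal (w x) = 0" by (subst (asm) nn_integral_0_iff_AE) auto
    with w_pos have "AE x in M. ennpowr (f x) p0 = 0" by eventually_elim auto
    then have "(\<integral>\<^sup>+x. ennpowr (f x) p0 \<partial>M) = 0" by (subst nn_integral_0_iff_AE) auto
    then show ?thesis using unweighted zero by simp
  next
    case 2
    then show ?thesis using unweighted zero p by simp
  next
    case 3
    then show ?thesis using D by (simp add: Lp_norm_def ennreal_mult_top)
  next
    case 4
    then have "Lp_norm M p w g \<le> ennpowr (ennreal (K powr p * D) * ?J) (1 / p)"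
      unfolding Lp_norm_def using p main by (intro ennpowr_mono) auto
    then show ?thesis using K D p by (simp add: Lp_norm_def ennpowr_mult powr_mult powr_powr)
  qed
qed

end

section \<open>Balls and cubes in a space of homogeneous type\<close>

lemma doubling_iterated:
  assumes "\<And>r. 0 < r \<Longrightarrow> emeasure M (qball M \<rho> x (2 * r)) \<le> D * emeasure M (qball M \<rho> x r)" "0 < r"
  shows "emeasure M (qball M \<rho> x (2 ^ m * r)) \<le> D ^ m * emeasure M (qball M \<rho> x r)"
proof (induction m)
  case (Suc m)
  have "emeasure M (qball M \<rho> x (2 ^ Suc m * r)) \<le> D * emeasure M (qball M \<rho> x (2 ^ m * r))"
    using assms(1)[of "2 ^ m * r"] assms(2) by (simp add: mult.assoc)
  also have "\<dots> \<le> D * (D ^ m * emeasure M (qball M \<rho> x r))"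
    by (intro mult_left_mono Suc) simp
  finally show ?case by (simp add: mult.assoc)
qed simp

locale homogeneous_dyadic =
  fixes M :: "'a measure" and \<rho> :: "'a \<Rightarrow> 'a \<Rightarrow> real" and \<D> :: "int \<Rightarrow> 'a set set"
  assumes homogeneous: "space_of_homogeneous_type M \<rho>"
    and dyadic: "dyadic_decomposition M \<rho> \<D>"
begin

lemma qball_sets [measurable]: "x \<in> space M \<Longrightarrow> 0 < r \<Longrightarrow> qball M \<rho> x r \<in> sets M"
  using homogeneous unfolding space_of_homogeneous_type_def by blast

lemma doubling_const:
  obtains D :: ennreal where "D < top"
    "\<And>x r. x \<in> space M \<Longrightarrow> 0 < r \<Longrightarrow> emeasure M (qball M \<rho> x (2 * r)) \<le> D * emeasure M (qball M \<rho> x r)"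
proof -
  have "\<exists>D::real. \<forall>x\<in>space M. \<forall>r>0.
        0 < emeasure M (qball M \<rho> x (2 * r)) \<and>
        emeasure M (qball M \<rho> x (2 * r)) \<le> ennreal D * emeasure M (qball M \<rho> x r) \<and>
        ennreal D * emeasure M (qball M \<rho> x r) < \<infinity>"
    using homogeneous unfolding space_of_homogeneous_type_def by (elim conjE)
  then obtain D :: real where "\<forall>x\<in>space M. \<forall>r>0.
        0 < emeasure M (qball M \<rho> x (2 * r)) \<and>
        emeasure M (qball M \<rho> x (2 * r)) \<le> ennreal D * emeasure M (qball M \<rho> x r) \<and>
        ennreal D * emeasure M (qball M \<rho> x r) < \<infinity>"
    by (elim exE)
  then show ?thesis by (intro that[of "ennreal D"]) auto
qed

lemma ball_measure:
  assumes x: "x \<in> space M" and r: "0 < r"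
  shows "emeasure M (qball M \<rho> x r) \<noteq> 0" "emeasure M (qball M \<rho> x r) \<noteq> top"
proof -
  obtain D :: real where D: "\<And>r. 0 < r \<Longrightarrow>
      0 < emeasure M (qball M \<rho> x (2 * r)) \<and>
      emeasure M (qball M \<rho> x (2 * r)) \<le> ennreal D * emeasure M (qball M \<rho> x r) \<and>
      ennreal D * emeasure M (qball M \<rho> x r) < \<infinity>"
    using homogeneous x unfolding space_of_homogeneous_type_def by blast
  show "emeasure M (qball M \<rho> x r) \<noteq> 0" using D[of "r / 2"] r by auto
  have "ennreal D \<noteq> 0" using D[OF r] by auto
  then show "emeasure M (qball M \<rho> x r) \<noteq> top" using D[OF r] by (auto simp: ennreal_mult_top)
qed

lemma quasi_triangle:
  obtains \<kappa> where "0 < \<kappa>" "\<And>x y z. x \<in> space M \<Longrightarrow> y \<in> space M \<Longrightarrow> z \<in> space M \<Longrightarrow> \<rho> x z \<le> \<kappa> * (\<rho> x y + \<rho> y z)"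
proof -
  have "\<exists>\<kappa>>0. \<forall>x\<in>space M. \<forall>y\<in>space M. \<forall>z\<in>space M. \<rho> x z \<le> \<kappa> * (\<rho> x y + \<rho> y z)"
    using homogeneous unfolding space_of_homogeneous_type_def quasimetric_on_def by (elim conjE)
  then obtain \<kappa> where "\<kappa> > 0" "\<forall>x\<in>space M. \<forall>y\<in>space M. \<forall>z\<in>space M. \<rho> x z \<le> \<kappa> * (\<rho> x y + \<rho> y z)"
    by (elim exE conjE)
  then show ?thesis by (intro that) auto
qed

lemma quasi_metric_axioms:
  "\<forall>x\<in>space M. \<forall>y\<in>space M. 0 \<le> \<rho> x y \<and> (\<rho> x y = 0 \<longleftrightarrow> x = y) \<and> \<rho> x y = \<rho> y x"
  using homogeneous unfolding space_of_homogeneous_type_def quasimetric_on_def by (elim conjE)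

lemma quasi_sym: "x \<in> space M \<Longrightarrow> y \<in> space M \<Longrightarrow> \<rho> x y = \<rho> y x"
  and quasi_refl: "x \<in> space M \<Longrightarrow> \<rho> x x = 0"
  using quasi_metric_axioms by blast+

lemma cube_centres:
  obtains \<delta> C0 :: real and xc where "1 < \<delta>" "0 < C0" "\<And>k Q. Q \<in> \<D> k \<Longrightarrow> xc Q \<in> space M"
    "\<And>k Q. Q \<in> \<D> k \<Longrightarrow> qball M \<rho> (xc Q) (\<delta> powi k) \<subseteq> Q"
    "\<And>k Q. Q \<in> \<D> k \<Longrightarrow> Q \<subseteq> qball M \<rho> (xc Q) (C0 * \<delta> powi k)"
proof -
  have "\<exists>(xc :: 'a set \<Rightarrow> 'a) (\<delta>::real) (C0::real). \<delta> > 1 \<and> C0 > 0 \<and>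
        (\<forall>k. \<forall>Q\<in>\<D> k. xc Q \<in> space M \<and>
           qball M \<rho> (xc Q) (\<delta> powi k) \<subseteq> Q \<and> Q \<subseteq> qball M \<rho> (xc Q) (C0 * \<delta> powi k))"
    using dyadic unfolding dyadic_decomposition_def by (elim conjE)
  then obtain xc :: "'a set \<Rightarrow> 'a" and \<delta> C0 :: real where "1 < \<delta>" "0 < C0"
    and *: "\<forall>k. \<forall>Q\<in>\<D> k. xc Q \<in> space M \<and>
           qball M \<rho> (xc Q) (\<delta> powi k) \<subseteq> Q \<and> Q \<subseteq> qball M \<rho> (xc Q) (C0 * \<delta> powi k)"
    by (elim exE conjE)
  then show ?thesis by (intro that[of \<delta> C0 xc]) auto
qed

lemma cubes_measurable: "cubes \<D> \<subseteq> sets M"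
  and generation_covers: "space M = \<Union>(\<D> k)"
  and cubes_nested: "Q \<in> cubes \<D> \<Longrightarrow> R \<in> cubes \<D> \<Longrightarrow> Q \<inter> R \<noteq> {} \<Longrightarrow> Q \<subseteq> R \<or> R \<subseteq> Q"
  and child_exists: "Q \<in> \<D> k \<Longrightarrow> \<exists>R\<in>\<D> (k - 1). R \<subseteq> Q"
  and parent_unique: "R \<in> \<D> k \<Longrightarrow> \<exists>!P. P \<in> \<D> (k + 1) \<and> R \<subseteq> P"
  using dyadic unfolding dyadic_decomposition_def by (elim conjE; simp)+

text \<open>Two cubes of one generation that meet are nested, and then a child of the smaller one is contained in both; since its parent is
unique, they coincide.\<close>

lemma same_generation_disjoint:
  assumes QR: "Q \<in> \<D> k" "R \<in> \<D> k" "Q \<inter> R \<noteq> {}"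
  shows "Q = R"
proof -
  have *: "Q = R" if sub: "Q \<subseteq> R" and QR: "Q \<in> \<D> k" "R \<in> \<D> k" for Q R
  proof -
    obtain S where S: "S \<in> \<D> (k - 1)" "S \<subseteq> Q" using child_exists[OF QR(1)] by blast
    have "\<exists>!P. P \<in> \<D> k \<and> S \<subseteq> P" using parent_unique[OF S(1)] by simp
    moreover have "S \<subseteq> R" using S(2) sub by (rule subset_trans)
    ultimately show ?thesis using QR S(2) by (elim ex1E) metis
  qed
  have "Q \<in> cubes \<D>" "R \<in> cubes \<D>" using QR by (auto simp: cubes_def)
  then show ?thesis using cubes_nested[of Q R] *[of Q R] *[of R Q] QR by auto
qed

text \<open>The cubes of generation \<open>k\<close> that meet a ball contain disjoint balls of radius \<open>t = \<delta>^k\<close>, which all lie in one larger ball. By doubling the measure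
of the large ball is at most \<open>D^m\<close> times that of each of the small ones, so there are at most \<open>D^m\<close> of them.\<close>

lemma ball_meets_finitely_many:
  assumes x: "x \<in> space M" and r: "0 < r"
  shows "finite {Q \<in> \<D> k. Q \<inter> qball M \<rho> x r \<noteq> {}}"
proof -
  obtain \<delta> C0 :: real and xc where \<delta>: "1 < \<delta>" and C0: "0 < C0" and xc: "\<And>k Q. Q \<in> \<D> k \<Longrightarrow> xc Q \<in> space M"
    and inner: "\<And>k Q. Q \<in> \<D> k \<Longrightarrow> qball M \<rho> (xc Q) (\<delta> powi k) \<subseteq> Q"
    and outer: "\<And>k Q. Q \<in> \<D> k \<Longrightarrow> Q \<subseteq> qball M \<rho> (xc Q) (C0 * \<delta> powi k)"
    by (rule cube_centres) (rule that)
  obtain \<kappa> where \<kappa>: "0 < \<kappa>" and tri: "\<And>x y z. x \<in> space M \<Longrightarrow> y \<in> space M \<Longrightarrow> z \<in> space M \<Longrightarrow> \<rho> x z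
      \<le> \<kappa> * (\<rho> x y + \<rho> y z)"
    by (rule quasi_triangle) (rule that)
  obtain D where D: "D < top" and doubling: "\<And>x r. x \<in> space M \<Longrightarrow> 0 < r
      \<Longrightarrow> emeasure M (qball M \<rho> x (2 * r)) \<le> D * emeasure M (qball M \<rho> x r)"
    by (rule doubling_const) (rule that)
  define t where "t = \<delta> powi k"
  have t: "0 < t" using \<delta> by (simp add: t_def)
  define a where "a = \<kappa> * (r + C0 * t)"
  have a: "0 < a" unfolding a_def using \<kappa> r C0 t by (intro mult_pos_pos add_pos_pos)
  define R where "R = \<kappa> * (a + t)"
  have R: "0 < R" unfolding R_def using \<kappa> a t by (intro mult_pos_pos add_pos_pos)
  \<comment> \<open>The ball of radius \<open>R\<close> about \<open>x\<close> contains all the small balls,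
      and \<open>m\<close> doublings of any small ball contain it.\<close>
  obtain m where "\<kappa> * (a + R) / t < 2 ^ m" using real_arch_pow[of 2] by auto
  then have m: "\<kappa> * (a + R) \<le> 2 ^ m * t" using t by (simp add: field_simps)
  let ?V = "emeasure M (qball M \<rho> x R)"
  let ?b = "\<lambda>Q. qball M \<rho> (xc Q) t"
  define \<F> where "\<F> = {Q \<in> \<D> k. Q \<inter> qball M \<rho> x r \<noteq> {}}"
  have centre: "\<rho> x (xc Q) < a" if Q: "Q \<in> \<F>" for Q
  proof -
    from Q have QD: "Q \<in> \<D> k" by (simp add: \<F>_def)
    from Q obtain y where y: "y \<in> Q" "y \<in> qball M \<rho> x r" by (auto simp: \<F>_def)
    then have y': "y \<in> space M" "\<rho> x y < r" "\<rho> (xc Q) y < C0 * t"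
      using outer[OF QD] by (auto simp: qball_def t_def)
    have "\<rho> x (xc Q) \<le> \<kappa> * (\<rho> x y + \<rho> y (xc Q))" using x y'(1) xc[OF QD] by (rule tri)
    also have "\<dots> < a" unfolding a_def quasi_sym[OF y'(1) xc[OF QD]]
      using y' \<kappa> by (intro mult_strict_left_mono) auto
    finally show ?thesis .
  qed
  have sub: "?b Q \<subseteq> qball M \<rho> x R" if Q: "Q \<in> \<F>" for Q
  proof
    have QD: "Q \<in> \<D> k" using Q by (simp add: \<F>_def)
    fix z assume "z \<in> ?b Q"
    then have z: "z \<in> space M" "\<rho> (xc Q) z < t" by (auto simp: qball_def)
    have "\<rho> x z \<le> \<kappa> * (\<rho> x (xc Q) + \<rho> (xc Q) z)" using x xc[OF QD] z(1) by (rule tri)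
    also have "\<dots> < R" unfolding R_def using centre[OF Q] z \<kappa> by (intro mult_strict_left_mono) auto
    finally show "z \<in> qball M \<rho> x R" using z by (simp add: qball_def)
  qed
  have large: "?V \<le> D ^ m * emeasure M (?b Q)" if Q: "Q \<in> \<F>" for Q
  proof -
    have QD: "Q \<in> \<D> k" using Q by (simp add: \<F>_def)
    have "qball M \<rho> x R \<subseteq> qball M \<rho> (xc Q) (2 ^ m * t)"
    proof
      fix z assume "z \<in> qball M \<rho> x R"
      then have z: "z \<in> space M" "\<rho> x z < R" by (auto simp: qball_def)
      have "\<rho> (xc Q) z \<le> \<kappa> * (\<rho> (xc Q) x + \<rho> x z)" using xc[OF QD] x z(1) by (rule tri)
      also have "\<dots> < \<kappa> * (a + R)" unfolding quasi_sym[OF xc[OF QD] x]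
        using centre[OF Q] z \<kappa> by (intro mult_strict_left_mono) auto
      finally show "z \<in> qball M \<rho> (xc Q) (2 ^ m * t)" using z m by (simp add: qball_def)
    qed
    then have "?V \<le> emeasure M (qball M \<rho> (xc Q) (2 ^ m * t))"
      using xc[OF QD] t by (intro emeasure_mono qball_sets) auto
    also have "\<dots> \<le> D ^ m * emeasure M (?b Q)"
      using doubling xc[OF QD] t by (intro doubling_iterated) auto
    finally show ?thesis .
  qed
  have V: "?V \<noteq> 0" "?V \<noteq> top" using ball_measure[OF x R] by auto
  have bound: "of_nat (card \<G>) \<le> D ^ m" if \<G>: "\<G> \<subseteq> \<F>" "finite \<G>" for \<G>
  proof -
    have disj: "disjoint_family_on ?b \<G>"
      unfolding disjoint_family_on_def
    proof (intro ballI impI)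
      fix Q Q' assume "Q \<in> \<G>" "Q' \<in> \<G>" "Q \<noteq> Q'"
      moreover from this have "Q \<in> \<D> k" "Q' \<in> \<D> k" using \<G> by (auto simp: \<F>_def)
      ultimately show "?b Q \<inter> ?b Q' = {}"
        using same_generation_disjoint[of Q k Q'] inner[of Q k] inner[of Q' k] unfolding t_def by blast
    qed
    have meas: "?b ` \<G> \<subseteq> sets M" using \<G> xc t by (auto simp: \<F>_def intro!: qball_sets)
    have "of_nat (card \<G>) * ?V = (\<Sum>Q\<in>\<G>. ?V)" by simp
    also have "\<dots> \<le> (\<Sum>Q\<in>\<G>. D ^ m * emeasure M (?b Q))" using \<G> large by (intro sum_mono) auto
    also have "\<dots> = D ^ m * emeasure M (\<Union>Q\<in>\<G>. ?b Q)"
      unfolding sum_emeasure[OF meas disj \<G>(2), symmetric] by (simp add: sum_distrib_left)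
    also have "\<dots> \<le> D ^ m * ?V"
      using sub \<G> x R by (intro mult_left_mono emeasure_mono qball_sets) auto
    finally have "of_nat (card \<G>) * ?V / ?V \<le> D ^ m * ?V / ?V" by (rule divide_right_mono_ennreal)
    then show ?thesis using V by (simp add: mult_divide_eq_ennreal)
  qed
  have "D ^ m < top" using D by (simp add: power_less_top_ennreal)
  then have "D ^ m < (SUP n::nat. of_nat n)" by (simp only: ennreal_SUP_of_nat_eq_top)
  then obtain n :: nat where n: "D ^ m < of_nat n"
    by (rule less_SUP_iff[THEN iffD1, THEN bexE]) (rule that)
  show ?thesis
  proof (rule ccontr)
    assume "infinite {Q \<in> \<D> k. Q \<inter> qball M \<rho> x r \<noteq> {}}"
    then have "infinite \<F>" by (simp only: \<F>_def not_False_eq_True)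
    from infinite_arbitrarily_large[OF this, of n]
    obtain \<G> where "finite \<G>" "card \<G> = n" "\<G> \<subseteq> \<F>" by (elim exE conjE)
    then show False using bound[of \<G>] n by (simp add: leD)
  qed
qed

lemma countable_cubes: "countable (cubes \<D>)"
proof -
  obtain x where x: "x \<in> space M" using homogeneous unfolding space_of_homogeneous_type_def by blast
  have "countable (\<D> k)" for k
  proof -
    have "\<D> k \<subseteq> (\<Union>n::nat. {Q \<in> \<D> k. Q \<inter> qball M \<rho> x (real (Suc n)) \<noteq> {}})"
    proof
      fix Q assume Q: "Q \<in> \<D> k"
      obtain \<delta> C0 :: real and xc where \<delta>: "1 < \<delta>" and "0 < C0" and xc: "\<And>k Q. Q \<in> \<D> k \<Longrightarrow> xc Q \<in> space M"
        and inner: "\<And>k Q. Q \<in> \<D> k \<Longrightarrow> qball M \<rho> (xc Q) (\<delta> powi k) \<subseteq> Q"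
        and "\<And>k Q. Q \<in> \<D> k \<Longrightarrow> Q \<subseteq> qball M \<rho> (xc Q) (C0 * \<delta> powi k)"
        by (rule cube_centres) (rule that)
      have "xc Q \<in> qball M \<rho> (xc Q) (\<delta> powi k)" using xc[OF Q] \<delta> by (simp add: qball_def quasi_refl)
      then have "xc Q \<in> Q" using inner[OF Q] by auto
      obtain n :: nat where "\<rho> x (xc Q) < real n" using reals_Archimedean2 by auto
      then have "xc Q \<in> qball M \<rho> x (real (Suc n))" using xc[OF Q] by (simp add: qball_def)
      with \<open>xc Q \<in> Q\<close> Q show "Q \<in> (\<Union>n::nat. {Q \<in> \<D> k. Q \<inter> qball M \<rho> x (real (Suc n)) \<noteq> {}})" by blast
    qed
    moreover have "countable (\<Union>n::nat. {Q \<in> \<D> k. Q \<inter> qball M \<rho> x (real (Suc n)) \<noteq> {}})"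
      using ball_meets_finitely_many[OF x] by (intro countable_UN countableI_type countable_finite) auto
    ultimately show ?thesis by (rule countable_subset)
  qed
  then show ?thesis by (simp add: cubes_def)
qed

lemma cube_measure:
  assumes "Q \<in> cubes \<D>"
  shows "emeasure M Q \<noteq> 0" "emeasure M Q \<noteq> top"
proof -
  obtain k where Q: "Q \<in> \<D> k" using assms by (auto simp: cubes_def)
  obtain \<delta> C0 :: real and xc where \<delta>: "1 < \<delta>" and C0: "0 < C0" and xc: "\<And>k Q. Q \<in> \<D> k \<Longrightarrow> xc Q \<in> space M"
    and inner: "\<And>k Q. Q \<in> \<D> k \<Longrightarrow> qball M \<rho> (xc Q) (\<delta> powi k) \<subseteq> Q"
    and outer: "\<And>k Q. Q \<in> \<D> k \<Longrightarrow> Q \<subseteq> qball M \<rho> (xc Q) (C0 * \<delta> powi k)"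
    by (rule cube_centres) (rule that)
  have t: "0 < \<delta> powi k" using \<delta> by simp
  have "emeasure M (qball M \<rho> (xc Q) (\<delta> powi k)) \<le> emeasure M Q"
    using inner[OF Q] assms cubes_measurable by (intro emeasure_mono) auto
  then show "emeasure M Q \<noteq> 0" using ball_measure(1)[OF xc[OF Q] t] by auto
  have "emeasure M Q \<le> emeasure M (qball M \<rho> (xc Q) (C0 * \<delta> powi k))"
    using outer[OF Q] xc[OF Q] t C0 by (intro emeasure_mono qball_sets) auto
  then show "emeasure M Q \<noteq> top" using ball_measure(2)[OF xc[OF Q], of "C0 * \<delta> powi k"] t C0
      by (auto simp: top_unique)
qed

sublocale dyadic_family M \<D>
proof
  show "space M \<noteq> {}" using homogeneous by (simp add: space_of_homogeneous_type_def)
  show "\<Union>(cubes \<D>) = space M" 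
  proof -
    have "\<Union>(cubes \<D>) = (\<Union>k. \<Union>(\<D> k))" unfolding cubes_def by blast
    also have "\<dots> = (\<Union>k::int. space M)" by (intro SUP_cong refl) (rule generation_covers[symmetric])
    finally show ?thesis by simp
  qed
qed (use countable_cubes cubes_measurable cubes_nested cube_measure in auto)

text \<open>Integrability over balls follows from integrability over cubes, because finitely many cubes of generation zero cover a ball, and
integrability over cubes is a consequence of the finite \<open>A_p\<close> constant.\<close>

lemma Ap_weightsI:
  assumes p: "1 \<le> p" and [measurable]: "w \<in> borel_measurable M"
    and nonneg: "\<And>x. x \<in> space M \<Longrightarrow> 0 \<le> w x" and pos: "AE x in M. 0 < w x"
    and fin: "Ap_const M \<D> p w < top"
  shows "w \<in> Ap_weights M \<rho> \<D> p"
proof -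
  have "(\<integral>\<^sup>+y\<in>qball M \<rho> x r. ennreal (w y) \<partial>M) < top" if x: "x \<in> space M" and r: "0 < r" for x r
  proof -
    define \<G> where "\<G> = {Q \<in> \<D> 0. Q \<inter> qball M \<rho> x r \<noteq> {}}"
    have \<G>: "finite \<G>" "\<G> \<subseteq> cubes \<D>"
      using ball_meets_finitely_many[OF x r] by (auto simp: \<G>_def cubes_def)
    have cov: "qball M \<rho> x r \<subseteq> \<Union>\<G>"
    proof
      fix y assume y: "y \<in> qball M \<rho> x r"
      then have "y \<in> \<Union>(\<D> 0)" using generation_covers[of 0] by (auto simp: qball_def)
      with y show "y \<in> \<Union>\<G>" by (auto simp: \<G>_def)
    qed
    have "(\<integral>\<^sup>+y\<in>qball M \<rho> x r. ennreal (w y) \<partial>M) \<le> (\<integral>\<^sup>+y. (\<Sum>Q\<in>\<G>. ennreal (w y) * indicator Q y) \<partial>M)"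
    proof (rule nn_integral_mono)
      fix y
      show "ennreal (w y) * indicator (qball M \<rho> x r) y \<le> (\<Sum>Q\<in>\<G>. ennreal (w y) * indicator Q y)"
      proof (cases "y \<in> qball M \<rho> x r")
        case True
        then obtain Q where "Q \<in> \<G>" "y \<in> Q" using cov by blast
        then show ?thesis using member_le_sum[of Q \<G> "\<lambda>Q. ennreal (w y) * indicator Q y"] \<G>(1)
            by (auto simp: indicator_def)
      qed simp
    qed
    also have "\<dots> = (\<Sum>Q\<in>\<G>. \<integral>\<^sup>+y\<in>Q. ennreal (w y) \<partial>M)"
      using \<G> cubes_measurable by (intro nn_integral_sum) auto
    also have "\<dots> < top"
      using \<G> Ap_const_finite_imp_integrable[OF p _ pos fin] by (auto simp: subset_iff)
    finally show ?thesis .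
  qed
  then show ?thesis using nonneg pos fin by (simp add: Ap_weights_def weight_def)
qed

end

section \<open>The extrapolation theorem\<close>

text \<open>The factor lost in the norm estimate: the \<open>p\<close>-th root of the constants in \<open>extrapolate_down\<close> and \<open>extrapolate_up\<close>.\<close>

definition norm_const :: "real \<Rightarrow> real \<Rightarrow> real" where
  "norm_const p0 p =
     (if p < p0 then (2 * 2 powr p) powr (1 / p)
      else if p = p0 then 1
      else ((2 * 2 powr conj_exp p) powr ((p - p0) / p0)) powr (1 / p))"

text \<open>The factor in front of the power of \<open>[w]\<close> once the norm of the maximal operator in the argument of \<open>N\<close> is replaced by
Buckley's bound.\<close>

definition scale_const :: "real \<Rightarrow> real \<Rightarrow> real" where
  "scale_const p0 p =
     (if p < p0 then (2 * buckley_const p powr (1 / p)) powr (p0 - p)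
      else if p = p0 then 1
      else (2 * buckley_const p powr (1 / conj_exp p)) powr ((p - p0) / (p - 1)))"

lemma one_le_powr_mult: "1 \<le> x \<Longrightarrow> 1 \<le> y \<Longrightarrow> 0 \<le> a \<Longrightarrow> 1 \<le> x * (2 * y) powr (a::real)"
  using mult_mono[of 1 x 1 "(2 * y) powr a"] by (simp add: ge_one_powr_ge_zero)

context homogeneous_dyadic
begin

lemma Ap_const_one: 
  assumes "1 \<le> p" shows "Ap_const M \<D> p (\<lambda>x. 1) \<le> 1"
proof (cases "p = 1")
  case True
  have "avg M Q (\<lambda>x. 1) * esssup (restrict_space M Q) (\<lambda>x. inverse (ennreal 1)) \<le> 1"
      if Q: "Q \<in> cubes \<D>" for Q
    using esssup_I[of "\<lambda>x. 1 :: ennreal" "restrict_space M Q" 1] Q by (simp add: avg_one)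
  then show ?thesis unfolding Ap_const_def if_P[OF True] by (rule SUP_least)
next
  case False
  then show ?thesis using assms by (intro Ap_const_least) (auto simp: avg_one)
qed

text \<open>The number \<open>t\<close> is the argument of \<open>N\<close> in \<open>K(w)\<close>. The estimate for \<open>w\<close> follows from the estimates for those weights
of \<open>A_p0\<close> whose constant is at most \<open>t\<close>, and Buckley's bound converts \<open>t\<close> into a power of \<open>[w]\<close>: the exponents add up to
\<open>1 + (p0 - p) / (p - 1) = (p0 - 1) / (p - 1)\<close> for \<open>p < p0\<close>, and to \<open>\<theta> + (1 - \<theta>) = 1\<close> for \<open>p > p0\<close>.\<close>

lemma extrapolation_single_weight:
  assumes p: "1 < p" and p0: "1 \<le> p0" and w: "w \<in> Ap_weights M \<rho> \<D> p"
  shows "\<exists>t\<ge>1. (\<forall>N. extrap_K M \<D> N p0 p w = N t)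
    \<and> t \<le> scale_const p0 p * Ap_real M \<D> p w powr max 1 ((p0 - 1) / (p - 1))
    \<and> (\<forall>f g K. f \<in> borel_measurable M \<longrightarrow> g \<in> borel_measurable M \<longrightarrow> 0 \<le> K \<longrightarrow>
         (\<forall>W\<in>Ap_weights M \<rho> \<D> p0. Ap_const M \<D> p0 W \<le> ennreal t \<longrightarrow>
            Lp_norm M p0 W g \<le> ennreal K * Lp_norm M p0 W f) \<longrightarrow>
         Lp_norm M p w g \<le> ennreal (K * norm_const p0 p) * Lp_norm M p w f)"
proof -
  have w_meas[measurable]: "w \<in> borel_measurable M" and w_nonneg: "\<And>x. x \<in> space M \<Longrightarrow> 0 \<le> w x"
    and w_pos: "AE x in M. 0 < w x" and w_fin: "Ap_const M \<D> p w < top"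
    using w by (auto simp: Ap_weights_def weight_def)
  define A where "A = Ap_real M \<D> p w"
  have A: "Ap_const M \<D> p w = ennreal A" "0 \<le> A" using w_fin by (simp_all add: A_def less_top)
  have A1: "1 \<le> A"
    using one_le_Ap_const[of p w] p w_pos A by (simp add: ennreal_le_iff2 flip: ennreal_1)
  have integral_form: "(\<integral>\<^sup>+x. ennpowr (g x) p0 * ennreal (W x) \<partial>M)
      \<le> ennreal (K powr p0) * (\<integral>\<^sup>+x. ennpowr (f x) p0 * ennreal (W x) \<partial>M)"
    if hyp: "\<forall>W\<in>Ap_weights M \<rho> \<D> p0. Ap_const M \<D> p0 W \<le> ennreal t \<longrightarrow> Lp_norm M p0 W g
        \<le> ennreal K * Lp_norm M p0 W f"
      and "0 \<le> K" and W: "W \<in> borel_measurable M" "\<And>x. x \<in> space M \<Longrightarrow> 0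
          \<le> W x" "AE x in M. 0 < W x" "Ap_const M \<D> p0 W \<le> ennreal t"
    for t K f g W
  proof -
    have "W \<in> Ap_weights M \<rho> \<D> p0"
      using W p0 by (intro Ap_weightsI) (auto intro: le_less_trans)
    with hyp W(4) have "Lp_norm M p0 W g \<le> ennreal K * Lp_norm M p0 W f" by blast
    then have "(\<integral>\<^sup>+x. ennpowr (g x) p0 * ennreal (W x) \<partial>M) \<le> ennpowr (ennreal K * Lp_norm M p0 W f) p0"
      using p0 by (simp add: Lp_norm_def ennpowr_le_iff)
    then show ?thesis using p0 \<open>0 \<le> K\<close> by (simp add: Lp_norm_def ennpowr_mult)
  qed
  have unweighted: "(\<integral>\<^sup>+x. ennpowr (g x) p0 \<partial>M) \<le> ennreal (K powr p0) * (\<integral>\<^sup>+x. ennpowr (f x) p0 \<partial>M)"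
    if hyp: "\<forall>W\<in>Ap_weights M \<rho> \<D> p0. Ap_const M \<D> p0 W \<le> ennreal t \<longrightarrow> Lp_norm M p0 W g
        \<le> ennreal K * Lp_norm M p0 W f"
      and K: "0 \<le> K" and t: "1 \<le> t" for t K f g
  proof -
    have "Ap_const M \<D> p0 (\<lambda>x. 1) \<le> ennreal t"
      using Ap_const_one[OF p0] t by (auto simp flip: ennreal_1 intro: order_trans ennreal_leI)
    then show ?thesis using integral_form[OF hyp K, of "\<lambda>x. 1"] by simp
  qed
  consider "p < p0" | "p = p0" | "p0 < p" by linarith
  then show ?thesis
  proof cases
    case 1
    obtain B where B: "1 \<le> B" "maximal_norm M \<D> p w = ennreal B" "B
        \<le> buckley_const p powr (1 / p) * A powr (1 / (p - 1))"
      using maximal_norm_Ap[OF p w_meas w_pos A] by auto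
    define t where "t = A * (2 * B) powr (p0 - p)"
    have t1: "1 \<le> t" unfolding t_def using A1 B(1) 1 by (intro one_le_powr_mult) auto
    have "t \<le> scale_const p0 p * A powr max 1 ((p0 - 1) / (p - 1))"
    proof -
      have "(2 * B) powr (p0 - p)
          \<le> (2 * buckley_const p powr (1 / p) * A powr (1 / (p - 1))) powr (p0 - p)"
        using 1 B by (intro powr_mono2) auto
      also have "\<dots> = scale_const p0 p * A powr ((p0 - p) / (p - 1))"
        using 1 by (simp add: scale_const_def powr_mult powr_powr)
      finally have "t \<le> A * (scale_const p0 p * A powr ((p0 - p) / (p - 1)))"
        unfolding t_def using A(2) by (rule mult_left_mono)
      also have "\<dots> = scale_const p0 p * A powr (1 + (p0 - p) / (p - 1))"
        using A1 by (simp add: powr_add)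
      also have "1 + (p0 - p) / (p - 1) = max 1 ((p0 - 1) / (p - 1))"
        using p 1 by (simp add: field_simps max_def)
      finally show ?thesis .
    qed
    moreover have "extrap_K M \<D> N p0 p w = N t" for N
      using 1 B by (simp add: extrap_K_def t_def A_def)
    moreover have "Lp_norm M p w g \<le> ennreal (K * norm_const p0 p) * Lp_norm M p w f"
      if [measurable]: "f \<in> borel_measurable M" "g \<in> borel_measurable M" and K: "0 \<le> K"
        and hyp: "\<forall>W\<in>Ap_weights M \<rho> \<D> p0. Ap_const M \<D> p0 W \<le> ennreal t \<longrightarrow> Lp_norm M p0 W g
            \<le> ennreal K * Lp_norm M p0 W f"
      for f g K
    proof -
      have "Lp_norm M p w g \<le> ennreal (K * (2 * 2 powr p) powr (1 / p)) * Lp_norm M p w f"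
      proof (rule extrapolation_closing[where ?p0.0
          = p0, OF _ _ _ w_pos _ _ unweighted[OF hyp K t1] _ K])
        assume "(\<integral>\<^sup>+x. ennpowr (f x) p * ennreal (w x) \<partial>M) \<noteq> 0" "(\<integral>\<^sup>+x. ennpowr (f x) p * ennreal (w x) \<partial>M) \<noteq> top"
        with integral_form[OF hyp K] B(1) K show "(\<integral>\<^sup>+x. ennpowr (g x) p * ennreal (w x) \<partial>M)
            \<le> ennreal (K powr p * (2 * 2 powr p)) * (\<integral>\<^sup>+x. ennpowr (f x) p * ennreal (w x) \<partial>M)"
          by (intro extrapolate_down[OF p 1 _ w_nonneg w_pos A B(2)]) (auto simp: t_def)
      qed (use p p0 in auto)
      then show ?thesis using 1 by (simp add: norm_const_def)
    qed
    ultimately show ?thesis using t1 unfolding A_def by blast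
  next
    case 2
    have "Lp_norm M p w g \<le> ennreal (K * norm_const p0 p) * Lp_norm M p w f"
      if "\<forall>W\<in>Ap_weights M \<rho> \<D> p0. Ap_const M \<D> p0 W \<le> ennreal A \<longrightarrow> Lp_norm M p0 W g
          \<le> ennreal K * Lp_norm M p0 W f"
      for f g K
      using that w A 2 by (simp add: norm_const_def)
    moreover have "A \<le> scale_const p0 p * A powr max 1 ((p0 - 1) / (p - 1))"
      using 2 A1 p by (simp add: scale_const_def)
    moreover have "extrap_K M \<D> N p0 p w = N A" for N
      using 2 by (simp add: extrap_K_def A_def)
    ultimately show ?thesis using A1 unfolding A_def by blast
  next
    case 3
    define q where "q = conj_exp p"
    define \<theta> where "\<theta> = (p0 - 1) / (p - 1)"
    have \<theta>: "(p - p0) / (p - 1) = 1 - \<theta>" "0 \<le> \<theta>" "\<theta> \<le> 1" using p p0 3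
        by (simp_all add: \<theta>_def field_simps)
    obtain B where B: "1 \<le> B" "maximal_norm M \<D> q (\<lambda>x. w x powr (1 - q)) = ennreal B" "B
        \<le> buckley_const p powr (1 / q) * A"
      using maximal_norm_dual[OF p w_meas w_pos A] by (auto simp: q_def)
    define t where "t = A powr \<theta> * (2 * B) powr (1 - \<theta>)"
    have t1: "1 \<le> t" unfolding t_def using A1 B(1) \<theta>
        by (intro one_le_powr_mult) (auto simp: ge_one_powr_ge_zero)
    have "t \<le> scale_const p0 p * A powr max 1 ((p0 - 1) / (p - 1))"
    proof -
      have "(2 * B) powr (1 - \<theta>) \<le> (2 * buckley_const p powr (1 / q) * A) powr (1 - \<theta>)"
        using B \<theta> by (intro powr_mono2) auto
      also have "\<dots> = scale_const p0 p * A powr (1 - \<theta>)"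
        using 3 A(2) by (simp add: scale_const_def powr_mult q_def \<theta>(1))
      finally have "t \<le> A powr \<theta> * (scale_const p0 p * A powr (1 - \<theta>))"
        unfolding t_def by (rule mult_left_mono) simp
      also have "\<dots> = scale_const p0 p * A powr (\<theta> + (1 - \<theta>))"
        by (simp only: powr_add ac_simps)
      also have "\<theta> + (1 - \<theta>) = max 1 ((p0 - 1) / (p - 1))"
        using \<theta>(3) by (simp add: \<theta>_def)
      finally show ?thesis .
    qed
    moreover have "extrap_K M \<D> N p0 p w = N t" for N
      using 3 B by (simp add: extrap_K_def t_def A_def \<theta>(1)[symmetric] q_def) (simp add: \<theta>_def)
    moreover have "Lp_norm M p w g \<le> ennreal (K * norm_const p0 p) * Lp_norm M p w f"
      if [measurable]: "f \<in> borel_measurable M" "g \<in> borel_measurable M" and K: "0 \<le> K"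
        and hyp: "\<forall>W\<in>Ap_weights M \<rho> \<D> p0. Ap_const M \<D> p0 W \<le> ennreal t \<longrightarrow> Lp_norm M p0 W g
            \<le> ennreal K * Lp_norm M p0 W f"
      for f g K
    proof -
      have "Lp_norm M p w g \<le> ennreal (K * ((2 * 2 powr conj_exp p) powr ((p - p0) / p0)) powr (1 / p)) * Lp_norm M p w f"
      proof (rule extrapolation_closing[where ?p0.0
          = p0, OF _ _ _ w_pos _ _ unweighted[OF hyp K t1] _ K])
        have B0: "0 < B" using B(1) by simp
        have t_eq: "A powr ((p0 - 1) / (p - 1)) * (2 * B) powr ((p - p0) / (p - 1)) = t"
          unfolding \<theta>(1) by (simp add: t_def \<theta>_def)
        show "(\<integral>\<^sup>+x. ennpowr (g x) p * ennreal (w x) \<partial>M)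
            \<le> ennreal (K powr p * (2 * 2 powr conj_exp p) powr ((p - p0) / p0)) * (\<integral>\<^sup>+x. ennpowr (f x) p * ennreal (w x) \<partial>M)"
          by (rule extrapolate_up[OF p0 3 _ w_pos A B(2)[unfolded q_def] B0 _ _ _ K])
            (use integral_form[OF hyp K] in \<open>auto simp: t_eq\<close>)
      qed (use p p0 in auto)
      then show ?thesis using 3 by (simp add: norm_const_def)
    qed
    ultimately show ?thesis using t1 unfolding A_def by blast
  qed
qed

text \<open>Monotonicity of \<open>N\<close> on \<open>[1, \<infinity>)\<close> replaces \<open>N([W])\<close> by \<open>N(t)\<close> for all weights with \<open>[W] \<le> t\<close>, so that \<open>C N(t)\<close> can be used as the
common constant \<open>K\<close>.\<close>

lemma weighted_estimate_extrapolation: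
  assumes p: "1 < p" and p0: "1 \<le> p0"
    and F: "\<forall>(f, g)\<in>F. f \<in> borel_measurable M \<and> g \<in> borel_measurable M"
    and N: "mono_on {1..} N" "\<forall>t\<ge>1. 0 \<le> N t" and C: "0 \<le> C"
    and est: "weighted_estimate M \<rho> \<D> F p0 C (\<lambda>w. N (Ap_real M \<D> p0 w))"
  shows "weighted_estimate M \<rho> \<D> F p (C * norm_const p0 p) (\<lambda>w. extrap_K M \<D> N p0 p w)"
  unfolding weighted_estimate_def
proof (intro ballI, clarify)
  fix w f g assume w: "w \<in> Ap_weights M \<rho> \<D> p" and fg: "(f, g) \<in> F"
  obtain t where t: "1 \<le> t" and K_eq: "extrap_K M \<D> N p0 p w = N t"
    and step: "\<And>f g K. f \<in> borel_measurable M \<Longrightarrow> g \<in> borel_measurable M \<Longrightarrow> 0 \<le> K \<Longrightarrow>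
         (\<forall>W\<in>Ap_weights M \<rho> \<D> p0. Ap_const M \<D> p0 W \<le> ennreal t \<longrightarrow>
            Lp_norm M p0 W g \<le> ennreal K * Lp_norm M p0 W f) \<Longrightarrow>
         Lp_norm M p w g \<le> ennreal (K * norm_const p0 p) * Lp_norm M p w f"
    using extrapolation_single_weight[OF p p0 w] by (elim exE conjE) metis
  have "Lp_norm M p0 W g \<le> ennreal (C * N t) * Lp_norm M p0 W f"
    if W: "W \<in> Ap_weights M \<rho> \<D> p0" and le: "Ap_const M \<D> p0 W \<le> ennreal t" for W
  proof -
    have "1 \<le> Ap_const M \<D> p0 W"
      using W p0 by (intro one_le_Ap_const) (auto simp: Ap_weights_def weight_def)
    then have "1 \<le> Ap_real M \<D> p0 W" "Ap_real M \<D> p0 W \<le> t"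
      using le t by (cases "Ap_const M \<D> p0 W"; auto simp: ennreal_le_iff2 top_unique simp flip: ennreal_1)+
    then have "N (Ap_real M \<D> p0 W) \<le> N t" using N(1) t by (auto simp: mono_on_def)
    have "Lp_norm M p0 W g \<le> ennreal (C * N (Ap_real M \<D> p0 W)) * Lp_norm M p0 W f"
      using est W fg by (auto simp: weighted_estimate_def)
    also have "\<dots> \<le> ennreal (C * N t) * Lp_norm M p0 W f"
      using \<open>N (Ap_real M \<D> p0 W) \<le> N t\<close> C by (intro mult_right_mono ennreal_leI mult_left_mono) auto
    finally show ?thesis .
  qed
  then have "Lp_norm M p w g \<le> ennreal (C * N t * norm_const p0 p) * Lp_norm M p w f"
    using F fg C N(2) t by (intro step) auto
  then show "Lp_norm M p w g \<le> ennreal (C * norm_const p0 p * extrap_K M \<D> N p0 p w) * Lp_norm M p w f"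
    by (simp add: K_eq ac_simps)
qed

lemma extrap_K_le:
  assumes p: "1 < p" and p0: "1 \<le> p0" and N: "mono_on {1..} N" and w: "w \<in> Ap_weights M \<rho> \<D> p"
  shows "extrap_K M \<D> N p0 p w
      \<le> N (max 1 (scale_const p0 p) * Ap_real M \<D> p w powr max 1 ((p0 - 1) / (p - 1)))"
proof -
  obtain t where t: "1 \<le> t" and K_eq: "extrap_K M \<D> N p0 p w = N t"
    and le: "t \<le> scale_const p0 p * Ap_real M \<D> p w powr max 1 ((p0 - 1) / (p - 1))"
    using extrapolation_single_weight[OF p p0 w] by blast
  note le
  also have "scale_const p0 p * Ap_real M \<D> p w powr max 1 ((p0 - 1) / (p - 1))
      \<le> max 1 (scale_const p0 p) * Ap_real M \<D> p w powr max 1 ((p0 - 1) / (p - 1))"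
    by (intro mult_right_mono) auto
  finally show ?thesis using t N by (auto simp: K_eq mono_on_def)
qed

end

theorem theorem3p5:
  fixes M :: "'a measure" and \<rho> :: "'a \<Rightarrow> 'a \<Rightarrow> real" and p0 :: real
  assumes "space_of_homogeneous_type M \<rho>"
    and "1 \<le> p0"
  shows "\<forall>p>1. \<exists>C1>0. \<exists>C2\<ge>1.
    \<forall>(\<D> :: int \<Rightarrow> 'a set set) (F :: (('a \<Rightarrow> ennreal) \<times> ('a \<Rightarrow> ennreal)) set)
      (N :: real \<Rightarrow> real) (C :: real).
      dyadic_decomposition M \<rho> \<D> \<longrightarrow>
      (\<forall>(f, g)\<in>F. f \<in> borel_measurable M \<and> g \<in> borel_measurable M) \<longrightarrow>
      mono_on {1..} N \<longrightarrow> (\<forall>t\<ge>1. 0 \<le> N t) \<longrightarrow> 0 \<le> C \<longrightarrow>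
      weighted_estimate M \<rho> \<D> F p0 C (\<lambda>w. N (Ap_real M \<D> p0 w)) \<longrightarrow>
      (\<exists>C'\<ge>0. weighted_estimate M \<rho> \<D> F p C' (\<lambda>w. extrap_K M \<D> N p0 p w)) \<and>
      (\<forall>w\<in>Ap_weights M \<rho> \<D> p.
         extrap_K M \<D> N p0 p w \<le>
           C1 * N (C2 * Ap_real M \<D> p w powr max 1 ((p0 - 1) / (p - 1))))"
proof (intro allI impI)
  fix p :: real assume p: "1 < p"
  have norm_const: "0 \<le> norm_const p0 p" by (simp add: norm_const_def)
  show "\<exists>C1>0. \<exists>C2\<ge>1.
    \<forall>(\<D> :: int \<Rightarrow> 'a set set) (F :: (('a \<Rightarrow> ennreal) \<times> ('a \<Rightarrow> ennreal)) set)
      (N :: real \<Rightarrow> real) (C :: real).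
      dyadic_decomposition M \<rho> \<D> \<longrightarrow>
      (\<forall>(f, g)\<in>F. f \<in> borel_measurable M \<and> g \<in> borel_measurable M) \<longrightarrow>
      mono_on {1..} N \<longrightarrow> (\<forall>t\<ge>1. 0 \<le> N t) \<longrightarrow> 0 \<le> C \<longrightarrow>
      weighted_estimate M \<rho> \<D> F p0 C (\<lambda>w. N (Ap_real M \<D> p0 w)) \<longrightarrow>
      (\<exists>C'\<ge>0. weighted_estimate M \<rho> \<D> F p C' (\<lambda>w. extrap_K M \<D> N p0 p w)) \<and>
      (\<forall>w\<in>Ap_weights M \<rho> \<D> p.
         extrap_K M \<D> N p0 p w \<le>
           C1 * N (C2 * Ap_real M \<D> p w powr max 1 ((p0 - 1) / (p - 1))))"
  proof (rule exI[of _ 1], rule conjI, simp, rule exI[of _ "max 1 (scale_const p0 p)"], rule conjI, simp, intro allI impI)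
    fix \<D> :: "int \<Rightarrow> 'a set set" and F :: "(('a \<Rightarrow> ennreal) \<times> ('a \<Rightarrow> ennreal)) set"
      and N :: "real \<Rightarrow> real" and C :: real
    assume "dyadic_decomposition M \<rho> \<D>"
      and F: "\<forall>(f, g)\<in>F. f \<in> borel_measurable M \<and> g \<in> borel_measurable M"
      and N: "mono_on {1..} N" "\<forall>t\<ge>1. 0 \<le> N t" and C: "0 \<le> C"
      and est: "weighted_estimate M \<rho> \<D> F p0 C (\<lambda>w. N (Ap_real M \<D> p0 w))"
    then interpret homogeneous_dyadic M \<rho> \<D>
      using assms(1) by unfold_locales
    show "(\<exists>C'\<ge>0. weighted_estimate M \<rho> \<D> F p C' (\<lambda>w. extrap_K M \<D> N p0 p w)) \<and>
      (\<forall>w\<in>Ap_weights M \<rho> \<D> p.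
         extrap_K M \<D> N p0 p w \<le>
           1 * N (max 1 (scale_const p0 p) * Ap_real M \<D> p w powr max 1 ((p0 - 1) / (p - 1))))"
      using weighted_estimate_extrapolation[OF p assms(2) F N C est] extrap_K_le[OF p assms(2) N(1)] C norm_const
      by (intro conjI exI[of _ "C * norm_const p0 p"]) auto
  qed
qed

end
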